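(* Let $\mathbb{G}$ be a stratified Lie group of homogeneous dimension $Q$, $\Omega\subset\mathbb{G}$ a bounded domain, $\lambda>0$, $0<s<1$, $0<\delta<1$, $1<p<Q$, $Q>ps$, $p<q+1<p_s^*:=\frac{Qp}{Q-sp}$, and let $f,g\in L^\infty(\Omega)$ be strictly positive. Suppose $u\in X_0^{s,p}(\Omega)$ is a nonnegative weak solution to the problem $$(-\Delta_{p,\mathbb{G}})^su=\frac{\lambda f(x)}{u^\delta}+g(x)u^q\ \text{ in }\Omega,\qquad u>0\ \text{ in }\Omega,\qquad u=0\ \text{ in }\mathbb{G}\setminus\Omega.$$ Then $u\in L^\infty(\Omega)$.
   Context: Stratified Lie group: a Lie group $\mathbb{G}=(\mathbb{R}^N,\circ)$ with identity $0$ such that (i) there is a decomposition $\mathbb{R}^N=\mathbb{R}^{N_1}\times\cdots\times\mathbb{R}^{N_k}$ for which, for every $\lambda>0$, the dilation $D_\lambda(x)=(\lambda x^{(1)},\lambda^2x^{(2)},\dots,\lambda^kx^{(k)})$, $x^{(i)}\in\mathbb{R}^{N_i}$, is an automorphism of $\mathbb{G}$; (ii) if $X_1,\dots,X_{N_1}$ are the left-invariant vector fields with $X_j(0)=\partial/\partial x_j|_0$, then the Lie algebra generated by $X_1,\dots,X_{N_1}$ has rank $N$ at every point. The homogeneous dimension is $Q=\sum_{i=1}^k iN_i$. The Haar measure $dx$ is Lebesgue measure on $\mathbb{R}^N$. We write $xy$ for $x\circ y$ and fix a homogeneous quasi-norm $|\cdot|$ on $\mathbb{G}$: a continuous function $|\cdot|:\mathbb{G}\to[0,\infty)$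 with $|x|=0$ iff $x=0$, $|x^{-1}|=|x|$, and $|D_\lambda x|=\lambda|x|$ for $\lambda>0$. A domain is a nonempty connected open set. Functions are real-valued. $[u]_{s,p,\mathbb{G}}:=\left(\iint_{\mathbb{G}\times\mathbb{G}}\frac{|u(x)-u(y)|^p}{|y^{-1}x|^{Q+ps}}\,dx\,dy\right)^{1/p}$. $X_0^{s,p}(\Omega)$ is the closure of $C_c^\infty(\Omega)$ with respect to the norm $\|u\|_{L^p(\Omega)}+[u]_{s,p,\mathbb{G}}$, functions being extended by $0$ to $\mathbb{G}\setminus\Omega$. The fractional $p$-sub-Laplacian is understood weakly: $$\langle(-\Delta_{p,\mathbb{G}})^su,\varphi\rangle=\iint_{\mathbb{G}\times\mathbb{G}}\frac{|u(x)-u(y)|^{p-2}(u(x)-u(y))(\varphi(x)-\varphi(y))}{|y^{-1}x|^{Q+ps}}\,dx\,dy.$$ Weak solution of the problem: $u\in X_0^{s,p}(\Omega)$ with $\operatorname{ess\,inf}_Ku\ge C_K>0$ for every compact $K\subset\Omega$ and $\langle(-\Delta_{p,\mathbb{G}})^su,\psi\rangle-\lambda\int_\Omega f u^{-\delta}\psi\,dx-\int_\Omega g u^q\psi\,dx=0$ for all $\psi\in C_c^\infty(\Omega)$. *)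

theory Defs
  imports "HOL-Probability.Essential_Supremum" "HOL-Analysis.Analysis"
begin

primrec Ck_on ::
  "nat \<Rightarrow> 'a::euclidean_space set \<Rightarrow> ('a \<Rightarrow> 'b::euclidean_space) \<Rightarrow> bool" where
  "Ck_on 0 S f \<longleftrightarrow> continuous_on S f"
| "Ck_on (Suc m) S f \<longleftrightarrow>
     (\<forall>x\<in>S. f differentiable (at x)) \<and> (\<forall>v. Ck_on m S (\<lambda>x. frechet_derivative f (at x) v))"

definition smooth :: "('a::euclidean_space \<Rightarrow> 'b::euclidean_space) \<Rightarrow> bool" where
  "smooth f \<longleftrightarrow> (\<forall>m. Ck_on m UNIV f)"

text \<open>Vector fields on \<open>\<real>\<^sup>N\<close> are identified with their coefficient maps, so that
  \<open>(X \<phi>)(x) = D\<phi>(x)(X x)\<close> and the commutator \<open>XY - YX\<close> has the coefficients below.\<close>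

definition lie_bracket ::
  "('a::euclidean_space \<Rightarrow> 'a) \<Rightarrow> ('a \<Rightarrow> 'a) \<Rightarrow> 'a \<Rightarrow> 'a" where
  "lie_bracket X Y = (\<lambda>x. frechet_derivative Y (at x) (X x) - frechet_derivative X (at x) (Y x))"

inductive_set lie_generated :: "('a::euclidean_space \<Rightarrow> 'a) set \<Rightarrow> ('a \<Rightarrow> 'a) set"
  for G :: "('a \<Rightarrow> 'a) set" where
  gen: "X \<in> G \<Longrightarrow> X \<in> lie_generated G"
| zero: "(\<lambda>x. 0) \<in> lie_generated G"
| add: "X \<in> lie_generated G \<Longrightarrow> Y \<in> lie_generated G \<Longrightarrow> (\<lambda>x. X x + Y x) \<in> lie_generated G"
| scale: "X \<in> lie_generated G \<Longrightarrow> (\<lambda>x. c *\<^sub>R X x) \<in> lie_generated G"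
| bracket: "X \<in> lie_generated G \<Longrightarrow> Y \<in> lie_generated G \<Longrightarrow> lie_bracket X Y \<in> lie_generated G"

definition left_invariant ::
  "('a::euclidean_space \<Rightarrow> 'a \<Rightarrow> 'a) \<Rightarrow> ('a \<Rightarrow> 'a) \<Rightarrow> bool" where
  "left_invariant mul X \<longleftrightarrow>
     smooth X \<and> (\<forall>a x. frechet_derivative (mul a) (at x) (X x) = X (mul a x))"

text \<open>The decomposition \<open>\<real>\<^sup>N = \<real>\<^bsup>N\<^sub>1\<^esup> \<times> \<dots> \<times> \<real>\<^bsup>N\<^sub>k\<^esup>\<close> is encoded by \<open>\<sigma>\<close>, which maps a coordinate to
  the number of the layer containing it; thus \<open>N\<^sub>i\<close> is the number of coordinates \<open>j\<close> with \<open>\<sigma> j = i\<close>.\<close>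

definition layer_dim :: "('n::finite \<Rightarrow> nat) \<Rightarrow> nat \<Rightarrow> nat" where
  "layer_dim \<sigma> i = card {j. \<sigma> j = i}"

definition homogeneous_dim :: "nat \<Rightarrow> ('n::finite \<Rightarrow> nat) \<Rightarrow> nat" where
  "homogeneous_dim k \<sigma> = (\<Sum>i=1..k. i * layer_dim \<sigma> i)"

definition dilation :: "('n::finite \<Rightarrow> nat) \<Rightarrow> real \<Rightarrow> real^'n \<Rightarrow> real^'n" where
  "dilation \<sigma> r x = (\<chi> j. r ^ \<sigma> j * x $ j)"

definition horizontal_fields ::
  "(real^'n \<Rightarrow> real^'n \<Rightarrow> real^'n) \<Rightarrow> ('n::finite \<Rightarrow> nat) \<Rightarrow> (real^'n \<Rightarrow> real^'n) set" where
  "horizontal_fields mul \<sigma> = {X. left_invariant mul X \<and> (\<exists>j. \<sigma> j = 1 \<and> X 0 = axis j 1)}"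

locale stratified_lie_group =
  group mul "0 :: real^'n" ginv
  for mul :: "real^'n::finite \<Rightarrow> real^'n \<Rightarrow> real^'n" and ginv :: "real^'n \<Rightarrow> real^'n" +
  fixes k :: nat and \<sigma> :: "'n \<Rightarrow> nat"
  assumes smooth_mul: "smooth (\<lambda>z. mul (fst z) (snd z))"
    and smooth_ginv: "smooth ginv"
    and layers: "\<sigma> j \<in> {1..k}"
    and dilation_bij: "r > 0 \<Longrightarrow> bij (dilation \<sigma> r)"
    and dilation_hom: "r > 0 \<Longrightarrow> dilation \<sigma> r (mul x y) = mul (dilation \<sigma> r x) (dilation \<sigma> r y)"
    and full_rank: "\<And>x. dim {X x | X. X \<in> lie_generated (horizontal_fields mul \<sigma>)} = CARD('n)"

definition homogeneous_quasi_norm ::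
  "(real^'n \<Rightarrow> real^'n) \<Rightarrow> ('n::finite \<Rightarrow> nat) \<Rightarrow> (real^'n \<Rightarrow> real) \<Rightarrow> bool" where
  "homogeneous_quasi_norm ginv \<sigma> \<rho> \<longleftrightarrow>
     continuous_on UNIV \<rho> \<and> (\<forall>x. \<rho> x \<ge> 0) \<and> (\<forall>x. \<rho> x = 0 \<longleftrightarrow> x = 0) \<and>
     (\<forall>x. \<rho> (ginv x) = \<rho> x) \<and> (\<forall>r>0. \<forall>x. \<rho> (dilation \<sigma> r x) = r * \<rho> x)"

definition Linfty :: "'a::euclidean_space set \<Rightarrow> ('a \<Rightarrow> real) set" where
  "Linfty \<Omega> = {f \<in> borel_measurable (lebesgue_on \<Omega>).
                 esssup (lebesgue_on \<Omega>) (\<lambda>x. ereal \<bar>f x\<bar>) < \<infinity>}"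

definition ess_inf :: "'a::euclidean_space set \<Rightarrow> ('a \<Rightarrow> real) \<Rightarrow> ereal" where
  "ess_inf K u = - esssup (lebesgue_on K) (\<lambda>x. - ereal (u x))"

definition Cc_infty :: "'a::euclidean_space set \<Rightarrow> ('a \<Rightarrow> real) set" where
  "Cc_infty \<Omega> = {\<phi>. smooth \<phi> \<and> compact (closure {x. \<phi> x \<noteq> 0}) \<and> closure {x. \<phi> x \<noteq> 0} \<subseteq> \<Omega>}"

definition ennreal_root :: "real \<Rightarrow> ennreal \<Rightarrow> ennreal" where
  "ennreal_root p I = (if I = \<infinity> then \<infinity> else ennreal (enn2real I powr (1 / p)))"

definition Lp_norm :: "real \<Rightarrow> 'a::euclidean_space set \<Rightarrow> ('a \<Rightarrow> real) \<Rightarrow> ennreal" where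
  "Lp_norm p \<Omega> u = ennreal_root p (\<integral>\<^sup>+x. ennreal (\<bar>u x\<bar> powr p) \<partial>lebesgue_on \<Omega>)"

definition frac_kernel ::
  "(real^'n \<Rightarrow> real^'n \<Rightarrow> real^'n) \<Rightarrow> (real^'n::finite \<Rightarrow> real^'n) \<Rightarrow> (real^'n \<Rightarrow> real) \<Rightarrow>
   real \<Rightarrow> real \<Rightarrow> real \<Rightarrow> real^'n \<Rightarrow> real^'n \<Rightarrow> real" where
  "frac_kernel mul ginv \<rho> Q s p x y = \<rho> (mul (ginv y) x) powr (Q + p * s)"

definition gagliardo ::
  "(real^'n \<Rightarrow> real^'n \<Rightarrow> real^'n) \<Rightarrow> (real^'n::finite \<Rightarrow> real^'n) \<Rightarrow> (real^'n \<Rightarrow> real) \<Rightarrow>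
   real \<Rightarrow> real \<Rightarrow> real \<Rightarrow> (real^'n \<Rightarrow> real) \<Rightarrow> ennreal" where
  "gagliardo mul ginv \<rho> Q s p u = ennreal_root p
     (\<integral>\<^sup>+(x, y). ennreal (\<bar>u x - u y\<bar> powr p / frac_kernel mul ginv \<rho> Q s p x y)
        \<partial>(lebesgue \<Otimes>\<^sub>M lebesgue))"

text \<open>Elements of \<open>X\<^sub>0\<^sup>s\<^sup>,\<^sup>p(\<Omega>)\<close> are represented by functions on the whole group that vanish almost
  everywhere outside \<open>\<Omega>\<close>.  Being in \<open>L\<^sup>p\<close> with finite seminorm is automatic, since the (extended
  nonnegative) norms of test functions are finite.\<close>

definition X0 ::
  "(real^'n \<Rightarrow> real^'n \<Rightarrow> real^'n) \<Rightarrow> (real^'n::finite \<Rightarrow> real^'n) \<Rightarrow> (real^'n \<Rightarrow> real) \<Rightarrow>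
   real \<Rightarrow> real \<Rightarrow> real \<Rightarrow> (real^'n) set \<Rightarrow> (real^'n \<Rightarrow> real) set" where
  "X0 mul ginv \<rho> Q s p \<Omega> = {u \<in> borel_measurable lebesgue.
     (AE x in lebesgue. x \<notin> \<Omega> \<longrightarrow> u x = 0) \<and>
     (\<forall>\<epsilon>>0. \<exists>\<phi>\<in>Cc_infty \<Omega>.
        Lp_norm p \<Omega> (\<lambda>x. u x - \<phi> x) + gagliardo mul ginv \<rho> Q s p (\<lambda>x. u x - \<phi> x) < ennreal \<epsilon>)}"

text \<open>Where \<open>u x = u y\<close> the integrand is \<open>0\<close>, also for \<open>p < 2\<close>.\<close>

definition frac_p_sublaplacian ::
  "(real^'n \<Rightarrow> real^'n \<Rightarrow> real^'n) \<Rightarrow> (real^'n::finite \<Rightarrow> real^'n) \<Rightarrow> (real^'n \<Rightarrow> real) \<Rightarrow>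
   real \<Rightarrow> real \<Rightarrow> real \<Rightarrow> (real^'n \<Rightarrow> real) \<Rightarrow> (real^'n \<Rightarrow> real) \<Rightarrow> real" where
  "frac_p_sublaplacian mul ginv \<rho> Q s p u \<phi> =
     (\<integral>(x, y). \<bar>u x - u y\<bar> powr (p - 2) * (u x - u y) * (\<phi> x - \<phi> y)
                / frac_kernel mul ginv \<rho> Q s p x y \<partial>(lebesgue \<Otimes>\<^sub>M lebesgue))"

definition weak_solution ::
  "(real^'n \<Rightarrow> real^'n \<Rightarrow> real^'n) \<Rightarrow> (real^'n::finite \<Rightarrow> real^'n) \<Rightarrow> (real^'n \<Rightarrow> real) \<Rightarrow>
   real \<Rightarrow> real \<Rightarrow> real \<Rightarrow> (real^'n) set \<Rightarrow>
   real \<Rightarrow> real \<Rightarrow> real \<Rightarrow> (real^'n \<Rightarrow> real) \<Rightarrow> (real^'n \<Rightarrow> real) \<Rightarrow> (real^'n \<Rightarrow> real) \<Rightarrow> bool" where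
  "weak_solution mul ginv \<rho> Q s p \<Omega> lam \<delta> q f g u \<longleftrightarrow>
     u \<in> X0 mul ginv \<rho> Q s p \<Omega> \<and>
     (\<forall>K. compact K \<and> K \<subseteq> \<Omega> \<longrightarrow> (\<exists>C>0. ereal C \<le> ess_inf K u)) \<and>
     (\<forall>\<psi>\<in>Cc_infty \<Omega>.
        frac_p_sublaplacian mul ginv \<rho> Q s p u \<psi>
        - lam * (\<integral>x. f x * u x powr (- \<delta>) * \<psi> x \<partial>lebesgue_on \<Omega>)
        - (\<integral>x. g x * u x powr q * \<psi> x \<partial>lebesgue_on \<Omega>) = 0)"

definition critical_exponent :: "real \<Rightarrow> real \<Rightarrow> real \<Rightarrow> real" where
  "critical_exponent Q s p = Q * p / (Q - s * p)"

end

theory Submission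
  imports Defs
begin

text \<open>With \<open>\<theta> = ps/Q\<close>, \<open>A\<^sub>k = {u > k}\<close> and \<open>E(w)\<close> the \<open>p\<close>-th power of the Gagliardo seminorm, the
  proof is De Giorgi's, without a Sobolev embedding. A gauge ball of measure \<open>2|A\<^sub>k|\<close> carries a kernel
  mass of order \<open>|A\<^sub>k|\<^sup>-\<^sup>\<theta>\<close> outside \<open>A\<^sub>k\<close>, so that \<open>(l - k)\<^sup>p |A\<^sub>l| \<le> C |A\<^sub>k|\<^sup>\<theta> E((u - k)\<^sub>+)\<close> for
  \<open>k < l\<close>. Since \<open>E((u - k)\<^sub>+) \<le> E(u)\<close>, this improves the integrability of \<open>u\<close> up to the exponent
  \<open>q + 1 < p\<^sub>s\<^sup>*\<close>. Testing the equation with \<open>(u - k)\<^sub>+\<close> then bounds \<open>E((u - k)\<^sub>+)\<close> by a multiple of the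
  integral of \<open>u\<close> to the power \<open>q + 1\<close> over \<open>A\<^sub>k\<close>; the same iteration yields all moments, and
  Stampacchia's lemma yields boundedness. The test function \<open>(u - k)\<^sub>+\<close> is reached from smooth
  truncations of test functions \<open>\<phi>\<^sub>n \<rightarrow> u\<close>: on the right-hand side \<open>h = \<lambda> f u\<^sup>-\<^sup>\<delta> + g u\<^sup>q\<close> the equation itself
  controls \<open>\<integral>h|\<phi>|\<close> by \<open>\<epsilon> E(u) + \<epsilon>\<^sup>1\<^sup>-\<^sup>p E(\<phi>)\<close>, and on the left Fatou's lemma suffices.\<close>

section \<open>Lebesgue measure under coordinate relabelling\<close>

text \<open>The equation may only be tested with compactly supported smooth functions, while u may
  tend to 0 at the boundary, so \<open>f x * u x powr (- \<delta>)\<close> need not be integrable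
  over \<Omega>. Energy convergence of \<phi>_n to u therefore says nothing by itself about the
  right-hand side h; what saves the limit is that the equation, tested with a smoothed |\<phi>|,
  bounds h-weighted integrals by energies. On the left, the truncations of \<phi>_n are not claimed
  to converge in energy; since only an upper bound for E((u - k)_+) is wanted, lower semicontinuity
  is enough.

  The critical exponent equals p / (1 - \<theta>), the fixed point of the map m -> p + m \<theta>
  that describes how the level inequality improves moments while the energies are merely bounded.
  Below it, each round gains a fixed amount. Levels start at k = 1 because there u^(-\<delta>) \<le>
  u^q, which makes the singular term subordinate to the power term.

  The exponent \<theta> comes from the volume r^Q of gauge balls. This needs left translations to
  preserve Lebesgue measure, which is derived here from the group axioms and the dilations.\<close>

text \<open>Change of variables in the library needs a well-ordered index type.\<close>

typedef ('n::finite) ordered_index = "{..<CARD('n)}"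
  using zero_less_card_finite by (metis lessThan_iff)

instance ordered_index :: (finite) finite
proof
  show "finite (UNIV :: 'a ordered_index set)"
    unfolding type_definition.univ[OF type_definition_ordered_index] by simp
qed

instantiation ordered_index :: (finite) linorder
begin

definition "x \<le> y \<longleftrightarrow> Rep_ordered_index x \<le> Rep_ordered_index y"
definition "x < y \<longleftrightarrow> Rep_ordered_index x < Rep_ordered_index y"

instance
  by standard (auto simp: less_eq_ordered_index_def less_ordered_index_def Rep_ordered_index_inject)

end

instance ordered_index :: (finite) wellorder
proof
  fix P :: "'a ordered_index \<Rightarrow> bool" and a
  assume step: "\<And>x. (\<And>y. y < x \<Longrightarrow> P y) \<Longrightarrow> P x"
  show "P a"
    by (induction a rule: measure_induct_rule[where f=Rep_ordered_index])
       (auto intro: step simp: less_ordered_index_def)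
qed

lemma ordered_index_bij: "\<exists>\<pi> :: 'n::finite \<Rightarrow> 'n ordered_index. bij \<pi>"
  by (intro finite_same_card_bij) (auto simp: type_definition.card[OF type_definition_ordered_index])

definition reindex :: "('n::finite \<Rightarrow> 'm::finite) \<Rightarrow> real^'m \<Rightarrow> real^'n" where
  "reindex \<pi> x = (\<chi> i. x $ \<pi> i)"

lemma linear_reindex: "linear (reindex \<pi>)"
  by (intro linearI) (simp_all add: reindex_def vec_eq_iff)

lemma reindex_inv:
  assumes "bij \<pi>"
  shows "reindex \<pi> (reindex (inv \<pi>) x) = x" "reindex (inv \<pi>) (reindex \<pi> y) = y"
  using assms by (simp_all add: reindex_def vec_eq_iff bij_is_inj inv_f_f bij_is_surj surj_f_inv_f)

text \<open>Relabelling coordinates maps boxes to boxes and only permutes the factors of their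
  volume, and Lebesgue measure is determined by its values on boxes.\<close>

lemma distr_lborel_reindex:
  fixes \<pi> :: "'n::finite \<Rightarrow> 'm::finite"
  assumes \<pi>: "bij \<pi>"
  shows "distr lborel borel (reindex \<pi>) = lborel"
proof (rule lborel_eqI[symmetric])
  have meas[measurable]: "reindex \<pi> \<in> borel_measurable borel"
    by (intro borel_measurable_continuous_onI linear_continuous_on linear_reindex[THEN linear_conv_bounded_linear[THEN iffD1]])
  have prodB: "(\<Prod>b\<in>Basis. (u - l) \<bullet> b) = (\<Prod>i\<in>UNIV. u $ i - l $ i)" for u l :: "real^'k::finite"
  proof -
    have B: "(Basis :: (real^'k) set) = range (\<lambda>i. axis i 1)" by (auto simp: Basis_vec_def)
    have "inj (\<lambda>i. axis i (1::real) :: real^'k)" by (auto simp: inj_on_def axis_eq_axis)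
    then show ?thesis unfolding B by (subst prod.reindex) (auto simp: inner_axis)
  qed
  fix l u :: "real^'n" assume lu: "\<And>b. b \<in> Basis \<Longrightarrow> l \<bullet> b \<le> u \<bullet> b"
  have le: "l $ i \<le> u $ i" for i using lu[of "axis i 1"] by (simp add: inner_axis axis_in_Basis_iff)
  have pre: "reindex \<pi> -` box l u = box (reindex (inv \<pi>) l) (reindex (inv \<pi>) u)"
    using \<pi> by (auto simp: mem_box_cart reindex_def bij_is_inj inv_f_f) (metis bij_inv_eq_iff)+
  have le': "\<And>b. b \<in> Basis \<Longrightarrow> reindex (inv \<pi>) l \<bullet> b \<le> reindex (inv \<pi>) u \<bullet> b"
    using le by (auto simp: Basis_vec_def inner_axis reindex_def)
  have "emeasure (distr lborel borel (reindex \<pi>)) (box l u)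
      = emeasure lborel (box (reindex (inv \<pi>) l) (reindex (inv \<pi>) u))"
    by (subst emeasure_distr) (auto simp: pre)
  also have "\<dots> = ennreal (\<Prod>i\<in>UNIV. u $ inv \<pi> i - l $ inv \<pi> i)"
    by (subst emeasure_lborel_box[OF le']) (auto simp: prodB reindex_def)
  also have "(\<Prod>i\<in>UNIV. u $ inv \<pi> i - l $ inv \<pi> i) = (\<Prod>i\<in>UNIV. u $ i - l $ i)"
    by (rule prod.reindex_bij_betw[OF bij_imp_bij_inv[OF \<pi>]])
  finally show "emeasure (distr lborel borel (reindex \<pi>)) (box l u) = (\<Prod>b\<in>Basis. (u - l) \<bullet> b)"
    by (simp add: prodB)
qed simp

section \<open>Smooth functions and test functions\<close>

lemma Ck_on_mono_order: "Ck_on (Suc m) S f \<Longrightarrow> Ck_on m S f"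
proof (induction m arbitrary: f)
  case 0 then show ?case
    by (auto intro!: continuous_at_imp_continuous_on differentiable_imp_continuous_within)
qed auto

lemma smooth_differentiable: "smooth f \<Longrightarrow> f differentiable (at x)"
  unfolding smooth_def by (metis Ck_on.simps(2) UNIV_I)

lemma smooth_continuous_derivative:
  "smooth f \<Longrightarrow> continuous_on UNIV (\<lambda>x. frechet_derivative f (at x) v)"
  unfolding smooth_def by (metis Ck_on.simps)

lemma smooth_derivative: "smooth f \<Longrightarrow> smooth (\<lambda>x. frechet_derivative f (at x) v)"
  unfolding smooth_def by (metis Ck_on.simps(2))

lemma smooth_continuous: "smooth f \<Longrightarrow> continuous_on UNIV f"
  unfolding smooth_def by (metis Ck_on.simps(1))

lemma Ck_on_add: "Ck_on m UNIV f \<Longrightarrow> Ck_on m UNIV g \<Longrightarrow> Ck_on m UNIV (\<lambda>x. f x + g x)"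
proof (induction m arbitrary: f g)
  case 0 then show ?case by (auto intro: continuous_on_add)
next
  case (Suc m)
  have "frechet_derivative (\<lambda>x. f x + g x) (at x) v = frechet_derivative f (at x) v + frechet_derivative g (at x) v" for x v
    using Suc.prems
    by (intro fun_cong[OF frechet_derivative_at[symmetric]] has_derivative_add)
       (auto simp: frechet_derivative_works[symmetric])
  then show ?case using Suc by (auto intro: differentiable_add)
qed

lemma Ck_on_mult:
  fixes f g :: "'a::euclidean_space \<Rightarrow> real"
  shows "Ck_on m UNIV f \<Longrightarrow> Ck_on m UNIV g \<Longrightarrow> Ck_on m UNIV (\<lambda>x. f x * g x)"
proof (induction m arbitrary: f g)
  case 0 then show ?case by (auto intro: continuous_on_mult)
next
  case (Suc m)
  have "frechet_derivative (\<lambda>x. f x * g x) (at x) v = f x * frechet_derivative g (at x) v + frechet_derivative f (at x) v * g x" for x v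
    using Suc.prems
    by (intro fun_cong[OF frechet_derivative_at[symmetric]] has_derivative_mult)
       (auto simp: frechet_derivative_works[symmetric])
  moreover have "Ck_on m UNIV f" "Ck_on m UNIV g" using Suc.prems Ck_on_mono_order by blast+
  ultimately show ?case using Suc by (auto intro!: differentiable_mult Ck_on_add)
qed

text \<open>\<open>G\<close> is the whole tower of derivatives of the outer function. By the chain
  rule a derivative of \<open>G n\<close> after \<phi> is \<open>G (Suc n)\<close> after \<phi>
  times a derivative of \<phi>, so the induction on the order closes only when it runs over all
  \<open>n\<close> at once.\<close>

lemma smooth_compose_real:
  fixes \<phi> :: "'a::euclidean_space \<Rightarrow> real" and G :: "nat \<Rightarrow> real \<Rightarrow> real"
  assumes \<phi>: "smooth \<phi>" and G: "\<And>n t. (G n has_real_derivative G (Suc n) t) (at t)"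
  shows "smooth (\<lambda>x. G n (\<phi> x))"
proof -
  have "Ck_on m UNIV (\<lambda>x. G n (\<phi> x))" for m
  proof (induction m arbitrary: n)
    case 0
    have "continuous_on UNIV (G n)"
      using G by (meson DERIV_isCont continuous_at_imp_continuous_on)
    then show ?case using smooth_continuous[OF \<phi>] by (simp add: continuous_on_compose2)
  next
    case (Suc m)
    have d: "((\<lambda>x. G n (\<phi> x)) has_derivative (\<lambda>v. G (Suc n) (\<phi> x) * frechet_derivative \<phi> (at x) v)) (at x)" for x
      using smooth_differentiable[OF \<phi>, of x] has_derivative_compose[of \<phi> _ x UNIV "G n"] G[of n "\<phi> x"]
      by (simp add: frechet_derivative_works has_field_derivative_def)
    have "Ck_on m UNIV (\<lambda>x. frechet_derivative \<phi> (at x) v)" for v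
      using smooth_derivative[OF \<phi>] by (simp add: smooth_def)
    then show ?case
      using d Suc by (auto simp: frechet_derivative_at[OF d, symmetric] differentiable_def intro!: Ck_on_mult)
  qed
  then show ?thesis by (simp add: smooth_def)
qed

lemma smooth_lipschitz_on_compact_convex:
  fixes f :: "'a::euclidean_space \<Rightarrow> 'b::euclidean_space"
  assumes f: "smooth f" and K: "compact K" "convex K"
  shows "\<exists>L\<ge>0. \<forall>x\<in>K. \<forall>y\<in>K. norm (f x - f y) \<le> L * norm (x - y)"
proof -
  let ?D = "\<lambda>x. frechet_derivative f (at x)"
  have D: "(f has_derivative ?D x) (at x)" for x
    using smooth_differentiable[OF f] by (simp add: frechet_derivative_works)
  \<comment> \<open>The sum over the basis dominates the operator norm, and its continuity in x is
    immediate from that of the directional derivatives.\<close>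
  have "continuous_on K (\<lambda>x. \<Sum>b\<in>Basis. norm (?D x b))"
    by (intro continuous_intros continuous_on_subset[OF smooth_continuous_derivative[OF f]]) auto
  then have "bounded ((\<lambda>x. \<Sum>b\<in>Basis. norm (?D x b)) ` K)"
    using K compact_continuous_image compact_imp_bounded by blast
  then obtain L where L: "0 < L" "\<And>x. x \<in> K \<Longrightarrow> \<bar>\<Sum>b\<in>Basis. norm (?D x b)\<bar> \<le> L"
    unfolding bounded_pos by (metis image_eqI real_norm_def)
  have "onorm (?D x) \<le> L" if x: "x \<in> K" for x
  proof (rule onorm_le)
    fix h :: 'a
    have lin: "linear (?D x)" using D[of x] has_derivative_linear by blast
    have "?D x h = ?D x (\<Sum>b\<in>Basis. (h \<bullet> b) *\<^sub>R b)" by (simp add: euclidean_representation)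
    also have "\<dots> = (\<Sum>b\<in>Basis. (h \<bullet> b) *\<^sub>R ?D x b)" by (simp add: linear_sum[OF lin] linear_cmul[OF lin])
    also have "norm \<dots> \<le> (\<Sum>b\<in>Basis. norm h * norm (?D x b))"
      by (intro order_trans[OF norm_sum] sum_mono) (auto intro!: mult_right_mono Basis_le_norm)
    also have "\<dots> \<le> L * norm h"
    proof -
      have "(\<Sum>b\<in>Basis. norm (?D x b)) * norm h \<le> L * norm h"
        using L(2)[OF x] by (intro mult_right_mono) auto
      then show ?thesis by (simp add: sum_distrib_left mult.commute[of _ "norm h"])
    qed
    finally show "norm (?D x h) \<le> L * norm h" .
  qed
  then show ?thesis
    using L K D by (intro exI[of _ L] conjI ballI differentiable_bound[of K f ?D]) 
      (auto intro: has_derivative_at_withinI)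
qed

text \<open>All derivatives of this approximation of \<open>\<bar>t\<bar>\<close> are polynomials in \<open>tanh\<close>.\<close>

definition smooth_abs :: "nat \<Rightarrow> real \<Rightarrow> real" where
  "smooth_abs n t = ln (cosh (real (Suc n) * t)) / real (Suc n)"

lemma smooth_abs_deriv: "(smooth_abs n has_real_derivative tanh (real (Suc n) * t)) (at t)"
  unfolding smooth_abs_def
  by (auto intro!: derivative_eq_intros simp: cosh_real_pos tanh_def field_simps simp del: of_nat_Suc)

lemma smooth_abs_0 [simp]: "smooth_abs n 0 = 0"
  by (simp add: smooth_abs_def)

lemma smooth_abs_minus [simp]: "smooth_abs n (- t) = smooth_abs n t"
  by (simp add: smooth_abs_def)

lemma smooth_abs_lipschitz: "\<bar>smooth_abs n x - smooth_abs n y\<bar> \<le> \<bar>x - y\<bar>"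
  using field_differentiable_bound[of UNIV "smooth_abs n" "\<lambda>t. tanh (real (Suc n) * t)" 1 x y]
    smooth_abs_deriv tanh_real_bounds by (auto simp: abs_le_iff less_imp_le simp del: of_nat_Suc)

text \<open>From exp |x| / 2 \<le> cosh x \<le> exp |x| the logarithm of cosh x is within ln 2 of
  |x|; rescaling by \<open>Suc n\<close> turns this into a uniform error that tends to 0.\<close>

lemma smooth_abs_approx: "\<bar>smooth_abs n t - \<bar>t\<bar>\<bar> \<le> ln 2 / real (Suc n)"
proof -
  have c: "\<bar>ln (cosh x) - \<bar>x\<bar>\<bar> \<le> ln 2" for x :: real
  proof -
    define A B where "A = exp \<bar>x\<bar>" and "B = exp (- \<bar>x\<bar>)"
    have "cosh x = (A + B) / 2" by (simp add: A_def B_def cosh_def abs_if)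
    moreover have "B \<le> A" "0 < B" by (simp_all add: A_def B_def)
    ultimately have "exp \<bar>x\<bar> / 2 \<le> cosh x" "cosh x \<le> exp \<bar>x\<bar>"
      unfolding A_def[symmetric] by auto
    then have "ln (exp \<bar>x\<bar> / 2) \<le> ln (cosh x)" "ln (cosh x) \<le> ln (exp \<bar>x\<bar>)"
      using cosh_real_pos[of x] by (subst ln_le_cancel_iff; simp)+
    moreover have "0 \<le> ln (2::real)" by simp
    ultimately show ?thesis by (simp add: ln_div)
  qed
  have "smooth_abs n t - \<bar>t\<bar> = (ln (cosh (real (Suc n) * t)) - \<bar>real (Suc n) * t\<bar>) / real (Suc n)"
    by (simp add: smooth_abs_def abs_mult diff_divide_distrib del: of_nat_Suc)
  then have "\<bar>smooth_abs n t - \<bar>t\<bar>\<bar> = \<bar>ln (cosh (real (Suc n) * t)) - \<bar>real (Suc n) * t\<bar>\<bar> / real (Suc n)"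
    by (simp add: abs_divide del: of_nat_Suc)
  also have "\<dots> \<le> ln 2 / real (Suc n)" by (intro divide_right_mono c) simp
  finally show ?thesis .
qed

lemma smooth_const: "smooth (\<lambda>x. c)"
proof -
  have "Ck_on m UNIV (\<lambda>x::'a. c)" for m and c :: 'b
    by (induction m arbitrary: c) (auto simp: frechet_derivative_const)
  then show ?thesis by (simp add: smooth_def)
qed

lemma smooth_add: "smooth f \<Longrightarrow> smooth g \<Longrightarrow> smooth (\<lambda>x. f x + g x)"
  by (simp add: smooth_def Ck_on_add)

lemma smooth_mult:
  fixes f g :: "'a::euclidean_space \<Rightarrow> real"
  shows "smooth f \<Longrightarrow> smooth g \<Longrightarrow> smooth (\<lambda>x. f x * g x)"
  by (simp add: smooth_def Ck_on_mult)

lemma smooth_smooth_abs_compose: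
  fixes \<phi> :: "'a::euclidean_space \<Rightarrow> real"
  assumes "smooth \<phi>"
  shows "smooth (\<lambda>x. smooth_abs n (\<phi> x))"
proof -
  \<comment> \<open>\<open>P i\<close>, evaluated at tanh, is the derivative of order i + 1; the
    recursion is the chain rule with tanh' = 1 - tanh^2. Order 0 is the function itself, not a
    polynomial in tanh, hence the shift by one in \<open>G\<close>.\<close>
  define P where "P = rec_nat [:0, 1:] (\<lambda>_ r. smult (real (Suc n)) (pderiv r * [:1, 0, - 1:]))"
  define G where "G j t = (case j of 0 \<Rightarrow> smooth_abs n t | Suc i \<Rightarrow> poly (P i) (tanh (real (Suc n) * t)))" for j t
  have P: "P 0 = [:0, 1:]" "P (Suc i) = smult (real (Suc n)) (pderiv (P i) * [:1, 0, - 1:])" for i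
    by (simp_all add: P_def)
  have tanh: "((\<lambda>t. tanh (real (Suc n) * t)) has_real_derivative (1 - tanh (real (Suc n) * t) ^ 2) * real (Suc n)) (at t)" for t
    by (rule derivative_eq_intros refl | simp)+
  have "(G j has_real_derivative G (Suc j) t) (at t)" for j t
  proof (cases j)
    case 0
    moreover have "G 0 = smooth_abs n" by (simp add: fun_eq_iff G_def)
    ultimately show ?thesis using smooth_abs_deriv[of n t] by (simp add: G_def[of "Suc 0"] P(1) del: of_nat_Suc)
  next
    case (Suc i)
    have G: "G (Suc i) = (\<lambda>t. poly (P i) (tanh (real (Suc n) * t)))" for i by (simp add: fun_eq_iff G_def)
    show ?thesis
      using DERIV_chain2[OF poly_DERIV tanh, of "P i" t] unfolding Suc G P(2)
      by (simp add: power2_eq_square algebra_simps del: of_nat_Suc)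
  qed
  from smooth_compose_real[where G=G and n=0, OF assms this] show ?thesis by (simp add: G_def)
qed

section \<open>Test functions and their smooth truncations\<close>

lemma Cc_infty_compose:
  assumes \<phi>: "\<phi> \<in> Cc_infty \<Omega>" and sm: "smooth (\<lambda>x. G (\<phi> x))" and G: "G 0 = (0::real)"
  shows "(\<lambda>x. G (\<phi> x)) \<in> Cc_infty \<Omega>"
proof -
  have "closure {x. G (\<phi> x) \<noteq> 0} \<subseteq> closure {x. \<phi> x \<noteq> 0}" using G by (intro closure_mono) auto
  then show ?thesis using \<phi> sm unfolding Cc_infty_def compact_eq_bounded_closed
    by (auto intro: bounded_subset)
qed

lemma Cc_infty_diff:
  assumes "\<phi> \<in> Cc_infty \<Omega>" "\<psi> \<in> Cc_infty \<Omega>"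
  shows "(\<lambda>x. \<phi> x - \<psi> x) \<in> Cc_infty \<Omega>"
proof -
  have "smooth (\<lambda>x. \<phi> x + (- 1) * \<psi> x)"
    using assms by (intro smooth_add smooth_mult smooth_const) (auto simp: Cc_infty_def)
  moreover have sub: "closure {x. \<phi> x - \<psi> x \<noteq> 0} \<subseteq> closure {x. \<phi> x \<noteq> 0} \<union> closure {x. \<psi> x \<noteq> 0}"
    unfolding closure_Un[symmetric] by (intro closure_mono) auto
  moreover have "bounded (closure {x. \<phi> x \<noteq> 0} \<union> closure {x. \<psi> x \<noteq> 0})"
    using assms by (simp add: Cc_infty_def compact_eq_bounded_closed)
  then have "bounded (closure {x. \<phi> x - \<psi> x \<noteq> 0})" using sub by (rule bounded_subset)
  ultimately show ?thesis using assms unfolding Cc_infty_def compact_eq_bounded_closed by auto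
qed

text \<open>Smooth version of (t - a)_+ = (t + |t - a| - a) / 2. For a \<ge> 0 the last a is |a|,
  and replacing it by \<open>smooth_abs n a\<close> as well makes the value at t = 0 exactly 0, so
  that compositions keep compact support.\<close>

definition smooth_trunc :: "nat \<Rightarrow> real \<Rightarrow> real \<Rightarrow> real" where
  "smooth_trunc n a t = (t + smooth_abs n (t - a) - smooth_abs n a) / 2"

lemma smooth_trunc_0 [simp]: "smooth_trunc n a 0 = 0"
  using smooth_abs_minus[of n a] by (simp add: smooth_trunc_def)

lemma smooth_trunc_lipschitz: "\<bar>smooth_trunc n a x - smooth_trunc n a y\<bar> \<le> \<bar>x - y\<bar>"
proof -
  have "smooth_trunc n a x - smooth_trunc n a y = ((x - y) + (smooth_abs n (x - a) - smooth_abs n (y - a))) / 2"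
    by (simp add: smooth_trunc_def field_simps)
  moreover have "\<bar>(c + d) / 2\<bar> \<le> \<bar>c\<bar>" if "\<bar>d\<bar> \<le> \<bar>c\<bar>" for c d :: real
    using that abs_triangle_ineq[of c d] by simp
  ultimately show ?thesis using smooth_abs_lipschitz[of n "x - a" "y - a"] by simp
qed

lemma smooth_trunc_approx:
  assumes "0 \<le> a" shows "\<bar>smooth_trunc n a t - max 0 (t - a)\<bar> \<le> ln 2 / real (Suc n)"
proof -
  have eq: "smooth_trunc n a t - max 0 (t - a) = ((smooth_abs n (t - a) - \<bar>t - a\<bar>) - (smooth_abs n a - \<bar>a\<bar>)) / 2"
    using assms by (simp add: smooth_trunc_def max_def abs_if field_simps)
  have avg: "\<bar>(b - c) / 2\<bar> \<le> d" if "\<bar>b\<bar> \<le> d" "\<bar>c\<bar> \<le> d" for b c d :: real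
    using that abs_triangle_ineq4[of b c] by simp
  show ?thesis unfolding eq by (rule avg[OF smooth_abs_approx smooth_abs_approx])
qed

lemma Cc_infty_smooth_abs: "\<phi> \<in> Cc_infty \<Omega> \<Longrightarrow> (\<lambda>x. smooth_abs n (\<phi> x)) \<in> Cc_infty \<Omega>"
  by (rule Cc_infty_compose) (auto intro!: smooth_smooth_abs_compose simp: Cc_infty_def)

lemma Cc_infty_smooth_trunc:
  assumes "\<phi> \<in> Cc_infty \<Omega>"
  shows "(\<lambda>x. smooth_trunc n a (\<phi> x)) \<in> Cc_infty \<Omega>"
proof (rule Cc_infty_compose[OF assms])
  have \<phi>: "smooth \<phi>" using assms by (simp add: Cc_infty_def)
  then have "smooth (\<lambda>x. \<phi> x + (- a))" by (intro smooth_add smooth_const)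
  then have "smooth (\<lambda>x. (\<phi> x + smooth_abs n (\<phi> x + (- a)) + (- smooth_abs n a)) * (1 / 2))"
    by (intro smooth_mult smooth_add smooth_const \<phi> smooth_smooth_abs_compose)
  then show "smooth (\<lambda>x. smooth_trunc n a (\<phi> x))" by (simp add: smooth_trunc_def)
qed simp

text \<open>If b \<le> \<epsilon> a, the first term on the right already suffices; otherwise a < b /
  \<epsilon> and the second one does. In use, the small factor \<epsilon> multiplies the energy of
  the fixed solution and the large factor the energy of a test function that can be made
  small.\<close>

lemma young_scaled:
  fixes a b :: real
  assumes "0 \<le> a" "0 \<le> b" "0 < \<epsilon>" "1 < p"
  shows "a powr (p - 1) * b \<le> \<epsilon> * a powr p + \<epsilon> powr (1 - p) * b powr p"
proof (cases "b \<le> \<epsilon> * a")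
  case True
  have "a powr (p - 1) * b \<le> a powr (p - 1) * (\<epsilon> * a)" using True by (intro mult_left_mono) auto
  also have "\<dots> = \<epsilon> * a powr p"
    using assms by (cases "a = 0") (auto simp: powr_diff)
  also have "\<dots> \<le> \<epsilon> * a powr p + \<epsilon> powr (1 - p) * b powr p" by simp
  finally show ?thesis .
next
  case False
  then have b: "0 < b" using assms by (smt (verit) mult_nonneg_nonneg)
  have "a powr (p - 1) * b \<le> (b / \<epsilon>) powr (p - 1) * b"
    using False assms by (intro mult_right_mono powr_mono2) (auto simp: field_simps)
  also have "\<dots> = \<epsilon> powr (1 - p) * b powr p"
    using b assms by (simp add: powr_divide powr_diff)
  also have "\<dots> \<le> \<epsilon> * a powr p + \<epsilon> powr (1 - p) * b powr p" using assms by simp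
  finally show ?thesis .
qed

lemma powr_add_le:
  fixes a b :: real
  assumes "0 < p"
  shows "\<bar>a + b\<bar> powr p \<le> 2 powr p * (\<bar>a\<bar> powr p + \<bar>b\<bar> powr p)"
proof -
  have "\<bar>a + b\<bar> powr p \<le> (2 * max \<bar>a\<bar> \<bar>b\<bar>) powr p" using assms by (intro powr_mono2) auto
  also have "\<dots> = 2 powr p * max \<bar>a\<bar> \<bar>b\<bar> powr p" by (simp add: powr_mult)
  also have "\<dots> \<le> 2 powr p * (\<bar>a\<bar> powr p + \<bar>b\<bar> powr p)" by (intro mult_left_mono) (auto simp: max_def)
  finally show ?thesis .
qed

lemma abs_signed_powr: "\<bar>\<bar>a\<bar> powr (p - 2) * a\<bar> = \<bar>a\<bar> powr (p - 1)" for a p :: real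
proof (cases "a = 0")
  case False
  then have "\<bar>a\<bar> powr (p - 2) * \<bar>a\<bar> = \<bar>a\<bar> powr (p - 2) * \<bar>a\<bar> powr 1" by simp
  also have "\<dots> = \<bar>a\<bar> powr (p - 1)" by (subst powr_add[symmetric]) simp
  finally show ?thesis by (simp add: abs_mult)
qed simp

text \<open>The truncation t -> (t - a)_+ is nondecreasing and 1-Lipschitz: its increment has the
  sign of x - y and is no larger in size. This is why pairing the operator with a truncation of u
  dominates the energy of that truncation.\<close>

lemma trunc_monotone:
  fixes x y a :: real
  assumes "1 < p"
  shows "\<bar>max 0 (x - a) - max 0 (y - a)\<bar> powr p \<le> \<bar>x - y\<bar> powr (p - 2) * (x - y) * (max 0 (x - a) - max 0 (y - a))"
proof -
  let ?d = "max 0 (x - a) - max 0 (y - a)"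
  have "\<bar>?d\<bar> powr p = \<bar>?d\<bar> powr (p - 1) * \<bar>?d\<bar>"
    using assms by (cases "?d = 0") (auto simp: powr_diff)
  also have "\<dots> \<le> \<bar>x - y\<bar> powr (p - 1) * \<bar>?d\<bar>"
    using assms by (intro mult_right_mono powr_mono2) auto
  also have "\<dots> = \<bar>x - y\<bar> powr (p - 2) * \<bar>x - y\<bar> * \<bar>?d\<bar>"
    by (simp add: abs_signed_powr[symmetric] abs_mult)
  also have "\<dots> = \<bar>x - y\<bar> powr (p - 2) * (x - y) * ?d"
  proof -
    have "0 \<le> (x - y) * ?d" by (auto simp: max_def mult_nonneg_nonneg mult_nonpos_nonpos)
    then have "\<bar>x - y\<bar> * \<bar>?d\<bar> = (x - y) * ?d" by (simp add: abs_mult[symmetric])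
    then show ?thesis by (simp only: mult.assoc)
  qed
  finally show ?thesis .
qed

lemma smooth_compact_support_bounded:
  fixes \<phi> :: "'a::euclidean_space \<Rightarrow> real"
  assumes \<phi>: "smooth \<phi>" and S: "compact S" and out: "\<And>x. x \<notin> S \<Longrightarrow> \<phi> x = 0"
  shows "\<exists>M>0. \<forall>x. \<bar>\<phi> x\<bar> \<le> M"
proof -
  have "bounded (\<phi> ` S)"
    by (intro compact_imp_bounded compact_continuous_image continuous_on_subset[OF smooth_continuous[OF \<phi>]] S subset_UNIV)
  then obtain M where M: "0 < M" "\<And>x. x \<in> S \<Longrightarrow> \<bar>\<phi> x\<bar> \<le> M" unfolding bounded_pos by force
  then have "\<bar>\<phi> x\<bar> \<le> M" for x using out[of x] by (cases "x \<in> S") auto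
  with M show ?thesis by blast
qed

lemma Cc_infty_outside: "x \<notin> closure {x. \<phi> x \<noteq> 0} \<Longrightarrow> \<phi> x = 0"
  using closure_subset[of "{x. \<phi> x \<noteq> 0}"] by blast

lemma Cc_infty_bounded:
  assumes "\<phi> \<in> Cc_infty \<Omega>"
  shows "\<exists>M>0. \<forall>x. \<bar>\<phi> x\<bar> \<le> M"
  using assms by (intro smooth_compact_support_bounded[OF _ _ Cc_infty_outside]) (auto simp: Cc_infty_def)

section \<open>Translations, dilations and gauge balls\<close>

context stratified_lie_group begin

text \<open>The derivative of the left translation by a at x. Reading it off the joint derivative of
  the multiplication makes it continuous in the pair (a, x), which is needed when both tend to the
  identity.\<close>

definition dmul :: "real^'n \<Rightarrow> real^'n \<Rightarrow> real^'n \<Rightarrow> real^'n" where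
  "dmul a x h = frechet_derivative (\<lambda>z. mul (fst z) (snd z)) (at (a, x)) (0, h)"

lemma mul_has_derivative: "(mul a has_derivative dmul a x) (at x)"
proof -
  have "((\<lambda>z. mul (fst z) (snd z)) has_derivative frechet_derivative (\<lambda>z. mul (fst z) (snd z)) (at (a, x))) (at (a, x))"
    using smooth_differentiable[OF smooth_mul] by (simp add: frechet_derivative_works)
  moreover have "((\<lambda>x. (a, x)) has_derivative (\<lambda>h. (0, h))) (at x)" by (auto intro!: derivative_eq_intros)
  ultimately show ?thesis
    using has_derivative_compose[of "\<lambda>x. (a, x)" "\<lambda>h. (0, h)" x UNIV "\<lambda>z. mul (fst z) (snd z)"]
    by (simp add: dmul_def[abs_def])
qed

lemma continuous_mul: "continuous_on UNIV (\<lambda>z. mul (fst z) (snd z))"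
  by (rule smooth_continuous[OF smooth_mul])

lemma continuous_ginv: "continuous_on UNIV ginv"
  by (rule smooth_continuous[OF smooth_ginv])

lemma linear_dilation: "linear (dilation \<sigma> r)"
  by (intro linearI) (simp_all add: dilation_def vec_eq_iff algebra_simps)

lemma dilation_dilation: "dilation \<sigma> r (dilation \<sigma> t x) = dilation \<sigma> (r * t) x"
  by (simp add: dilation_def vec_eq_iff power_mult_distrib mult.assoc)

lemma dilation_1 [simp]: "dilation \<sigma> 1 x = x"
  by (simp add: dilation_def vec_eq_iff)

lemma dilation_0 [simp]: "dilation \<sigma> 0 x = 0"
proof -
  \<comment> \<open>Layers are numbered from 1, so 0^0 does not occur and dilation orbits extend
    continuously to r = 0.\<close>
  have "(0::real) ^ \<sigma> j = 0" for j using layers[of j] by (simp add: power_0_left)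
  then show ?thesis by (simp add: dilation_def vec_eq_iff)
qed

lemma continuous_dilation: "continuous_on UNIV (\<lambda>r. dilation \<sigma> r x)"
  unfolding dilation_def by (intro continuous_on_vec_lambda continuous_intros)

text \<open>Both sides are the derivative in x of one map, once written as D_r (a x) and once as
  (D_r a) (D_r x).\<close>

lemma dmul_dilation:
  assumes r: "0 < r"
  shows "dilation \<sigma> r (dmul a x h) = dmul (dilation \<sigma> r a) (dilation \<sigma> r x) (dilation \<sigma> r h)"
proof -
  have bl: "bounded_linear (dilation \<sigma> r)" using linear_dilation by (simp add: linear_conv_bounded_linear)
  have 1: "((\<lambda>x. dilation \<sigma> r (mul a x)) has_derivative (\<lambda>h. dilation \<sigma> r (dmul a x h))) (at x)"
    by (rule bounded_linear.has_derivative[OF bl mul_has_derivative])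
  have 2: "((\<lambda>x. mul (dilation \<sigma> r a) (dilation \<sigma> r x)) has_derivative
      (\<lambda>h. dmul (dilation \<sigma> r a) (dilation \<sigma> r x) (dilation \<sigma> r h))) (at x)"
    by (rule has_derivative_compose[OF bounded_linear_imp_has_derivative[OF bl] mul_has_derivative])
  have "(\<lambda>h. dilation \<sigma> r (dmul a x h)) = (\<lambda>h. dmul (dilation \<sigma> r a) (dilation \<sigma> r x) (dilation \<sigma> r h))"
    using 1 2 unfolding dilation_hom[OF r] by (rule has_derivative_unique)
  then show ?thesis by meson
qed

text \<open>The Jacobian of a left translation is invariant under \<open>(a, x) \<mapsto> (D\<^sub>r a, D\<^sub>r x)\<close>; letting
  \<open>r \<rightarrow> 0\<close> shows that it equals its value at the origin.\<close>

lemma det_dmul: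
  fixes \<pi> :: "'n \<Rightarrow> 'm::finite"
  assumes \<pi>: "bij \<pi>"
  shows "det (matrix (reindex (inv \<pi>) \<circ> dmul a x \<circ> reindex \<pi>)) = 1"
proof -
  let ?P = "reindex (inv \<pi>) :: real^'n \<Rightarrow> real^'m" and ?Q = "reindex \<pi> :: real^'m \<Rightarrow> real^'n"
  define j where "j z = det (matrix (?P \<circ> dmul (fst z) (snd z) \<circ> ?Q))" for z
  have lin_dmul: "linear (dmul a x)" for a x using mul_has_derivative has_derivative_linear by blast
  have cont: "continuous_on UNIV j"
  proof -
    have "continuous_on UNIV (\<lambda>z. dmul (fst z) (snd z) h)" for h
      using smooth_continuous_derivative[OF smooth_mul, of "(0, h)"] by (simp add: dmul_def)
    then have "continuous_on UNIV (\<lambda>z. matrix (?P \<circ> dmul (fst z) (snd z) \<circ> ?Q) $ i $ k)" for i k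
      by (simp add: matrix_def reindex_def continuous_on_component)
    then show ?thesis unfolding j_def det_def by (intro continuous_on_sum continuous_on_mult continuous_on_const continuous_on_prod)
  qed
  have inv: "j (dilation \<sigma> r a, dilation \<sigma> r x) = j (a, x)" if r: "0 < r" for r
  proof -
    define R where "R t = ?P \<circ> dilation \<sigma> t \<circ> ?Q" for t
    have linR: "linear (R t)" for t
      unfolding R_def by (intro linear_compose linear_reindex linear_dilation)
    have linM: "linear (?P \<circ> dmul a x \<circ> ?Q)" for a x
      by (intro linear_compose linear_reindex lin_dmul)
    \<comment> \<open>The two Jacobian matrices are conjugate under the matrix of the dilation,
      whose determinant is nonzero and so cancels.\<close>
    have "R r \<circ> R (1 / r) = id"
      using r by (auto simp: R_def fun_eq_iff reindex_inv[OF \<pi>] dilation_dilation)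
    then have "det (matrix (R r)) * det (matrix (R (1 / r))) = 1"
      by (metis det_mul matrix_compose linR matrix_id_mat_1 det_I)
    then have nz: "det (matrix (R r)) \<noteq> 0" by auto
    have "R r \<circ> (?P \<circ> dmul a x \<circ> ?Q) = (?P \<circ> dmul (dilation \<sigma> r a) (dilation \<sigma> r x) \<circ> ?Q) \<circ> R r"
      by (auto simp: R_def fun_eq_iff reindex_inv[OF \<pi>] dmul_dilation[OF r])
    then have "det (matrix (R r)) * j (a, x) = j (dilation \<sigma> r a, dilation \<sigma> r x) * det (matrix (R r))"
      unfolding j_def fst_conv snd_conv by (metis det_mul matrix_compose linR linM)
    with nz show ?thesis by simp
  qed
  let ?r = "\<lambda>n. 1 / real (Suc n)"
  have r0: "?r \<longlonglongrightarrow> 0" by (rule LIMSEQ_Suc[OF lim_const_over_n])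
  have dil: "(\<lambda>n. dilation \<sigma> (?r n) y) \<longlonglongrightarrow> 0" for y
    using continuous_on_tendsto_compose[OF continuous_dilation r0, of y] by simp
  have "(\<lambda>n. j (dilation \<sigma> (?r n) a, dilation \<sigma> (?r n) x)) \<longlonglongrightarrow> j (0, 0)"
    by (rule continuous_on_tendsto_compose[OF cont tendsto_Pair[OF dil dil]]) auto
  then have "j (a, x) = j (0, 0)" using inv by (simp add: LIMSEQ_const_iff)
  also have "\<dots> = 1"
  proof -
    have "mul 0 = id" by (simp add: fun_eq_iff group_left_neutral)
    then have "(mul 0 has_derivative id) (at 0)" by (simp add: has_derivative_id)
    then have "dmul 0 0 = id" by (rule has_derivative_unique[OF mul_has_derivative])
    moreover have "?P \<circ> id \<circ> ?Q = id" by (simp add: fun_eq_iff reindex_inv[OF \<pi>])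
    ultimately show ?thesis by (simp add: j_def matrix_id_mat_1)
  qed
  finally show ?thesis by (simp add: j_def)
qed

section \<open>Left translations preserve Lebesgue measure\<close>

lemma right_inverse: "mul a (ginv a) = 0"
  by (metis assoc group_left_neutral left_inverse)

lemma mul_ginv_cancel: "mul a (mul (ginv a) x) = x" "mul (ginv a) (mul a x) = x"
  by (simp_all add: assoc[symmetric] right_inverse group_left_neutral)

lemma left_translate_image: "mul a ` S = {x. mul (ginv a) x \<in> S}"
  using mul_ginv_cancel by (auto simp: image_iff) metis

lemma continuous_on_mul_left: "continuous_on S (mul a)"
  using continuous_on_compose2[OF continuous_mul, of S "\<lambda>x. (a, x)"]
  by (simp add: continuous_on_Pair continuous_on_id[unfolded id_def])

lemma open_left_translate: "open S \<Longrightarrow> open (mul a ` S)"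
  unfolding left_translate_image
  using continuous_on_mul_left[of UNIV "ginv a"] open_vimage[of S "mul (ginv a)"] by (simp add: vimage_def)

text \<open>The Jacobian determinant is 1 everywhere, and the translation is injective. Change of
  variables is carried out in the relabelled coordinates, on the preimage \<open>T\<close> of
  \<open>S\<close>, and transported back. Open sets of finite measure are enough because only gauge
  balls are translated.\<close>

lemma emeasure_left_translate:
  assumes S: "open S" "emeasure lborel S < \<infinity>"
  shows "emeasure lborel (mul a ` S) = emeasure lborel S"
proof -
  obtain \<pi> :: "'n \<Rightarrow> 'n ordered_index" where \<pi>: "bij \<pi>" using ordered_index_bij by blast
  let ?P = "reindex (inv \<pi>)" and ?Q = "reindex \<pi>"
  let ?f = "?P \<circ> mul a \<circ> ?Q"
  have measQ: "emeasure lborel (?Q -` U) = emeasure lborel U" if "open U" for U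
  proof -
    have "?Q \<in> borel_measurable borel"
      by (intro borel_measurable_continuous_onI linear_continuous_on linear_reindex[THEN linear_conv_bounded_linear[THEN iffD1]])
    then have "?Q \<in> borel_measurable lborel" by simp
    then have "emeasure (distr lborel borel ?Q) U = emeasure lborel (?Q -` U)"
      using that by (subst emeasure_distr) auto
    then show ?thesis by (simp add: distr_lborel_reindex[OF \<pi>])
  qed
  have vim: "?Q -` U = ?P ` U" for U
    using reindex_inv[OF \<pi>] by (auto simp: image_iff) metis
  define T where "T = ?Q -` S"
  have openQ: "open (?Q -` U)" if "open U" for U
    using that by (intro open_vimage linear_continuous_on linear_reindex[THEN linear_conv_bounded_linear[THEN iffD1]])
  have T: "open T" "emeasure lborel T = emeasure lborel S" unfolding T_def using S measQ openQ by auto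
  have Tl: "T \<in> lmeasurable" using T S by (auto simp: fmeasurable_def)
  have fT: "?f ` T = ?Q -` (mul a ` S)"
    unfolding vim T_def by (simp add: image_image reindex_inv[OF \<pi>])
  have bl: "bounded_linear (reindex p)" for p using linear_reindex by (simp add: linear_conv_bounded_linear)
  have der: "(?f has_derivative (?P \<circ> dmul a (?Q y) \<circ> ?Q)) (at y within T)" for y
  proof -
    have "((\<lambda>y. mul a (?Q y)) has_derivative (\<lambda>h. dmul a (?Q y) (?Q h))) (at y within T)"
      by (rule has_derivative_compose[OF bounded_linear_imp_has_derivative[OF bl] mul_has_derivative])
    from bounded_linear.has_derivative[OF bl this] show ?thesis by (simp add: comp_def)
  qed
  have inj: "inj_on ?f T"
  proof (rule inj_onI)
    fix x y assume eq: "?f x = ?f y"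
    have "mul a (?Q x) = mul a (?Q y)"
      using arg_cong[OF eq, where f="?Q"] by (simp add: reindex_inv[OF \<pi>])
    then have eq': "?Q x = ?Q y" by (rule left_cancel[THEN iffD1])
    show "x = y" using arg_cong[OF eq', where f="?P"] by (simp add: reindex_inv[OF \<pi>])
  qed
  have intT: "(\<lambda>y. \<bar>det (matrix (?P \<circ> dmul a (?Q y) \<circ> ?Q))\<bar>) integrable_on T"
    using Tl by (simp add: det_dmul[OF \<pi>] integrable_on_const)
  have lm: "?f ` T \<in> lmeasurable"
    using measurable_differentiable_image_eq[OF _ der inj] intT Tl by blast
  have "measure lebesgue (?f ` T) = integral T (\<lambda>y. 1)"
    using measure_differentiable_image_eq[OF _ der inj intT] Tl by (simp add: det_dmul[OF \<pi>] fmeasurableD)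
  then have "measure lebesgue (?f ` T) = measure lebesgue T" using Tl by (simp add: lmeasure_integral)
  then have "emeasure lebesgue (?f ` T) = emeasure lebesgue T"
    using lm Tl by (simp add: emeasure_eq_measure2)
  moreover have "open (?f ` T)" unfolding fT by (intro openQ open_left_translate S)
  ultimately have "emeasure lborel (?f ` T) = emeasure lborel T"
    using T by simp
  then show ?thesis using T measQ[OF open_left_translate[OF S(1)]] unfolding fT by simp
qed


text \<open>The coordinates are grouped by layer. In this form Q is visibly the exponent of r in the
  determinant of the dilation by r.\<close>

lemma homogeneous_dim_eq: "homogeneous_dim k \<sigma> = (\<Sum>j\<in>UNIV. \<sigma> j)"
proof -
  have "homogeneous_dim k \<sigma> = (\<Sum>i\<in>{1..k}. \<Sum>j | j \<in> UNIV \<and> \<sigma> j = i. \<sigma> j)"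
    unfolding homogeneous_dim_def layer_dim_def by (intro sum.cong refl) simp
  also have "\<dots> = (\<Sum>j\<in>UNIV. \<sigma> j)"
    using layers by (intro sum.group) auto
  finally show ?thesis .
qed

end

section \<open>The quasi-norm, its distance function and the volume of gauge balls\<close>

locale quasi_normed_group = stratified_lie_group mul ginv k \<sigma>
  for mul :: "real^'n::finite \<Rightarrow> real^'n \<Rightarrow> real^'n" and ginv k \<sigma> +
  fixes \<rho> :: "real^'n \<Rightarrow> real"
  assumes quasi_norm: "homogeneous_quasi_norm ginv \<sigma> \<rho>"
begin

lemma continuous_rho: "continuous_on UNIV \<rho>"
  and rho_nonneg [simp]: "0 \<le> \<rho> x"
  and rho_eq_0 [simp]: "\<rho> x = 0 \<longleftrightarrow> x = 0"
  and rho_ginv: "\<rho> (ginv x) = \<rho> x"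
  and rho_dilation: "0 < r \<Longrightarrow> \<rho> (dilation \<sigma> r x) = r * \<rho> x"
  using quasi_norm by (auto simp: homogeneous_quasi_norm_def)

lemma rho_0 [simp]: "\<rho> 0 = 0" by simp

lemma rho_pos: "x \<noteq> 0 \<Longrightarrow> 0 < \<rho> x"
  by (simp add: less_le)

definition gdist :: "real^'n \<Rightarrow> real^'n \<Rightarrow> real" where
  "gdist x y = \<rho> (mul (ginv y) x)"

lemma gdist_nonneg [simp]: "0 \<le> gdist x y" by (simp add: gdist_def)

lemma gdist_commute: "gdist x y = gdist y x"
proof -
  have "mul (mul (ginv x) y) (mul (ginv y) x) = 0"
    using left_inverse mul_ginv_cancel by (simp add: assoc)
  then have "ginv (mul (ginv y) x) = mul (ginv x) y"
    by (metis assoc group_left_neutral left_inverse right_inverse)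
  then show ?thesis unfolding gdist_def by (metis rho_ginv)
qed

lemma gdist_eq_0: "gdist x y = 0 \<longleftrightarrow> x = y"
  unfolding gdist_def rho_eq_0 by (metis mul_ginv_cancel(1) left_inverse)

lemma continuous_gdist: "continuous_on UNIV (\<lambda>z. gdist (fst z) (snd z))"
  unfolding gdist_def
  by (intro continuous_on_compose2[OF continuous_rho] continuous_on_compose2[OF continuous_mul, of _ "\<lambda>z. (ginv (snd z), fst z)", simplified]
      continuous_intros continuous_on_compose2[OF continuous_ginv]) auto

lemma open_rho_ball: "open {x. \<rho> x < r}"
  using open_Collect_less[OF continuous_rho continuous_on_const] .

lemma gdist_ball_eq: "{x. gdist x y < r} = mul y ` {x. \<rho> x < r}"
  unfolding left_translate_image gdist_def by simp

lemma rho_ball_eq: assumes "0 < r" "0 < t"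
  shows "{x. \<rho> x < r * t} = dilation \<sigma> r ` {x. \<rho> x < t}"
proof -
  have "x \<in> dilation \<sigma> r ` {x. \<rho> x < t}" if "\<rho> x < r * t" for x
    using that assms by (intro image_eqI[where x="dilation \<sigma> (1 / r) x"])
      (auto simp: dilation_dilation rho_dilation field_simps)
  then show ?thesis using assms by (auto simp: rho_dilation)
qed

text \<open>The minimum of \<rho> over the Euclidean unit sphere serves as \<open>m\<close>. A point
  of norm at least 1 is moved onto the sphere by a dilation with factor r \<le> 1, by the
  intermediate value theorem along its orbit, which starts at 0; such a dilation does not increase
  \<rho>.\<close>

lemma rho_small_imp_norm: "\<exists>m>0. \<forall>x. \<rho> x < m \<longrightarrow> norm x < 1"
proof -
  have "sphere (0::real^'n) 1 \<noteq> {}" by simp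
  moreover have "compact (sphere (0::real^'n) 1)" by simp
  ultimately obtain x0 where x0: "x0 \<in> sphere 0 1" "\<And>x. x \<in> sphere 0 1 \<Longrightarrow> \<rho> x0 \<le> \<rho> x"
    using continuous_attains_inf[of "sphere 0 1" \<rho>] continuous_on_subset[OF continuous_rho] by auto
  have "norm x < 1" if x: "\<rho> x < \<rho> x0" for x
  proof (rule ccontr)
    assume "\<not> norm x < 1"
    then have "\<exists>r\<ge>0. r \<le> 1 \<and> norm (dilation \<sigma> r x) = 1"
      by (intro IVT' continuous_on_norm continuous_on_subset[OF continuous_dilation]) auto
    then obtain r where r: "0 \<le> r" "r \<le> 1" "norm (dilation \<sigma> r x) = 1" by blast
    then have "0 < r" by (cases "r = 0") auto
    then have "\<rho> x0 \<le> r * \<rho> x" using x0(2)[of "dilation \<sigma> r x"] r rho_dilation by simp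
    also have "\<dots> \<le> \<rho> x" using r by (simp add: mult_left_le_one_le)
    finally show False using x by simp
  qed
  moreover have "0 < \<rho> x0" using x0(1) by (intro rho_pos) auto
  ultimately show ?thesis by blast
qed

text \<open>The factor r > 1 is chosen so that the dilated point has gauge m / 2 and hence Euclidean
  norm below 1. Each coordinate was multiplied by r^(\<sigma> j) \<ge> r, so originally it was at
  most 1 / r, which is a multiple of \<rho> x.\<close>

lemma norm_le_rho: "\<exists>\<eta>>0. \<exists>C\<ge>0. \<forall>x. \<rho> x < \<eta> \<longrightarrow> norm x \<le> 1 \<and> norm x \<le> C * \<rho> x"
proof -
  obtain m where m: "0 < m" "\<And>x. \<rho> x < m \<Longrightarrow> norm x < 1" using rho_small_imp_norm by blast
  have "norm x \<le> (2 * CARD('n) / m) * \<rho> x" if x: "\<rho> x < m / 2" for x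
  proof (cases "x = 0")
    case False
    define r where "r = m / (2 * \<rho> x)"
    have r: "1 < r" using x rho_pos[OF False] by (simp add: r_def field_simps)
    have "\<rho> (dilation \<sigma> r x) < m" using r rho_pos[OF False] m by (simp add: rho_dilation) (simp add: r_def)
    then have n: "norm (dilation \<sigma> r x) < 1" by (rule m)
    have comp: "\<bar>x $ j\<bar> \<le> 1 / r" for j
    proof -
      have "r * \<bar>x $ j\<bar> \<le> r ^ \<sigma> j * \<bar>x $ j\<bar>"
        using r layers[of j] power_increasing[of 1 "\<sigma> j" r] by (intro mult_right_mono) auto
      also have "\<dots> = \<bar>dilation \<sigma> r x $ j\<bar>" using r by (simp add: dilation_def abs_mult)
      also have "\<dots> \<le> 1" using component_le_norm_cart[of "dilation \<sigma> r x" j] n by simp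
      finally show ?thesis using r by (simp add: field_simps)
    qed
    have "norm x \<le> (\<Sum>j\<in>UNIV. \<bar>x $ j\<bar>)" by (rule norm_le_l1_cart)
    also have "\<dots> \<le> (\<Sum>j\<in>(UNIV::'n set). 1 / r)" by (intro sum_mono comp)
    also have "\<dots> = (2 * CARD('n) / m) * \<rho> x" by (simp add: r_def)
    finally show ?thesis .
  qed simp
  moreover have "norm x \<le> 1" if "\<rho> x < m / 2" for x using m(2)[of x] that m(1) by simp
  ultimately show ?thesis using m by (intro exI[of _ "m/2"] conjI exI[of _ "2 * CARD('n) / m"]) auto
qed

definition unit_ball_volume :: real where
  "unit_ball_volume = measure lborel {x. \<rho> x < 1}"

lemma rho_ball_finite: "emeasure lborel {x. \<rho> x < 1} < \<infinity>"
proof -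
  obtain m where m: "0 < m" "\<And>x. \<rho> x < m \<Longrightarrow> norm x < 1" using rho_small_imp_norm by blast
  have "bounded {x. \<rho> x < m}" using m by (auto simp: bounded_iff intro!: exI[of _ 1] less_imp_le)
  then have "bounded (dilation \<sigma> (1 / m) ` {x. \<rho> x < m})"
    using linear_dilation by (intro bounded_linear_image) (auto simp: linear_conv_bounded_linear)
  then have "bounded {x. \<rho> x < 1}" using m rho_ball_eq[of "1/m" m] by simp
  then show ?thesis by (rule emeasure_bounded_finite)
qed

lemma unit_ball_volume_pos: "0 < unit_ball_volume"
proof -
  let ?B = "{x. \<rho> x < 1}"
  have "0 \<in> ?B" using rho_eq_0[of 0] by simp
  then have "\<not> negligible ?B" using open_not_negligible[OF open_rho_ball] by blast
  then have "emeasure lborel ?B \<noteq> 0" using open_rho_ball[of 1] by (auto simp: negligible_iff_null_sets null_sets_def)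
  then show ?thesis using rho_ball_finite unfolding unit_ball_volume_def measure_def
    by (simp add: enn2real_positive_iff zero_less_iff_neq_zero)
qed

text \<open>A ball is a left translate of a dilated unit ball: translation preserves volume, and the
  dilation has determinant r^Q. The value does not depend on the centre.\<close>

lemma emeasure_gdist_ball:
  assumes r: "0 < r"
  shows "emeasure lebesgue {x. gdist x y < r} = ennreal (unit_ball_volume * r powr homogeneous_dim k \<sigma>)"
proof -
  let ?B = "\<lambda>r. {x. \<rho> x < r}"
  have B1: "?B 1 \<in> lmeasurable" using open_rho_ball rho_ball_finite by (auto simp: fmeasurable_def)
  have Br: "?B r = (\<lambda>x. \<chi> j. r ^ \<sigma> j * x $ j) ` ?B 1"
    using rho_ball_eq[OF r, of 1] by (simp add: dilation_def)
  have lm: "?B r \<in> lmeasurable" unfolding Br by (rule measurable_stretch[OF B1])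
  have "measure lebesgue (?B r) = \<bar>\<Prod>j\<in>UNIV. r ^ \<sigma> j\<bar> * measure lebesgue (?B 1)"
    unfolding Br by (rule measure_stretch[OF B1])
  also have "\<bar>\<Prod>j\<in>UNIV. r ^ \<sigma> j\<bar> = r powr homogeneous_dim k \<sigma>"
    using r by (simp add: homogeneous_dim_eq powr_realpow[symmetric] powr_sum abs_prod)
  finally have "measure lebesgue (?B r) = unit_ball_volume * r powr homogeneous_dim k \<sigma>"
    using open_rho_ball[of 1] by (simp add: unit_ball_volume_def)
  then have e: "emeasure lebesgue (?B r) = ennreal (unit_ball_volume * r powr homogeneous_dim k \<sigma>)"
    using emeasure_eq_measure2[OF lm] by simp
  then have "emeasure lborel (?B r) < \<infinity>" using open_rho_ball[of r] by simp
  then have "emeasure lborel (mul y ` ?B r) = emeasure lborel (?B r)" by (rule emeasure_left_translate[OF open_rho_ball])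
  then show ?thesis
    unfolding gdist_ball_eq using e open_left_translate[OF open_rho_ball, of y r] open_rho_ball[of r] by simp
qed

end

section \<open>Kernel mass and energy\<close>

lemma sigma_finite_lebesgue: "sigma_finite_measure (lebesgue :: 'a::euclidean_space measure)"
proof
  obtain A :: "'a set set" where A: "countable A" "A \<subseteq> sets lborel" "\<Union>A = space lborel" "\<forall>a\<in>A. emeasure lborel a \<noteq> \<infinity>"
    using lborel.sigma_finite_countable by blast
  then show "\<exists>A. countable A \<and> A \<subseteq> sets (lebesgue :: 'a measure) \<and> \<Union>A = space lebesgue \<and> (\<forall>a\<in>A. emeasure lebesgue a \<noteq> \<infinity>)"
    by (intro exI[of _ A]) (auto simp: subset_eq)
qed

interpretation lebesgue: sigma_finite_measure "lebesgue :: 'a::euclidean_space measure"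
  by (rule sigma_finite_lebesgue)

interpretation lebesgue_pair: pair_sigma_finite "lebesgue :: 'a::euclidean_space measure" "lebesgue :: 'b::euclidean_space measure" ..

lemma ex_dyadic:
  fixes d :: real assumes "0 < d"
  shows "(\<exists>i::nat. 2 powr (- real (Suc i)) \<le> d \<and> d < 2 powr (- real i)) \<or> (\<exists>i::nat. 2 powr real i \<le> d \<and> d < 2 powr real (Suc i))"
proof -
  define n where "n = \<lfloor>log 2 d\<rfloor>"
  have "of_int n \<le> log 2 d" "log 2 d < of_int n + 1" unfolding n_def by linarith+
  then have n: "2 powr of_int n \<le> d" "d < 2 powr (of_int n + 1)"
    using assms by (simp_all add: le_log_iff log_less_iff)
  show ?thesis
  proof (cases "0 \<le> n")
    case True
    then show ?thesis using n by (intro disjI2 exI[of _ "nat n"]) (simp add: add.commute)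
  next
    case False
    then have "real (nat (- n - 1)) = - of_int n - 1" by simp
    then show ?thesis using n by (intro disjI1 exI[of _ "nat (- n - 1)"]) (simp add: add.commute)
  qed
qed

text \<open>Summation over dyadic shells. Near d = 0 the shells contribute a geometric series of
  ratio 2^(\<alpha> - p), far away one of ratio 2^(- \<alpha>); these are the two summands of the
  bound, and 0 < \<alpha> < p makes both converge.\<close>

lemma nn_integral_radial_le:
  fixes d :: "'b \<Rightarrow> real" and Q \<alpha> p c :: real
  assumes d[measurable]: "d \<in> borel_measurable M" and d0: "\<And>x. 0 \<le> d x"
    and vol: "\<And>r. 0 < r \<Longrightarrow> emeasure M {x\<in>space M. d x < r} \<le> ennreal (c * r powr Q)"
    and c: "0 \<le> c" and Q: "0 \<le> Q" and p: "0 < \<alpha>" "\<alpha> < p"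
  shows "(\<integral>\<^sup>+x. ennreal (min 1 (d x powr p) / d x powr (Q + \<alpha>)) \<partial>M)
    \<le> ennreal (c * 2 powr (Q + \<alpha>) / (1 - 2 powr (\<alpha> - p)) + c * 2 powr Q / (1 - 2 powr (- \<alpha>)))"
proof -
  \<comment> \<open>\<open>a i\<close> bounds the integrand on the i-th shell inside d < 1 and
    \<open>b i\<close> on the i-th shell outside. Each shell is enlarged to the ball
    \<open>A i\<close> or \<open>B i\<close> containing it, so an upper bound for the volumes is all
    that is required.\<close>
  define a where "a i = 2 powr (real (Suc i) * (Q + \<alpha>) - real i * p)" for i
  define b where "b i = 2 powr (- (real i * (Q + \<alpha>)))" for i
  define A where "A i = {x\<in>space M. d x < 2 powr (- real i)}" for i :: nat
  define B where "B i = {x\<in>space M. d x < 2 powr (real (Suc i))}" for i :: nat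
  have [measurable]: "A i \<in> sets M" "B i \<in> sets M" for i unfolding A_def B_def by measurable
  have sum_ge: "f i * indicator (S i) x \<le> (\<Sum>i. f i * indicator (S i) x)" for f :: "nat \<Rightarrow> ennreal" and S i and x :: 'b
  proof -
    have "(\<Sum>i\<in>{i}. f i * indicator (S i) x) \<le> (\<Sum>i. f i * indicator (S i) x)"
      by (rule sum_le_suminf) auto
    then show ?thesis
      by (simp only: sum.insert[OF finite.emptyI] sum.empty empty_iff not_False_eq_True add_0_right)
  qed
  have pw: "ennreal (min 1 (d x powr p) / d x powr (Q + \<alpha>))
     \<le> (\<Sum>i. ennreal (a i) * indicator (A i) x) + (\<Sum>i. ennreal (b i) * indicator (B i) x)"
    if x: "x \<in> space M" for x
  proof (cases "d x = 0")
    case True then show ?thesis by simp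
  next
    case False
    with d0[of x] have dpos: "0 < d x" by simp
    consider (small) i where "2 powr (- real (Suc i)) \<le> d x" "d x < 2 powr (- real i)"
      | (large) i where "2 powr real i \<le> d x" "d x < 2 powr real (Suc i)"
      using ex_dyadic[OF dpos] by blast
    then show ?thesis
    proof cases
      case small
      have "d x powr p \<le> (2 powr (- real i)) powr p" using small p dpos by (intro powr_mono2) auto
      then have 1: "min 1 (d x powr p) \<le> 2 powr (- (real i * p))" by (simp add: powr_powr min.coboundedI2)
      have "(2 powr (- real (Suc i))) powr (Q + \<alpha>) \<le> d x powr (Q + \<alpha>)"
        using small Q p by (intro powr_mono2) auto
      then have 2: "2 powr (- (real (Suc i) * (Q + \<alpha>))) \<le> d x powr (Q + \<alpha>)" by (simp add: powr_powr del: of_nat_Suc)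
      have "min 1 (d x powr p) / d x powr (Q + \<alpha>) \<le> 2 powr (- (real i * p)) / 2 powr (- (real (Suc i) * (Q + \<alpha>)))"
        using 1 2 by (intro frac_le) auto
      also have "\<dots> = a i" unfolding a_def by (subst powr_diff[symmetric]) (simp add: algebra_simps)
      finally have "ennreal (min 1 (d x powr p) / d x powr (Q + \<alpha>)) \<le> ennreal (a i) * indicator (A i) x"
        using small x by (simp add: A_def ennreal_leI)
      then show ?thesis using sum_ge[of "\<lambda>i. ennreal (a i)" i A x] by (meson add_increasing2 order_trans zero_le)
    next
      case large
      have "(2 powr real i) powr (Q + \<alpha>) \<le> d x powr (Q + \<alpha>)"
        using large Q p by (intro powr_mono2) auto
      then have 2: "2 powr (real i * (Q + \<alpha>)) \<le> d x powr (Q + \<alpha>)" by (simp add: powr_powr)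
      have "min 1 (d x powr p) / d x powr (Q + \<alpha>) \<le> 1 / 2 powr (real i * (Q + \<alpha>))"
        using 2 by (intro frac_le) auto
      also have "\<dots> = b i" unfolding b_def by (simp add: powr_minus divide_inverse)
      finally have "ennreal (min 1 (d x powr p) / d x powr (Q + \<alpha>)) \<le> ennreal (b i) * indicator (B i) x"
        using large x by (simp add: B_def ennreal_leI)
      then show ?thesis using sum_ge[of "\<lambda>i. ennreal (b i)" i B x] by (meson add_increasing order_trans zero_le)
    qed
  qed
  have r: "0 < 2 powr (\<alpha> - p)" "2 powr (\<alpha> - p) < 1" "0 < 2 powr (- \<alpha>)" "2 powr (- \<alpha>) < (1::real)"
    using p by (auto simp: powr_less_one)
  have "ennreal (a i) * emeasure M (A i) \<le> ennreal (c * 2 powr (Q + \<alpha>) * (2 powr (\<alpha> - p)) ^ i)" for i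
  proof -
    have "ennreal (a i) * emeasure M (A i) \<le> ennreal (a i) * ennreal (c * (2 powr (- real i)) powr Q)"
      unfolding A_def by (intro mult_left_mono vol) auto
    also have "\<dots> = ennreal (c * (a i * (2 powr (- real i)) powr Q))"
      using c by (subst ennreal_mult'[symmetric]) (auto simp: a_def mult_ac)
    also have "a i * (2 powr (- real i)) powr Q = 2 powr (Q + \<alpha>) * (2 powr (\<alpha> - p)) ^ i"
    proof -
      have "(2 powr (- real i)) powr Q = 2 powr (- (real i * Q))" by (simp add: powr_powr)
      moreover have "(2 powr (\<alpha> - p)) ^ i = 2 powr (real i * (\<alpha> - p))"
        by (simp add: powr_realpow[symmetric] powr_powr mult.commute)
      moreover have "real (Suc i) * (Q + \<alpha>) - real i * p + - (real i * Q) = Q + \<alpha> + real i * (\<alpha> - p)"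
        by (simp add: algebra_simps)
      ultimately show ?thesis unfolding a_def by (simp only: powr_add[symmetric])
    qed
    finally show ?thesis by (simp add: mult.assoc)
  qed
  then have "(\<Sum>i. ennreal (a i) * emeasure M (A i)) \<le> (\<Sum>i. ennreal (c * 2 powr (Q + \<alpha>) * (2 powr (\<alpha> - p)) ^ i))"
    by (intro suminf_le) auto
  also have "\<dots> = ennreal (c * 2 powr (Q + \<alpha>) / (1 - 2 powr (\<alpha> - p)))"
  proof (rule suminf_ennreal_eq)
    show "(\<lambda>i. c * 2 powr (Q + \<alpha>) * (2 powr (\<alpha> - p)) ^ i) sums (c * 2 powr (Q + \<alpha>) / (1 - 2 powr (\<alpha> - p)))"
      using sums_mult[OF geometric_sums, of "2 powr (\<alpha> - p)" "c * 2 powr (Q + \<alpha>)"] r by simp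
  qed (use c in auto)
  finally have sa: "(\<Sum>i. ennreal (a i) * emeasure M (A i)) \<le> ennreal (c * 2 powr (Q + \<alpha>) / (1 - 2 powr (\<alpha> - p)))" .
  have "ennreal (b i) * emeasure M (B i) \<le> ennreal (c * 2 powr Q * (2 powr (- \<alpha>)) ^ i)" for i
  proof -
    have "ennreal (b i) * emeasure M (B i) \<le> ennreal (b i) * ennreal (c * (2 powr (real (Suc i))) powr Q)"
      unfolding B_def by (intro mult_left_mono vol) auto
    also have "\<dots> = ennreal (c * (b i * (2 powr (real (Suc i))) powr Q))"
      using c by (subst ennreal_mult'[symmetric]) (auto simp: b_def mult_ac)
    also have "b i * (2 powr (real (Suc i))) powr Q = 2 powr Q * (2 powr (- \<alpha>)) ^ i"
    proof -
      have "(2 powr (real (Suc i))) powr Q = 2 powr (real (Suc i) * Q)" by (simp only: powr_powr)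
      moreover have "(2 powr (- \<alpha>)) ^ i = 2 powr (real i * (- \<alpha>))"
        by (simp add: powr_realpow[symmetric] powr_powr mult.commute)
      moreover have "- (real i * (Q + \<alpha>)) + real (Suc i) * Q = Q + real i * (- \<alpha>)"
        by (simp add: algebra_simps)
      ultimately show ?thesis unfolding b_def by (simp only: powr_add[symmetric])
    qed
    finally show ?thesis by (simp add: mult.assoc)
  qed
  then have "(\<Sum>i. ennreal (b i) * emeasure M (B i)) \<le> (\<Sum>i. ennreal (c * 2 powr Q * (2 powr (- \<alpha>)) ^ i))"
    by (intro suminf_le) auto
  also have "\<dots> = ennreal (c * 2 powr Q / (1 - 2 powr (- \<alpha>)))"
  proof (rule suminf_ennreal_eq)
    show "(\<lambda>i. c * 2 powr Q * (2 powr (- \<alpha>)) ^ i) sums (c * 2 powr Q / (1 - 2 powr (- \<alpha>)))"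
      using sums_mult[OF geometric_sums, of "2 powr (- \<alpha>)" "c * 2 powr Q"] r by simp
  qed (use c in auto)
  finally have sb: "(\<Sum>i. ennreal (b i) * emeasure M (B i)) \<le> ennreal (c * 2 powr Q / (1 - 2 powr (- \<alpha>)))" .
  have "(\<integral>\<^sup>+x. ennreal (min 1 (d x powr p) / d x powr (Q + \<alpha>)) \<partial>M)
     \<le> (\<integral>\<^sup>+x. (\<Sum>i. ennreal (a i) * indicator (A i) x) + (\<Sum>i. ennreal (b i) * indicator (B i) x) \<partial>M)"
    by (intro nn_integral_mono pw)
  also have "\<dots> = (\<Sum>i. ennreal (a i) * emeasure M (A i)) + (\<Sum>i. ennreal (b i) * emeasure M (B i))"
    by (subst nn_integral_add) (auto simp: nn_integral_suminf nn_integral_cmult)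
  also have "\<dots> \<le> ennreal (c * 2 powr (Q + \<alpha>) / (1 - 2 powr (\<alpha> - p))) + ennreal (c * 2 powr Q / (1 - 2 powr (- \<alpha>)))"
    by (intro add_mono sa sb)
  also have "\<dots> = ennreal (c * 2 powr (Q + \<alpha>) / (1 - 2 powr (\<alpha> - p)) + c * 2 powr Q / (1 - 2 powr (- \<alpha>)))"
    using c r by (subst ennreal_plus) auto
  finally show ?thesis .
qed

section \<open>The kernel of the fractional operator and its energy\<close>

locale fractional_kernel = quasi_normed_group mul ginv k \<sigma> \<rho>
  for mul :: "real^'n::finite \<Rightarrow> real^'n \<Rightarrow> real^'n" and ginv k \<sigma> \<rho> +
  fixes Q s p :: real
  assumes Q_eq: "Q = real (homogeneous_dim k \<sigma>)"
    and s: "0 < s" "s < 1" and p: "1 < p" "p < Q" "p * s < Q"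
begin

lemma Q_pos: "0 < Q" using p by simp

lemma ps_pos: "0 < p * s" "p * s < p" using s p by simp_all

text \<open>On the diagonal the weight is \<open>1 / 0 = 0\<close>.\<close>

definition wt :: "real^'n \<Rightarrow> real^'n \<Rightarrow> real" where
  "wt x y = 1 / gdist x y powr (Q + p * s)"

lemma frac_kernel_eq: "t / frac_kernel mul ginv \<rho> Q s p x y = t * wt x y"
  by (simp add: frac_kernel_def wt_def gdist_def)

lemma wt_nonneg [simp]: "0 \<le> wt x y" by (simp add: wt_def)

lemma wt_commute: "wt x y = wt y x" by (simp add: wt_def gdist_commute)

lemma measurable_gdist [measurable]:
  assumes [measurable]: "f \<in> M \<rightarrow>\<^sub>M borel" "g \<in> M \<rightarrow>\<^sub>M borel"
  shows "(\<lambda>z. gdist (f z) (g z)) \<in> borel_measurable M"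
proof -
  have "(\<lambda>z. (f z, g z)) \<in> M \<rightarrow>\<^sub>M borel" by (rule borel_measurable_Pair) measurable
  from measurable_compose[OF this borel_measurable_continuous_onI[OF continuous_gdist]]
  show ?thesis by simp
qed

lemma measurable_wt [measurable]:
  assumes [measurable]: "f \<in> M \<rightarrow>\<^sub>M borel" "g \<in> M \<rightarrow>\<^sub>M borel"
  shows "(\<lambda>z. wt (f z) (g z)) \<in> borel_measurable M"
  unfolding wt_def by measurable

lemma lebesgue_borel_id [measurable]: "(\<lambda>x. x) \<in> lebesgue \<rightarrow>\<^sub>M borel"
  by (simp add: measurable_completion)

definition energy :: "(real^'n \<Rightarrow> real) \<Rightarrow> ennreal" where
  "energy v = (\<integral>\<^sup>+z. ennreal (\<bar>v (fst z) - v (snd z)\<bar> powr p * wt (fst z) (snd z)) \<partial>(lebesgue \<Otimes>\<^sub>M lebesgue))"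

lemma gagliardo_eq: "gagliardo mul ginv \<rho> Q s p v = ennreal_root p (energy v)"
  by (simp add: gagliardo_def energy_def frac_kernel_eq case_prod_unfold)

text \<open>Among all sets of given measure, balls centred at \<open>x\<close> carry most of the kernel; hence a ball of
  twice the measure of \<open>E\<close> leaves a definite amount of kernel mass outside \<open>E\<close>.\<close>

lemma kernel_mass_outside:
  assumes E: "E \<in> sets lebesgue" "emeasure lebesgue E = ennreal m" and m: "0 < m"
  shows "ennreal ((2 / unit_ball_volume) powr (- (1 + p * s / Q)) * m powr (- (p * s / Q)))
     \<le> (\<integral>\<^sup>+y. ennreal (wt x y) * indicator (- E) y \<partial>lebesgue)"
proof -
  let ?c = unit_ball_volume
  have c: "0 < ?c" by (rule unit_ball_volume_pos)
  \<comment> \<open>This radius gives the ball around x exactly the measure 2 m.\<close>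
  define r where "r = (2 * m / ?c) powr (1 / Q)"
  have r: "0 < r" using c m by (simp add: r_def)
  define B where "B = {y. gdist y x < r}"
  have "(\<lambda>y. gdist y x) \<in> lebesgue \<rightarrow>\<^sub>M borel" by measurable
  then have "{y\<in>space lebesgue. gdist y x < r} \<in> sets lebesgue" by measurable
  then have B[measurable]: "B \<in> sets lebesgue" by (simp add: B_def)
  note E(1)[measurable]
  have "emeasure lebesgue B = ennreal (?c * r powr Q)"
    unfolding B_def Q_eq by (rule emeasure_gdist_ball[OF r])
  also have "?c * r powr Q = 2 * m" using c m Q_pos by (simp add: r_def powr_powr)
  finally have "ennreal (2 * m) = emeasure lebesgue B" by simp
  \<comment> \<open>The centre is split off because \<open>wt x x\<close> is 0 there, so the lower
    bound for the kernel fails at that one point, a null set.\<close>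
  also have "\<dots> \<le> emeasure lebesgue ((B - E - {x}) \<union> (E \<union> {x}))"
    by (intro emeasure_mono sets.Un) auto
  also have "\<dots> \<le> emeasure lebesgue (B - E - {x}) + emeasure lebesgue (E \<union> {x})"
    by (intro emeasure_subadditive sets.Un) auto
  also have "\<dots> \<le> emeasure lebesgue (B - E - {x}) + (emeasure lebesgue E + emeasure lebesgue {x})"
    by (intro add_left_mono emeasure_subadditive) auto
  finally have "ennreal (2 * m) \<le> emeasure lebesgue (B - E - {x}) + ennreal m" using E by simp
  then have "ennreal m \<le> emeasure lebesgue (B - E - {x})"
    using m by (cases "emeasure lebesgue (B - E - {x})") (auto simp: ennreal_plus[symmetric] top_unique simp del: ennreal_plus)
  then have "ennreal (r powr (- (Q + p * s))) * ennreal m \<le> ennreal (r powr (- (Q + p * s))) * emeasure lebesgue (B - E - {x})"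
    by (rule mult_left_mono) auto
  also have "\<dots> = (\<integral>\<^sup>+y. ennreal (r powr (- (Q + p * s))) * indicator (B - E - {x}) y \<partial>lebesgue)"
    by (rule nn_integral_cmult_indicator[symmetric]) auto
  also have "\<dots> \<le> (\<integral>\<^sup>+y. ennreal (wt x y) * indicator (- E) y \<partial>lebesgue)"
  proof (intro nn_integral_mono)
    fix y
    have "r powr (- (Q + p * s)) \<le> wt x y" if "gdist y x < r" "y \<noteq> x"
    proof -
      have "0 < gdist x y" using that(2) gdist_eq_0[of x y] gdist_nonneg[of x y] by (simp add: less_le)
      moreover have "gdist x y \<le> r" using that(1) gdist_commute[of x y] by simp
      ultimately have "r powr (- (Q + p * s)) \<le> gdist x y powr (- (Q + p * s))"
        using less_imp_le[OF add_pos_pos[OF Q_pos ps_pos(1)]] by (intro powr_mono2') linarith+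
      then show ?thesis by (simp only: wt_def powr_minus inverse_eq_divide)
    qed
    then show "ennreal (r powr (- (Q + p * s))) * indicator (B - E - {x}) y \<le> ennreal (wt x y) * indicator (- E) y"
      by (auto simp: indicator_def B_def ennreal_leI)
  qed
  finally have "ennreal (r powr (- (Q + p * s))) * ennreal m \<le> (\<integral>\<^sup>+y. ennreal (wt x y) * indicator (- E) y \<partial>lebesgue)" .
  moreover have "ennreal (r powr (- (Q + p * s))) * ennreal m = ennreal (r powr (- (Q + p * s)) * m)"
    using m by (simp add: ennreal_mult)
  \<comment> \<open>Since r^Q is proportional to m, the power of r is m^(-1 - \<theta>) up to a
    constant, and the measure of the remaining part of the ball gives back one factor m.\<close>
  moreover have "r powr (- (Q + p * s)) * m = (2 / ?c) powr (- (1 + p * s / Q)) * m powr (- (p * s / Q))"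
  proof -
    have "1 / Q * (- (Q + p * s)) = - (1 + p * s / Q)" using Q_pos by (simp add: field_simps)
    then have "r powr (- (Q + p * s)) = ((2 / ?c) * m) powr (- (1 + p * s / Q))" by (simp add: r_def powr_powr)
    also have "\<dots> = (2 / ?c) powr (- (1 + p * s / Q)) * m powr (- (1 + p * s / Q))"
      using c m by (subst powr_mult) auto
    also have "m powr (- (1 + p * s / Q)) * m powr 1 = m powr (- (p * s / Q))"
      by (subst powr_add[symmetric]) simp
    ultimately show ?thesis using m by (simp add: mult.assoc)
  qed
  ultimately show ?thesis by simp
qed

text \<open>If u x > b and u y \<le> a, the truncated values at x and y differ by at least b - a.
  For each such x the kernel is integrated over all such y, where \<open>kernel_mass_outside\<close>
  bounds its mass from below, and then over x. This is the substitute for a Sobolev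
  inequality.\<close>

lemma superlevel_le_energy:
  fixes u :: "real^'n \<Rightarrow> real"
  assumes u[measurable]: "u \<in> borel_measurable lebesgue" and ab: "a < b"
    and fin: "emeasure lebesgue {x. a < u x} < \<infinity>" and en: "energy (\<lambda>x. max 0 (u x - a)) < \<infinity>"
  shows "(b - a) powr p * measure lebesgue {x. b < u x}
     \<le> (2 / unit_ball_volume) powr (1 + p * s / Q) * measure lebesgue {x. a < u x} powr (p * s / Q)
        * enn2real (energy (\<lambda>x. max 0 (u x - a)))"
proof -
  define A where "A t = {x. t < u x}" for t
  have "{x\<in>space lebesgue. t < u x} \<in> sets lebesgue" for t by measurable
  then have A[measurable]: "A t \<in> sets lebesgue" for t by (simp add: A_def)
  define m where "m = measure lebesgue (A a)"
  have Aa: "emeasure lebesgue (A a) = ennreal m"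
    using fin by (simp add: m_def A_def emeasure_eq_ennreal_measure less_top)
  have "A b \<subseteq> A a" using ab by (auto simp: A_def)
  then have Aba: "emeasure lebesgue (A b) \<le> emeasure lebesgue (A a)" by (intro emeasure_mono A)
  then have Ab: "emeasure lebesgue (A b) = ennreal (measure lebesgue (A b))"
    using Aa by (intro emeasure_eq_ennreal_measure) (auto simp: top_unique)
  let ?K = "(2 / unit_ball_volume) powr (- (1 + p * s / Q))"
  let ?w = "\<lambda>x. max 0 (u x - a)"
  show ?thesis
  proof (cases "m = 0")
    case True
    then have "measure lebesgue (A b) = 0"
      using Aba Aa Ab by simp
    then show ?thesis by (simp add: A_def)
  next
    case False
    then have m: "0 < m" by (simp add: m_def less_le)
    have "ennreal ((b - a) powr p) * (ennreal (?K * m powr (- (p * s / Q))) * emeasure lebesgue (A b))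
       = (\<integral>\<^sup>+x. ennreal ((b - a) powr p) * (ennreal (?K * m powr (- (p * s / Q))) * indicator (A b) x) \<partial>lebesgue)"
      by (simp add: nn_integral_cmult)
    also have "\<dots> \<le> (\<integral>\<^sup>+x. \<integral>\<^sup>+y. ennreal (\<bar>?w x - ?w y\<bar> powr p * wt x y) \<partial>lebesgue \<partial>lebesgue)"
    proof (intro nn_integral_mono)
      fix x
      show "ennreal ((b - a) powr p) * (ennreal (?K * m powr (- (p * s / Q))) * indicator (A b) x)
         \<le> (\<integral>\<^sup>+y. ennreal (\<bar>?w x - ?w y\<bar> powr p * wt x y) \<partial>lebesgue)"
      proof (cases "x \<in> A b")
        case True
        have "ennreal ((b - a) powr p) * ennreal (?K * m powr (- (p * s / Q)))
           \<le> ennreal ((b - a) powr p) * (\<integral>\<^sup>+y. ennreal (wt x y) * indicator (- A a) y \<partial>lebesgue)"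
          by (intro mult_left_mono kernel_mass_outside Aa m) auto
        also have "\<dots> = (\<integral>\<^sup>+y. ennreal ((b - a) powr p) * (ennreal (wt x y) * indicator (- A a) y) \<partial>lebesgue)"
          by (simp add: nn_integral_cmult)
        also have "\<dots> \<le> (\<integral>\<^sup>+y. ennreal (\<bar>?w x - ?w y\<bar> powr p * wt x y) \<partial>lebesgue)"
        proof (intro nn_integral_mono)
          fix y
          have "(b - a) powr p * wt x y \<le> \<bar>?w x - ?w y\<bar> powr p * wt x y" if "y \<notin> A a"
            using that True ab p by (intro mult_right_mono powr_mono2) (auto simp: A_def)
          then show "ennreal ((b - a) powr p) * (ennreal (wt x y) * indicator (- A a) y) \<le> ennreal (\<bar>?w x - ?w y\<bar> powr p * wt x y)"
            by (auto simp: indicator_def ennreal_mult[symmetric] ennreal_leI)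
        qed
        finally show ?thesis using True by simp
      qed simp
    qed
    also have "\<dots> = energy ?w"
      unfolding energy_def
      by (subst lebesgue.nn_integral_fst[symmetric]) auto
    finally have "ennreal ((b - a) powr p * (?K * m powr (- (p * s / Q)) * measure lebesgue (A b))) \<le> energy ?w"
      by (simp add: Ab ennreal_mult)
    then have "(b - a) powr p * (?K * m powr (- (p * s / Q)) * measure lebesgue (A b)) \<le> enn2real (energy ?w)"
      using en by (cases "energy ?w") (auto simp: ennreal_le_iff)
    then have le: "(?K * m powr (- (p * s / Q))) * ((b - a) powr p * measure lebesgue (A b)) \<le> enn2real (energy ?w)"
      by (simp add: mult_ac)
    define X where "X = (2 / unit_ball_volume) powr (1 + p * s / Q) * m powr (p * s / Q)"
    have X: "0 < X" using m unit_ball_volume_pos by (simp add: X_def)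
    have "?K * m powr (- (p * s / Q)) = inverse X"
      unfolding X_def by (simp only: powr_minus inverse_mult_distrib)
    then have "(b - a) powr p * measure lebesgue (A b) = X * ((?K * m powr (- (p * s / Q))) * ((b - a) powr p * measure lebesgue (A b)))"
      using X by simp
    also have "\<dots> \<le> X * enn2real (energy ?w)" using le X by (intro mult_left_mono) auto
    finally show ?thesis unfolding X_def m_def A_def .
  qed
qed

text \<open>For y close to x write y = x z with z of small gauge. Multiplication is Lipschitz on a
  compact set, so the Euclidean distance of x and y is at most a multiple of the norm of z, hence of
  its gauge; \<phi> is Lipschitz there too. For distant y the boundedness of \<phi> is
  enough.\<close>

lemma lipschitz_gdist:
  assumes \<phi>: "smooth \<phi>" and S: "compact S" and out: "\<And>x. x \<notin> S \<Longrightarrow> \<phi> x = 0"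
  shows "\<exists>C\<ge>0. \<forall>x\<in>S. \<forall>y. \<bar>\<phi> x - \<phi> y\<bar> \<le> C * min 1 (gdist x y)"
proof -
  obtain M where M: "0 < M" and M': "\<And>x. \<bar>\<phi> x\<bar> \<le> M"
    using smooth_compact_support_bounded[OF \<phi> S out] by blast
  obtain R where "\<forall>x\<in>S. norm x \<le> R" using compact_imp_bounded[OF S] unfolding bounded_iff by blast
  then have R: "S \<subseteq> cball 0 R" by auto
  obtain \<eta> C1 where \<eta>: "0 < \<eta>" "0 \<le> C1" "\<And>z. \<rho> z < \<eta> \<Longrightarrow> norm z \<le> 1 \<and> norm z \<le> C1 * \<rho> z"
    using norm_le_rho by blast
  let ?F = "\<lambda>z. mul (fst z) (snd z)" and ?K = "cball (0::real^'n) R \<times> cball (0::real^'n) 1"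
  have K: "compact ?K" "convex ?K" by (auto intro!: compact_Times convex_Times)
  obtain L1 where L1: "0 \<le> L1" "\<And>a b. a \<in> ?K \<Longrightarrow> b \<in> ?K \<Longrightarrow> norm (?F a - ?F b) \<le> L1 * norm (a - b)"
    using smooth_lipschitz_on_compact_convex[OF smooth_mul K] by blast
  have "bounded (?F ` ?K)"
    by (intro compact_imp_bounded compact_continuous_image continuous_on_subset[OF continuous_mul] K subset_UNIV)
  then obtain R' where "\<forall>x\<in>?F ` ?K. norm x \<le> R'" unfolding bounded_iff by blast
  then have R': "?F ` ?K \<subseteq> cball 0 R'" by auto
  obtain L2 where L2: "0 \<le> L2" "\<And>a b. a \<in> cball 0 R' \<Longrightarrow> b \<in> cball 0 R' \<Longrightarrow> norm (\<phi> a - \<phi> b) \<le> L2 * norm (a - b)"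
    using smooth_lipschitz_on_compact_convex[OF \<phi>, of "cball 0 R'"] by auto
  \<comment> \<open>The first entry covers gauge distances of at least \<eta> and the cap at 1; the
    second is the product of the three Lipschitz constants for distances below \<eta>.\<close>
  define C where "C = max (2 * M / min 1 \<eta>) (L2 * L1 * C1)"
  have C0: "0 \<le> C" using M \<eta> by (simp add: C_def le_max_iff_disj)
  have M2: "2 * M \<le> C * min 1 \<eta>" and CL: "L2 * L1 * C1 \<le> C"
    using \<eta> by (simp_all add: C_def pos_divide_le_eq[symmetric])
  have "2 * M \<le> C" using order_trans[OF M2 mult_left_mono[OF min.cobounded1 C0, of 1 \<eta>]] by simp
  have "\<bar>\<phi> x - \<phi> y\<bar> \<le> C * min 1 (gdist x y)" if x: "x \<in> S" for x y
  proof -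
    have b: "\<bar>\<phi> x - \<phi> y\<bar> \<le> 2 * M" using M'[of x] M'[of y] by linarith
    show ?thesis
    proof (cases "gdist x y < \<eta>")
      case False
      then have "C * min 1 \<eta> \<le> C * min 1 (gdist x y)" using C0 by (intro mult_left_mono) auto
      then show ?thesis using b M2 by linarith
    next
      case True
      define z where "z = mul (ginv x) y"
      have z: "\<rho> z = gdist x y" unfolding z_def gdist_commute[of x y] by (simp add: gdist_def)
      have y: "y = mul x z" by (simp add: z_def mul_ginv_cancel)
      have x0: "mul x 0 = x" by (metis assoc group_left_neutral left_inverse mul_ginv_cancel(1))
      have nz: "norm z \<le> 1" "norm z \<le> C1 * gdist x y" using \<eta>(3)[of z] True z by auto
      have inK: "(x, z) \<in> ?K" "(x, 0) \<in> ?K" using x R nz by auto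
      have "norm (y - x) \<le> L1 * norm z"
        using L1(2)[OF inK] y x0 by (simp add: norm_Pair)
      moreover have "y \<in> cball 0 R'" "x \<in> cball 0 R'"
        using R' imageI[OF inK(1), of ?F] imageI[OF inK(2), of ?F] y x0 by auto
      ultimately have "\<bar>\<phi> x - \<phi> y\<bar> \<le> L2 * (L1 * norm z)"
        using L2(1) L2(2)[of y x] mult_left_mono[of "norm (y - x)" "L1 * norm z" L2]
        by (simp add: abs_minus_commute)
      also have "\<dots> \<le> L2 * (L1 * (C1 * gdist x y))" using L1 L2 nz by (intro mult_left_mono) auto
      also have "\<dots> = (L2 * L1 * C1) * gdist x y" by simp
      also have "\<dots> \<le> C * gdist x y" using CL by (intro mult_right_mono) auto
      finally have "\<bar>\<phi> x - \<phi> y\<bar> \<le> C * gdist x y" .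
      then show ?thesis using b \<open>2 * M \<le> C\<close> by (auto simp: min_def)
    qed
  qed
  then show ?thesis using C0 by blast
qed

text \<open>The integrand vanishes unless x or y lies in the support \<open>S\<close>, and by
  symmetry both cases are alike. There it is at most a multiple of min 1 d^p / d^(Q + p s), with d
  the gauge distance. Its integral in one variable is bounded uniformly in the other, since 0 < p s
  < p, and \<open>S\<close> has finite measure.\<close>

lemma energy_test_function_finite:
  assumes \<phi>: "\<phi> \<in> Cc_infty \<Omega>"
  shows "energy \<phi> < \<infinity>"
proof -
  define S where "S = closure {x. \<phi> x \<noteq> 0}"
  have S: "compact S" and sm: "smooth \<phi>" using \<phi> by (auto simp: Cc_infty_def S_def)
  have out: "\<phi> x = 0" if "x \<notin> S" for x using that Cc_infty_outside unfolding S_def by blast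
  obtain C where C: "0 \<le> C" "\<And>x y. x \<in> S \<Longrightarrow> \<bar>\<phi> x - \<phi> y\<bar> \<le> C * min 1 (gdist x y)"
    using lipschitz_gdist[OF sm S out] by blast
  have Sm[measurable]: "S \<in> sets lebesgue" using S by (simp add: compact_imp_closed)
  have "\<phi> \<in> borel_measurable borel" using smooth_continuous[OF sm] by (rule borel_measurable_continuous_onI)
  then have [measurable]: "\<phi> \<in> borel_measurable lebesgue" by (simp add: measurable_completion)
  define g where "g x y = min 1 (gdist x y powr p) / gdist x y powr (Q + p * s)" for x y
  have g0: "0 \<le> g x y" for x y by (simp add: g_def)
  have gc: "g x y = g y x" for x y by (simp add: g_def gdist_commute)
  obtain K :: real where K: "\<And>x. (\<integral>\<^sup>+y. ennreal (g x y) \<partial>lebesgue) \<le> ennreal K"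
  proof
    fix x
    have "(\<integral>\<^sup>+y. ennreal (min 1 (gdist y x powr p) / gdist y x powr (Q + p * s)) \<partial>lebesgue)
      \<le> ennreal (unit_ball_volume * 2 powr (Q + p * s) / (1 - 2 powr (p * s - p)) + unit_ball_volume * 2 powr Q / (1 - 2 powr (- (p * s))))"
    proof (rule nn_integral_radial_le)
      show "(\<lambda>y. gdist y x) \<in> borel_measurable lebesgue" by measurable
      fix r :: real assume "0 < r"
      then show "emeasure lebesgue {y \<in> space lebesgue. gdist y x < r} \<le> ennreal (unit_ball_volume * r powr Q)"
        using emeasure_gdist_ball[of r x] by (simp add: Q_eq)
    qed (use Q_pos ps_pos unit_ball_volume_pos in auto)
    then show "(\<integral>\<^sup>+y. ennreal (g x y) \<partial>lebesgue)
      \<le> ennreal (unit_ball_volume * 2 powr (Q + p * s) / (1 - 2 powr (p * s - p)) + unit_ball_volume * 2 powr Q / (1 - 2 powr (- (p * s))))"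
      by (simp add: g_def gdist_commute[of x])
  qed
  have gm[measurable]: "(\<lambda>z. g (fst z) (snd z)) \<in> borel_measurable (lebesgue \<Otimes>\<^sub>M lebesgue)"
    unfolding g_def by measurable
  have half: "\<bar>\<phi> x - \<phi> y\<bar> powr p * wt x y \<le> C powr p * g x y" if "x \<in> S" for x y
  proof -
    have "\<bar>\<phi> x - \<phi> y\<bar> powr p \<le> (C * min 1 (gdist x y)) powr p"
      using C(2)[OF that, of y] p by (intro powr_mono2) auto
    also have "\<dots> = C powr p * (min 1 (gdist x y)) powr p" using C by (simp add: powr_mult)
    also have "(min 1 (gdist x y)) powr p = min 1 (gdist x y powr p)"
    proof (cases "gdist x y \<le> 1")
      case True
      then show ?thesis using powr_le1[of p "gdist x y"] p by simp
    next
      case False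
      then show ?thesis using ge_one_powr_ge_zero[of "gdist x y" p] p by simp
    qed
    finally show ?thesis using mult_right_mono[of _ _ "wt x y"] by (simp add: g_def wt_def mult.assoc)
  qed
  have fin: "(\<integral>\<^sup>+x. \<integral>\<^sup>+y. ennreal (C powr p * g x y) * indicator S x \<partial>lebesgue \<partial>lebesgue) < \<infinity>"
  proof -
    have "(\<integral>\<^sup>+x. \<integral>\<^sup>+y. ennreal (C powr p * g x y) * indicator S x \<partial>lebesgue \<partial>lebesgue)
       \<le> (\<integral>\<^sup>+x. ennreal (C powr p * K) * indicator S x \<partial>lebesgue)"
    proof (rule nn_integral_mono)
      fix x :: "real^'n"
      have "(\<lambda>y. g x y) \<in> borel_measurable lebesgue" unfolding g_def by measurable
      then have "(\<integral>\<^sup>+y. ennreal (C powr p * g x y) * indicator S x \<partial>lebesgue) = ennreal (C powr p) * (\<integral>\<^sup>+y. ennreal (g x y) \<partial>lebesgue) * indicator S x"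
        by (simp add: nn_integral_multc nn_integral_cmult ennreal_mult g0)
      also have "\<dots> \<le> ennreal (C powr p) * ennreal K * indicator S x"
        by (intro mult_right_mono mult_left_mono K) auto
      finally show "(\<integral>\<^sup>+y. ennreal (C powr p * g x y) * indicator S x \<partial>lebesgue) \<le> ennreal (C powr p * K) * indicator S x"
        by (simp add: ennreal_mult')
    qed
    also have "\<dots> = ennreal (C powr p * K) * emeasure lebesgue S" by (simp add: nn_integral_cmult)
    also have "\<dots> < \<infinity>"
      using emeasure_bounded_finite[OF compact_imp_bounded[OF S]] S
      by (simp add: ennreal_mult_less_top compact_imp_closed)
    finally show ?thesis .
  qed
  let ?LL = "lebesgue \<Otimes>\<^sub>M (lebesgue :: (real^'n) measure)"
  have "energy \<phi> \<le> (\<integral>\<^sup>+z. ennreal (C powr p * g (fst z) (snd z)) * indicator S (fst z) + ennreal (C powr p * g (fst z) (snd z)) * indicator S (snd z) \<partial>?LL)"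
    unfolding energy_def
  proof (rule nn_integral_mono)
    fix z :: "(real^'n) \<times> (real^'n)"
    obtain x y where z: "z = (x, y)" by fastforce
    show "ennreal (\<bar>\<phi> (fst z) - \<phi> (snd z)\<bar> powr p * wt (fst z) (snd z)) \<le>
      ennreal (C powr p * g (fst z) (snd z)) * indicator S (fst z) + ennreal (C powr p * g (fst z) (snd z)) * indicator S (snd z)"
    proof (cases "x \<in> S")
      case True
      then show ?thesis using half[of x y] by (simp add: z ennreal_leI add_increasing2)
    next
      case False
      show ?thesis
      proof (cases "y \<in> S")
        case True
        then show ?thesis using half[of y x] False by (simp add: z ennreal_leI wt_commute gc abs_minus_commute)
      qed (use False out p in \<open>simp add: z\<close>)
    qed
  qed
  also have "\<dots> = (\<integral>\<^sup>+z. ennreal (C powr p * g (fst z) (snd z)) * indicator S (fst z) \<partial>?LL) + (\<integral>\<^sup>+z. ennreal (C powr p * g (fst z) (snd z)) * indicator S (snd z) \<partial>?LL)"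
    by (rule nn_integral_add) measurable
  also have "(\<integral>\<^sup>+z. ennreal (C powr p * g (fst z) (snd z)) * indicator S (fst z) \<partial>?LL) = (\<integral>\<^sup>+x. \<integral>\<^sup>+y. ennreal (C powr p * g x y) * indicator S x \<partial>lebesgue \<partial>lebesgue)"
  proof -
    have "(\<lambda>z. ennreal (C powr p * g (fst z) (snd z)) * indicator S (fst z)) \<in> borel_measurable ?LL" by measurable
    from lebesgue.nn_integral_fst[OF this] show ?thesis by simp
  qed
  also have "(\<integral>\<^sup>+z. ennreal (C powr p * g (fst z) (snd z)) * indicator S (snd z) \<partial>?LL) = (\<integral>\<^sup>+y. \<integral>\<^sup>+x. ennreal (C powr p * g y x) * indicator S y \<partial>lebesgue \<partial>lebesgue)"
  proof -
    have "(\<lambda>z. ennreal (C powr p * g (fst z) (snd z)) * indicator S (snd z)) \<in> borel_measurable ?LL" by measurable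
    from lebesgue_pair.nn_integral_snd[OF this] show ?thesis using gc by simp
  qed
  finally show ?thesis using fin by (simp add: ennreal_add_less_top less_top order_le_less_trans)
qed

end

section \<open>Testing the equation with truncations\<close>

lemma AE_lebesgue_pair:
  assumes "AE x in lebesgue. P x"
  shows "AE z in lebesgue \<Otimes>\<^sub>M lebesgue. P (fst z) \<and> P (snd z)"
proof -
  obtain N where N: "N \<in> null_sets lebesgue" "{x. \<not> P x} \<subseteq> N"
    using assms by (auto simp: eventually_ae_filter)
  have "N \<times> UNIV \<in> null_sets (lebesgue \<Otimes>\<^sub>M lebesgue)" "UNIV \<times> N \<in> null_sets (lebesgue \<Otimes>\<^sub>M lebesgue)"
    using N(1) by (auto simp: null_sets_def lebesgue.emeasure_pair_measure_Times intro!: pair_measureI sets.top[of lebesgue, simplified])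
  then have "N \<times> UNIV \<union> UNIV \<times> N \<in> null_sets (lebesgue \<Otimes>\<^sub>M lebesgue)" by (rule null_sets.Un)
  then show ?thesis
    by (rule AE_I') (use N(2) in auto)
qed

context fractional_kernel begin

abbreviation (input) "LL \<equiv> lebesgue \<Otimes>\<^sub>M (lebesgue :: (real^'n) measure)"

section \<open>Calculus of the energy and of the weak form of the operator\<close>

lemma energy_add_le:
  assumes [measurable]: "v \<in> borel_measurable lebesgue" "w \<in> borel_measurable lebesgue"
  shows "energy (\<lambda>x. v x + w x) \<le> ennreal (2 powr p) * (energy v + energy w)"
proof -
  have "energy (\<lambda>x. v x + w x) \<le> (\<integral>\<^sup>+z. ennreal (2 powr p) * (ennreal (\<bar>v (fst z) - v (snd z)\<bar> powr p * wt (fst z) (snd z))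
      + ennreal (\<bar>w (fst z) - w (snd z)\<bar> powr p * wt (fst z) (snd z))) \<partial>LL)"
    unfolding energy_def
  proof (rule nn_integral_mono)
    fix z :: "(real^'n) \<times> (real^'n)"
    let ?a = "v (fst z) - v (snd z)" and ?b = "w (fst z) - w (snd z)" and ?W = "wt (fst z) (snd z)"
    have "\<bar>v (fst z) + w (fst z) - (v (snd z) + w (snd z))\<bar> powr p = \<bar>?a + ?b\<bar> powr p" by (simp add: algebra_simps)
    also have "\<dots> \<le> 2 powr p * (\<bar>?a\<bar> powr p + \<bar>?b\<bar> powr p)" using p by (intro powr_add_le) auto
    finally have "\<bar>v (fst z) + w (fst z) - (v (snd z) + w (snd z))\<bar> powr p * ?W \<le> 2 powr p * (\<bar>?a\<bar> powr p + \<bar>?b\<bar> powr p) * ?W"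
      by (rule mult_right_mono) simp
    then have "ennreal (\<bar>v (fst z) + w (fst z) - (v (snd z) + w (snd z))\<bar> powr p * ?W)
      \<le> ennreal (2 powr p * (\<bar>?a\<bar> powr p * ?W + \<bar>?b\<bar> powr p * ?W))" by (intro ennreal_leI) (simp add: algebra_simps)
    then show "ennreal (\<bar>v (fst z) + w (fst z) - (v (snd z) + w (snd z))\<bar> powr p * ?W)
      \<le> ennreal (2 powr p) * (ennreal (\<bar>?a\<bar> powr p * ?W) + ennreal (\<bar>?b\<bar> powr p * ?W))"
      by (simp add: ennreal_mult)
  qed
  also have "\<dots> = ennreal (2 powr p) * (energy v + energy w)"
    unfolding energy_def by (subst nn_integral_cmult) (auto intro!: arg_cong2[where f="(*)"] nn_integral_add)
  finally show ?thesis .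
qed

lemma energy_minus: "energy (\<lambda>x. - v x) = energy v"
  unfolding energy_def by (intro nn_integral_cong) (simp add: abs_minus_commute)

lemma energy_lipschitz_le:
  assumes "\<And>x y. \<bar>w x - w y\<bar> \<le> \<bar>v x - v y\<bar>"
  shows "energy w \<le> energy v"
  unfolding energy_def using p
  by (intro nn_integral_mono ennreal_leI mult_right_mono powr_mono2 assms) auto

lemma energy_integrable:
  assumes [measurable]: "v \<in> borel_measurable lebesgue" and fin: "energy v < \<infinity>"
  shows "integrable LL (\<lambda>z. \<bar>v (fst z) - v (snd z)\<bar> powr p * wt (fst z) (snd z))"
    and "(\<integral>z. \<bar>v (fst z) - v (snd z)\<bar> powr p * wt (fst z) (snd z) \<partial>LL) = enn2real (energy v)"
  using fin unfolding energy_def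
  by (auto intro!: integrableI_nonneg simp: integral_eq_nn_integral)

definition flux :: "(real^'n \<Rightarrow> real) \<Rightarrow> (real^'n) \<times> (real^'n) \<Rightarrow> real" where
  "flux u z = \<bar>u (fst z) - u (snd z)\<bar> powr (p - 2) * (u (fst z) - u (snd z)) * wt (fst z) (snd z)"

lemma frac_p_sublaplacian_eq:
  "frac_p_sublaplacian mul ginv \<rho> Q s p u \<phi> = (\<integral>z. flux u z * (\<phi> (fst z) - \<phi> (snd z)) \<partial>LL)"
  unfolding frac_p_sublaplacian_def flux_def frac_kernel_eq
  by (intro Bochner_Integration.integral_cong refl) (simp add: case_prod_unfold mult_ac)

lemma measurable_flux [measurable]:
  assumes [measurable]: "u \<in> borel_measurable lebesgue"
  shows "flux u \<in> borel_measurable LL"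
  unfolding flux_def by measurable

lemma flux_bound:
  assumes "0 < \<epsilon>"
  shows "\<bar>flux u z * b\<bar> \<le> \<epsilon> * (\<bar>u (fst z) - u (snd z)\<bar> powr p * wt (fst z) (snd z)) + \<epsilon> powr (1 - p) * (\<bar>b\<bar> powr p * wt (fst z) (snd z))"
proof -
  let ?a = "u (fst z) - u (snd z)" and ?W = "wt (fst z) (snd z)"
  have "\<bar>flux u z * b\<bar> = \<bar>?a\<bar> powr (p - 1) * \<bar>b\<bar> * ?W"
    by (simp add: flux_def abs_mult abs_signed_powr[symmetric] mult_ac)
  also have "\<dots> \<le> (\<epsilon> * \<bar>?a\<bar> powr p + \<epsilon> powr (1 - p) * \<bar>b\<bar> powr p) * ?W"
    using assms p by (intro mult_right_mono young_scaled) auto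
  finally show ?thesis by (simp add: algebra_simps)
qed

lemma flux_integrable:
  assumes [measurable]: "u \<in> borel_measurable lebesgue" "v \<in> borel_measurable lebesgue"
    and fin: "energy u < \<infinity>" "energy v < \<infinity>"
  shows "integrable LL (\<lambda>z. flux u z * (v (fst z) - v (snd z)))"
proof (rule Bochner_Integration.integrable_bound)
  show "integrable LL (\<lambda>z. 1 * (\<bar>u (fst z) - u (snd z)\<bar> powr p * wt (fst z) (snd z)) + 1 powr (1 - p) * (\<bar>v (fst z) - v (snd z)\<bar> powr p * wt (fst z) (snd z)))"
    using energy_integrable(1)[OF assms(1) fin(1)] energy_integrable(1)[OF assms(2) fin(2)] by simp
  show "AE z in LL. norm (flux u z * (v (fst z) - v (snd z))) \<le> norm (1 * (\<bar>u (fst z) - u (snd z)\<bar> powr p * wt (fst z) (snd z)) + 1 powr (1 - p) * (\<bar>v (fst z) - v (snd z)\<bar> powr p * wt (fst z) (snd z)))"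
  proof (rule AE_I2)
    fix z
    show "norm (flux u z * (v (fst z) - v (snd z))) \<le> norm (1 * (\<bar>u (fst z) - u (snd z)\<bar> powr p * wt (fst z) (snd z)) + 1 powr (1 - p) * (\<bar>v (fst z) - v (snd z)\<bar> powr p * wt (fst z) (snd z)))"
      using flux_bound[of 1 u z "v (fst z) - v (snd z)"] by simp
  qed
qed measurable

lemma frac_p_sublaplacian_bound:
  assumes u: "u \<in> borel_measurable lebesgue" and v: "v \<in> borel_measurable lebesgue"
    and fin: "energy u < \<infinity>" "energy v < \<infinity>" and \<epsilon>: "0 < \<epsilon>"
  shows "\<bar>frac_p_sublaplacian mul ginv \<rho> Q s p u v\<bar> \<le> \<epsilon> * enn2real (energy u) + \<epsilon> powr (1 - p) * enn2real (energy v)"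
proof -
  note iu = energy_integrable[OF u fin(1)] and iv = energy_integrable[OF v fin(2)]
  have "\<bar>\<integral>z. flux u z * (v (fst z) - v (snd z)) \<partial>LL\<bar> \<le> (\<integral>z. \<bar>flux u z * (v (fst z) - v (snd z))\<bar> \<partial>LL)"
    by (rule integral_abs_bound)
  also have "\<dots> \<le> (\<integral>z. \<epsilon> * (\<bar>u (fst z) - u (snd z)\<bar> powr p * wt (fst z) (snd z)) + \<epsilon> powr (1 - p) * (\<bar>v (fst z) - v (snd z)\<bar> powr p * wt (fst z) (snd z)) \<partial>LL)"
    using flux_integrable[OF u v fin] iu(1) iv(1)
    by (intro integral_mono flux_bound \<epsilon>) auto
  also have "\<dots> = \<epsilon> * enn2real (energy u) + \<epsilon> powr (1 - p) * enn2real (energy v)"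
    using iu iv by simp
  finally show ?thesis by (simp add: frac_p_sublaplacian_eq)
qed

section \<open>Approximation by test functions in the energy space\<close>

lemma Cc_infty_measurable: "\<phi> \<in> Cc_infty \<Omega> \<Longrightarrow> \<phi> \<in> borel_measurable lebesgue"
  unfolding Cc_infty_def
  by (auto intro!: measurable_completion borel_measurable_continuous_onI smooth_continuous)

lemma ennreal_root_less:
  assumes "ennreal_root p I < ennreal \<epsilon>" "0 < \<epsilon>"
  shows "I < ennreal (\<epsilon> powr p)"
proof (cases I)
  case (real i)
  then have "i powr (1 / p) < \<epsilon>" using assms by (simp add: ennreal_root_def ennreal_less_iff)
  then have "(i powr (1 / p)) powr p < \<epsilon> powr p" using p by (intro powr_less_mono2) auto
  then show ?thesis using real p by (simp add: powr_powr ennreal_less_iff)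
next
  case top
  then show ?thesis using assms by (simp add: ennreal_root_def)
qed

text \<open>The rate is imposed on the p-th powers themselves, so that the errors are summable. This
  later yields almost everywhere convergence of the full sequence and an explicit energy bound for
  \<phi>_n - \<phi>_m.\<close>

lemma X0_approx:
  assumes u: "u \<in> X0 mul ginv \<rho> Q s p \<Omega>"
  shows "\<exists>\<phi>. \<forall>n. \<phi> n \<in> Cc_infty \<Omega> \<and> energy (\<lambda>x. u x - \<phi> n x) \<le> ennreal ((1 / 2) ^ n) \<and>
      (\<integral>\<^sup>+x. ennreal (\<bar>u x - \<phi> n x\<bar> powr p) \<partial>lebesgue_on \<Omega>) \<le> ennreal ((1 / 2) ^ n)"
proof -
  have "\<exists>\<phi>\<in>Cc_infty \<Omega>. energy (\<lambda>x. u x - \<phi> x) \<le> ennreal ((1 / 2) ^ n) \<and>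
     (\<integral>\<^sup>+x. ennreal (\<bar>u x - \<phi> x\<bar> powr p) \<partial>lebesgue_on \<Omega>) \<le> ennreal ((1 / 2) ^ n)" for n
  proof -
    define \<epsilon> where "\<epsilon> = ((1 / 2) ^ n) powr (1 / p)"
    have \<epsilon>: "0 < \<epsilon>" "\<epsilon> powr p = (1 / 2) ^ n" using p by (simp_all add: \<epsilon>_def powr_powr)
    obtain \<phi> where \<phi>: "\<phi> \<in> Cc_infty \<Omega>"
      "Lp_norm p \<Omega> (\<lambda>x. u x - \<phi> x) + gagliardo mul ginv \<rho> Q s p (\<lambda>x. u x - \<phi> x) < ennreal \<epsilon>"
      using u \<epsilon>(1) unfolding X0_def by blast
    have "Lp_norm p \<Omega> (\<lambda>x. u x - \<phi> x) < ennreal \<epsilon>"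
      by (rule le_less_trans[OF _ \<phi>(2)]) simp
    then have 1: "(\<integral>\<^sup>+x. ennreal (\<bar>u x - \<phi> x\<bar> powr p) \<partial>lebesgue_on \<Omega>) < ennreal (\<epsilon> powr p)"
      unfolding Lp_norm_def using \<epsilon>(1) by (rule ennreal_root_less)
    have "ennreal_root p (energy (\<lambda>x. u x - \<phi> x)) < ennreal \<epsilon>"
      unfolding gagliardo_eq[symmetric] by (rule le_less_trans[OF _ \<phi>(2)]) simp
    then have 2: "energy (\<lambda>x. u x - \<phi> x) < ennreal (\<epsilon> powr p)"
      using \<epsilon>(1) by (rule ennreal_root_less)
    show ?thesis using \<phi>(1) 1 2 unfolding \<epsilon>(2) by (intro bexI[of _ \<phi>]) auto
  qed
  then show ?thesis by (intro choice) blast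
qed

lemma X0_measurable: "u \<in> X0 mul ginv \<rho> Q s p \<Omega> \<Longrightarrow> u \<in> borel_measurable lebesgue"
  by (simp add: X0_def)

lemma X0_energy_finite:
  assumes u: "u \<in> X0 mul ginv \<rho> Q s p \<Omega>"
  shows "energy u < \<infinity>"
proof -
  obtain \<phi> where \<phi>_approx: "\<forall>n. \<phi> n \<in> Cc_infty \<Omega> \<and> energy (\<lambda>x. u x - \<phi> n x) \<le> ennreal ((1 / 2) ^ n) \<and>
      (\<integral>\<^sup>+x. ennreal (\<bar>u x - \<phi> n x\<bar> powr p) \<partial>lebesgue_on \<Omega>) \<le> ennreal ((1 / 2) ^ n)"
    using X0_approx[OF u] by blast
  then have \<phi>: "\<And>n. \<phi> n \<in> Cc_infty \<Omega>" "\<And>n. energy (\<lambda>x. u x - \<phi> n x) \<le> ennreal ((1 / 2) ^ n)"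
      "\<And>n. (\<integral>\<^sup>+x. ennreal (\<bar>u x - \<phi> n x\<bar> powr p) \<partial>lebesgue_on \<Omega>) \<le> ennreal ((1 / 2) ^ n)"
    by simp_all
  have [measurable]: "u \<in> borel_measurable lebesgue" "\<phi> 0 \<in> borel_measurable lebesgue"
    using X0_measurable[OF u] Cc_infty_measurable \<phi>(1) by blast+
  have "energy u = energy (\<lambda>x. (u x - \<phi> 0 x) + \<phi> 0 x)" by simp
  also have "\<dots> \<le> ennreal (2 powr p) * (energy (\<lambda>x. u x - \<phi> 0 x) + energy (\<phi> 0))"
    by (rule energy_add_le) measurable
  also have "\<dots> < \<infinity>"
    using \<phi>(2)[of 0] energy_test_function_finite[OF \<phi>(1)[of 0]]
    by (auto simp: ennreal_mult_less_top intro: le_less_trans)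
  finally show ?thesis .
qed

lemma X0_moment_finite:
  assumes u: "u \<in> X0 mul ginv \<rho> Q s p \<Omega>" and \<Omega>: "open \<Omega>" "bounded \<Omega>"
  shows "integrable (lebesgue_on \<Omega>) (\<lambda>x. \<bar>u x\<bar> powr p)"
proof -
  obtain \<phi> where \<phi>_approx: "\<forall>n. \<phi> n \<in> Cc_infty \<Omega> \<and> energy (\<lambda>x. u x - \<phi> n x) \<le> ennreal ((1 / 2) ^ n) \<and>
      (\<integral>\<^sup>+x. ennreal (\<bar>u x - \<phi> n x\<bar> powr p) \<partial>lebesgue_on \<Omega>) \<le> ennreal ((1 / 2) ^ n)"
    using X0_approx[OF u] by blast
  then have \<phi>: "\<And>n. \<phi> n \<in> Cc_infty \<Omega>" "\<And>n. energy (\<lambda>x. u x - \<phi> n x) \<le> ennreal ((1 / 2) ^ n)"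
      "\<And>n. (\<integral>\<^sup>+x. ennreal (\<bar>u x - \<phi> n x\<bar> powr p) \<partial>lebesgue_on \<Omega>) \<le> ennreal ((1 / 2) ^ n)"
    by simp_all
  have [measurable]: "u \<in> borel_measurable (lebesgue_on \<Omega>)" "\<phi> 0 \<in> borel_measurable (lebesgue_on \<Omega>)"
    by (intro measurable_restrict_space1 X0_measurable[OF u] Cc_infty_measurable[OF \<phi>(1)])+
  obtain M where M: "0 < M" and M': "\<And>x. \<bar>\<phi> 0 x\<bar> \<le> M" using Cc_infty_bounded[OF \<phi>(1)] by blast
  have "(\<integral>\<^sup>+x. ennreal (\<bar>u x\<bar> powr p) \<partial>lebesgue_on \<Omega>)
    \<le> (\<integral>\<^sup>+x. ennreal (2 powr p) * (ennreal (\<bar>u x - \<phi> 0 x\<bar> powr p) + ennreal (M powr p)) \<partial>lebesgue_on \<Omega>)"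
  proof (rule nn_integral_mono)
    fix x
    have "\<bar>u x\<bar> powr p \<le> 2 powr p * (\<bar>u x - \<phi> 0 x\<bar> powr p + \<bar>\<phi> 0 x\<bar> powr p)"
      using powr_add_le[of p "u x - \<phi> 0 x" "\<phi> 0 x"] p by simp
    also have "\<dots> \<le> 2 powr p * (\<bar>u x - \<phi> 0 x\<bar> powr p + M powr p)"
      using M'[of x] p by (intro mult_left_mono add_left_mono powr_mono2) auto
    finally have "ennreal (\<bar>u x\<bar> powr p) \<le> ennreal (2 powr p * (\<bar>u x - \<phi> 0 x\<bar> powr p + M powr p))" by (rule ennreal_leI)
    then show "ennreal (\<bar>u x\<bar> powr p) \<le> ennreal (2 powr p) * (ennreal (\<bar>u x - \<phi> 0 x\<bar> powr p) + ennreal (M powr p))"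
      by (simp add: ennreal_mult)
  qed
  also have "\<dots> = ennreal (2 powr p) * ((\<integral>\<^sup>+x. ennreal (\<bar>u x - \<phi> 0 x\<bar> powr p) \<partial>lebesgue_on \<Omega>) + ennreal (M powr p) * emeasure (lebesgue_on \<Omega>) (space (lebesgue_on \<Omega>)))"
    by (simp add: nn_integral_cmult nn_integral_add)
  also have "\<dots> < \<infinity>"
  proof -
    have "emeasure (lebesgue_on \<Omega>) (space (lebesgue_on \<Omega>)) < \<infinity>"
      using emeasure_bounded_finite[OF \<Omega>(2)] \<Omega>(1) by (simp add: emeasure_restrict_space)
    then show ?thesis using \<phi>(3)[of 0] by (auto simp: ennreal_mult_less_top intro: le_less_trans)
  qed
  finally show ?thesis by (intro integrableI_nonneg) auto
qed

text \<open>The sum over n of the p-th powers of the errors has finite integral, hence is finite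
  almost everywhere on \<Omega>, and its terms tend to 0. Outside \<Omega> each \<phi>_n is 0, and
  so is u almost everywhere.\<close>

lemma X0_approx_AE:
  assumes u: "u \<in> X0 mul ginv \<rho> Q s p \<Omega>" and \<Omega>: "open \<Omega>"
    and \<phi>: "\<And>n. \<phi> n \<in> Cc_infty \<Omega>"
      "\<And>n. (\<integral>\<^sup>+x. ennreal (\<bar>u x - \<phi> n x\<bar> powr p) \<partial>lebesgue_on \<Omega>) \<le> ennreal ((1 / 2) ^ n)"
  shows "AE x in lebesgue. (\<lambda>n. \<phi> n x) \<longlonglongrightarrow> u x"
proof -
  have [measurable]: "u \<in> borel_measurable (lebesgue_on \<Omega>)" "\<And>n. \<phi> n \<in> borel_measurable (lebesgue_on \<Omega>)"
    by (intro measurable_restrict_space1 X0_measurable[OF u] Cc_infty_measurable[OF \<phi>(1)])+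
  have "(\<integral>\<^sup>+x. (\<Sum>n. ennreal (\<bar>u x - \<phi> n x\<bar> powr p)) \<partial>lebesgue_on \<Omega>) = (\<Sum>n. \<integral>\<^sup>+x. ennreal (\<bar>u x - \<phi> n x\<bar> powr p) \<partial>lebesgue_on \<Omega>)"
    by (rule nn_integral_suminf) measurable
  also have "\<dots> \<le> (\<Sum>n. ennreal ((1 / 2) ^ n))" by (intro suminf_le \<phi>(2)) auto
  also have "\<dots> < \<infinity>"
    unfolding infinity_ennreal_def top.not_eq_extremum[symmetric]
    by (rule ennreal_suminf_neq_top) (auto intro: summable_geometric)
  finally have "AE x in lebesgue_on \<Omega>. (\<Sum>n. ennreal (\<bar>u x - \<phi> n x\<bar> powr p)) \<noteq> \<infinity>"
    by (intro nn_integral_PInf_AE) (auto simp: less_top top_unique)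
  then have "AE x in lebesgue. x \<in> \<Omega> \<longrightarrow> (\<Sum>n. ennreal (\<bar>u x - \<phi> n x\<bar> powr p)) \<noteq> \<infinity>"
    using \<Omega> by (subst (asm) AE_restrict_space_iff) auto
  moreover have "AE x in lebesgue. x \<notin> \<Omega> \<longrightarrow> u x = 0" using u by (simp add: X0_def)
  ultimately show ?thesis
  proof eventually_elim
    case (elim x)
    show ?case
    proof (cases "x \<in> \<Omega>")
      case True
      then have "(\<Sum>n. ennreal (\<bar>u x - \<phi> n x\<bar> powr p)) \<noteq> top"
        using elim(1) unfolding infinity_ennreal_def by blast
      then have "summable (\<lambda>n. \<bar>u x - \<phi> n x\<bar> powr p)"
        by (rule summable_suminf_not_top[rotated]) simp
      then have "(\<lambda>n. \<bar>u x - \<phi> n x\<bar> powr p) \<longlonglongrightarrow> 0" by (rule summable_LIMSEQ_zero)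
      from tendsto_zero_powrI[OF this tendsto_const, of "1 / p"]
      have "(\<lambda>n. \<bar>u x - \<phi> n x\<bar>) \<longlonglongrightarrow> 0" using p by (simp add: powr_powr)
      then have "(\<lambda>n. u x - (u x - \<phi> n x)) \<longlonglongrightarrow> u x - 0"
        by (intro tendsto_diff tendsto_const) (simp add: tendsto_rabs_zero_iff)
      then show ?thesis by simp
    next
      case False
      then have "\<phi> n x = 0" for n using \<phi>(1)[of n] Cc_infty_outside[of x "\<phi> n"] by (auto simp: Cc_infty_def)
      then show ?thesis using elim False by simp
    qed
  qed
qed

section \<open>Testing with truncations, for an abstract nonnegative right-hand side h\<close>

context
  fixes u h :: "real^'n \<Rightarrow> real" and \<Omega> :: "(real^'n) set"
  assumes uX0: "u \<in> X0 mul ginv \<rho> Q s p \<Omega>" and \<Omega>: "open \<Omega>"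
    and h_meas: "h \<in> borel_measurable (lebesgue_on \<Omega>)"
    and h_nonneg: "AE x in lebesgue_on \<Omega>. 0 \<le> h x"
    and h_int: "\<And>\<phi>. \<phi> \<in> Cc_infty \<Omega> \<Longrightarrow> integrable (lebesgue_on \<Omega>) (\<lambda>x. h x * \<phi> x)"
    and weak_eq: "\<And>\<phi>. \<phi> \<in> Cc_infty \<Omega> \<Longrightarrow>
      frac_p_sublaplacian mul ginv \<rho> Q s p u \<phi> = (\<integral>x. h x * \<phi> x \<partial>lebesgue_on \<Omega>)"
begin

text \<open>The function \<open>smooth_abs n\<close> of \<phi> is again a test function, with energy
  at most that of \<phi>. The equation turns its integral against h into a value of the weak form,
  which the scaled Young inequality bounds; dominated convergence with majorant |h \<phi>| then
  replaces it by |\<phi>|.\<close>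

lemma weak_abs_bound:
  assumes \<phi>: "\<phi> \<in> Cc_infty \<Omega>" and \<epsilon>: "0 < \<epsilon>"
  shows "(\<integral>\<^sup>+x. ennreal (h x * \<bar>\<phi> x\<bar>) \<partial>lebesgue_on \<Omega>)
    \<le> ennreal (\<epsilon> * enn2real (energy u) + \<epsilon> powr (1 - p) * enn2real (energy \<phi>))"
proof -
  note h_meas[measurable]
  have [measurable]: "\<phi> \<in> borel_measurable (lebesgue_on \<Omega>)"
    by (intro measurable_restrict_space1 Cc_infty_measurable[OF \<phi>])
  let ?B = "\<epsilon> * enn2real (energy u) + \<epsilon> powr (1 - p) * enn2real (energy \<phi>)"
  have int: "integrable (lebesgue_on \<Omega>) (\<lambda>x. h x * \<phi> x)" by (rule h_int[OF \<phi>])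
  have sm[measurable]: "smooth_abs n \<in> borel_measurable borel" for n
    by (intro borel_measurable_continuous_onI continuous_at_imp_continuous_on ballI DERIV_isCont[OF smooth_abs_deriv])
  have lim: "(\<lambda>n. \<integral>x. h x * smooth_abs n (\<phi> x) \<partial>lebesgue_on \<Omega>) \<longlonglongrightarrow> (\<integral>x. h x * \<bar>\<phi> x\<bar> \<partial>lebesgue_on \<Omega>)"
  proof (rule integral_dominated_convergence)
    show "integrable (lebesgue_on \<Omega>) (\<lambda>x. \<bar>h x * \<phi> x\<bar>)" using int by simp
    show "AE x in lebesgue_on \<Omega>. (\<lambda>n. h x * smooth_abs n (\<phi> x)) \<longlonglongrightarrow> h x * \<bar>\<phi> x\<bar>"
    proof (intro AE_I2 tendsto_mult tendsto_const)
      fix x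
      have "(\<lambda>n. ln 2 / real (Suc n)) \<longlonglongrightarrow> 0" by (rule LIMSEQ_Suc[OF lim_const_over_n])
      then have "(\<lambda>n. smooth_abs n (\<phi> x) - \<bar>\<phi> x\<bar>) \<longlonglongrightarrow> 0"
        by (rule Lim_null_comparison[rotated])
            (intro always_eventually allI, simp only: real_norm_def smooth_abs_approx)
      then show "(\<lambda>n. smooth_abs n (\<phi> x)) \<longlonglongrightarrow> \<bar>\<phi> x\<bar>" by (simp add: LIM_zero_iff)
    qed
    show "AE x in lebesgue_on \<Omega>. norm (h x * smooth_abs n (\<phi> x)) \<le> \<bar>h x * \<phi> x\<bar>" for n
    proof (rule AE_I2)
      fix x show "norm (h x * smooth_abs n (\<phi> x)) \<le> \<bar>h x * \<phi> x\<bar>"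
        using smooth_abs_lipschitz[of n "\<phi> x" 0] by (simp add: abs_mult mult_left_mono)
    qed
  qed measurable
  have bound: "(\<integral>x. h x * smooth_abs n (\<phi> x) \<partial>lebesgue_on \<Omega>) \<le> ?B" for n
  proof -
    have mem: "(\<lambda>x. smooth_abs n (\<phi> x)) \<in> Cc_infty \<Omega>" by (rule Cc_infty_smooth_abs[OF \<phi>])
    have le: "energy (\<lambda>x. smooth_abs n (\<phi> x)) \<le> energy \<phi>"
      by (rule energy_lipschitz_le) (rule smooth_abs_lipschitz)
    have fin: "energy \<phi> < \<infinity>" by (rule energy_test_function_finite[OF \<phi>])
    have "(\<integral>x. h x * smooth_abs n (\<phi> x) \<partial>lebesgue_on \<Omega>) = frac_p_sublaplacian mul ginv \<rho> Q s p u (\<lambda>x. smooth_abs n (\<phi> x))"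
      by (rule weak_eq[OF mem, symmetric])
    also have "\<dots> \<le> \<epsilon> * enn2real (energy u) + \<epsilon> powr (1 - p) * enn2real (energy (\<lambda>x. smooth_abs n (\<phi> x)))"
      using frac_p_sublaplacian_bound[OF X0_measurable[OF uX0] Cc_infty_measurable[OF mem] X0_energy_finite[OF uX0] _ \<epsilon>]
        le fin by (meson abs_le_D1 le_less_trans)
    also have "\<dots> \<le> ?B"
      using le fin by (intro add_left_mono mult_left_mono enn2real_mono) auto
    finally show ?thesis .
  qed
  have "(\<integral>x. h x * \<bar>\<phi> x\<bar> \<partial>lebesgue_on \<Omega>) \<le> ?B"
    by (rule LIMSEQ_le_const2[OF lim]) (use bound in auto)
  moreover have "(\<integral>\<^sup>+x. ennreal (h x * \<bar>\<phi> x\<bar>) \<partial>lebesgue_on \<Omega>) = ennreal (\<integral>x. h x * \<bar>\<phi> x\<bar> \<partial>lebesgue_on \<Omega>)"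
  proof (rule nn_integral_eq_integral)
    show "integrable (lebesgue_on \<Omega>) (\<lambda>x. h x * \<bar>\<phi> x\<bar>)"
      by (rule Bochner_Integration.integrable_bound[OF int]) (auto simp: abs_mult)
    show "AE x in lebesgue_on \<Omega>. 0 \<le> h x * \<bar>\<phi> x\<bar>" using h_nonneg by eventually_elim simp
  qed
  ultimately show ?thesis by (simp add: ennreal_leI)
qed

text \<open>The preceding bound is applied to \<phi>_n - \<phi>_m with m \<ge> n, whose energy is
  controlled through u by the approximation rate, and m tends to infinity by Fatou. In particular h
  |\<phi>_n - u| is integrable, even where h itself may fail to be so.\<close>

lemma weak_approx_error:
  assumes \<phi>: "\<And>n. \<phi> n \<in> Cc_infty \<Omega>" "\<And>n. energy (\<lambda>x. u x - \<phi> n x) \<le> ennreal ((1 / 2) ^ n)"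
    and conv: "AE x in lebesgue_on \<Omega>. (\<lambda>n. \<phi> n x) \<longlonglongrightarrow> u x" and \<epsilon>: "0 < \<epsilon>"
  shows "(\<integral>\<^sup>+x. ennreal (h x * \<bar>\<phi> n x - u x\<bar>) \<partial>lebesgue_on \<Omega>)
    \<le> ennreal (\<epsilon> * enn2real (energy u) + \<epsilon> powr (1 - p) * (2 powr p * 2 * (1 / 2) ^ n))"
proof -
  let ?B = "\<epsilon> * enn2real (energy u) + \<epsilon> powr (1 - p) * (2 powr p * 2 * (1 / 2) ^ n)"
  note h_meas[measurable]
  have um: "u \<in> borel_measurable lebesgue" by (rule X0_measurable[OF uX0])
  have \<phi>m: "\<phi> m \<in> borel_measurable lebesgue" for m by (rule Cc_infty_measurable[OF \<phi>(1)])
  have [measurable]: "u \<in> borel_measurable (lebesgue_on \<Omega>)" "\<And>m. \<phi> m \<in> borel_measurable (lebesgue_on \<Omega>)"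
    by (intro measurable_restrict_space1 um \<phi>m)+
  have bound: "(\<integral>\<^sup>+x. ennreal (h x * \<bar>\<phi> n x - \<phi> m x\<bar>) \<partial>lebesgue_on \<Omega>) \<le> ennreal ?B" if m: "n \<le> m" for m
  proof -
    have "energy (\<lambda>x. \<phi> n x - \<phi> m x) = energy (\<lambda>x. (u x - \<phi> m x) + - (u x - \<phi> n x))" by simp
    also have "\<dots> \<le> ennreal (2 powr p) * (energy (\<lambda>x. u x - \<phi> m x) + energy (\<lambda>x. - (u x - \<phi> n x)))"
      using um \<phi>m by (intro energy_add_le) auto
    also have "\<dots> = ennreal (2 powr p) * (energy (\<lambda>x. u x - \<phi> m x) + energy (\<lambda>x. u x - \<phi> n x))"
      by (subst energy_minus) (rule refl)
    also have "\<dots> \<le> ennreal (2 powr p) * (ennreal ((1 / 2) ^ n) + ennreal ((1 / 2) ^ n))"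
      using power_decreasing[OF m, of "1 / 2 :: real"]
      by (intro mult_left_mono add_mono \<phi>(2) order_trans[OF \<phi>(2)] ennreal_leI) auto
    also have "\<dots> = ennreal (2 powr p * 2 * (1 / 2) ^ n)"
      by (simp add: ennreal_plus[symmetric] ennreal_mult[symmetric] del: ennreal_plus)
    finally have "energy (\<lambda>x. \<phi> n x - \<phi> m x) \<le> ennreal (2 powr p * 2 * (1 / 2) ^ n)" .
    then have "enn2real (energy (\<lambda>x. \<phi> n x - \<phi> m x)) \<le> 2 powr p * 2 * (1 / 2) ^ n"
      by (intro enn2real_leI) auto
    then have "ennreal (\<epsilon> * enn2real (energy u) + \<epsilon> powr (1 - p) * enn2real (energy (\<lambda>x. \<phi> n x - \<phi> m x))) \<le> ennreal ?B"
      by (intro ennreal_leI add_left_mono mult_left_mono) auto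
    then show ?thesis
      using weak_abs_bound[OF Cc_infty_diff[OF \<phi>(1)[of n] \<phi>(1)[of m]] \<epsilon>] by (rule order_trans[rotated])
  qed
  have "(\<integral>\<^sup>+x. ennreal (h x * \<bar>\<phi> n x - u x\<bar>) \<partial>lebesgue_on \<Omega>)
      = (\<integral>\<^sup>+x. liminf (\<lambda>m. ennreal (h x * \<bar>\<phi> n x - \<phi> m x\<bar>)) \<partial>lebesgue_on \<Omega>)"
  proof (rule nn_integral_cong_AE)
    show "AE x in lebesgue_on \<Omega>. ennreal (h x * \<bar>\<phi> n x - u x\<bar>) = liminf (\<lambda>m. ennreal (h x * \<bar>\<phi> n x - \<phi> m x\<bar>))"
      using conv
    proof eventually_elim
      case (elim x)
      have "(\<lambda>m. ennreal (h x * \<bar>\<phi> n x - \<phi> m x\<bar>)) \<longlonglongrightarrow> ennreal (h x * \<bar>\<phi> n x - u x\<bar>)"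
        by (intro tendsto_intros elim)
      then show ?case by (intro lim_imp_Liminf[symmetric]) auto
    qed
  qed
  also have "\<dots> \<le> liminf (\<lambda>m. \<integral>\<^sup>+x. ennreal (h x * \<bar>\<phi> n x - \<phi> m x\<bar>) \<partial>lebesgue_on \<Omega>)"
    by (rule nn_integral_liminf) measurable
  also have "\<dots> \<le> limsup (\<lambda>m. \<integral>\<^sup>+x. ennreal (h x * \<bar>\<phi> n x - \<phi> m x\<bar>) \<partial>lebesgue_on \<Omega>)"
    by (rule Liminf_le_Limsup) simp
  also have "\<dots> \<le> ennreal ?B"
    by (rule Limsup_bounded) (use bound in \<open>auto simp: eventually_sequentially\<close>)
  finally show ?thesis .
qed

lemma weak_approx_error_tendsto:
  assumes \<phi>: "\<And>n. \<phi> n \<in> Cc_infty \<Omega>" "\<And>n. energy (\<lambda>x. u x - \<phi> n x) \<le> ennreal ((1 / 2) ^ n)"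
    and conv: "AE x in lebesgue_on \<Omega>. (\<lambda>n. \<phi> n x) \<longlonglongrightarrow> u x"
  shows "(\<lambda>n. \<integral>\<^sup>+x. ennreal (h x * \<bar>\<phi> n x - u x\<bar>) \<partial>lebesgue_on \<Omega>) \<longlonglongrightarrow> 0"
proof -
  let ?D = "\<lambda>n. \<integral>\<^sup>+x. ennreal (h x * \<bar>\<phi> n x - u x\<bar>) \<partial>lebesgue_on \<Omega>"
  have "\<forall>\<^sub>F n in sequentially. ?D n < e" if e: "0 < e" for e :: ennreal
  proof -
    obtain r :: real where r: "0 < r" "ennreal r < e"
      using e ennreal_Ex_less_of_nat dense[of 0 e] by (metis ennreal_cases less_ennreal.rep_eq ennreal_less_zero_iff top.not_eq_extremum not_less_iff_gr_or_eq)
    \<comment> \<open>\<epsilon> is fixed first, so that the term with E(u) stays below r / 2; only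
      then is n taken large. The added 1 covers the case E(u) = 0.\<close>
    define \<epsilon> where "\<epsilon> = r / 2 / (enn2real (energy u) + 1)"
    have E: "0 \<le> enn2real (energy u)" by simp
    then have \<epsilon>: "0 < \<epsilon>" using r by (simp add: \<epsilon>_def add_nonneg_pos)
    have "\<epsilon> * enn2real (energy u) \<le> \<epsilon> * (enn2real (energy u) + 1)" using \<epsilon> by simp
    also have "\<dots> = r / 2"
    proof -
      have "enn2real (energy u) + 1 \<noteq> 0" using E by linarith
      from iffD1[OF nonzero_eq_divide_eq[OF this] \<epsilon>_def] show ?thesis .
    qed
    finally have 1: "\<epsilon> * enn2real (energy u) \<le> r / 2" .
    have "(\<lambda>n. \<epsilon> powr (1 - p) * (2 powr p * 2 * (1 / 2) ^ n)) \<longlonglongrightarrow> \<epsilon> powr (1 - p) * (2 powr p * 2 * 0)"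
      by (intro tendsto_mult tendsto_const LIMSEQ_power_zero) simp
    then have "\<forall>\<^sub>F n in sequentially. \<epsilon> powr (1 - p) * (2 powr p * 2 * (1 / 2) ^ n) < r / 2"
      using r by (intro order_tendstoD(2)) auto
    then show ?thesis
    proof eventually_elim
      case (elim n)
      have "?D n \<le> ennreal (\<epsilon> * enn2real (energy u) + \<epsilon> powr (1 - p) * (2 powr p * 2 * (1 / 2) ^ n))"
        by (rule weak_approx_error[OF \<phi> conv \<epsilon>])
      also have "\<dots> \<le> ennreal r" using elim 1 by (intro ennreal_leI) linarith
      also note r(2)
      finally show ?case .
    qed
  qed
  then show ?thesis by (intro order_tendstoI) auto
qed

text \<open>The equation is tested with smooth truncations \<psi>_n of \<phi>_n. The right-hand
  sides converge. On the left the integrands converge almost everywhere to the flux times the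
  increment of (u - a)_+, which dominates the energy integrand by \<open>trunc_monotone\<close>;
  Fatou gives the inequality in the needed direction.\<close>

theorem truncation_energy_le:
  assumes a: "0 \<le> a"
  shows "integrable (lebesgue_on \<Omega>) (\<lambda>x. h x * max 0 (u x - a))"
    and "energy (\<lambda>x. max 0 (u x - a)) \<le> ennreal (\<integral>x. h x * max 0 (u x - a) \<partial>lebesgue_on \<Omega>)"
proof -
  note h_meas[measurable]
  let ?\<mu> = "lebesgue_on \<Omega>" and ?w = "\<lambda>x. max 0 (u x - a)"
  obtain \<phi> where \<phi>_approx: "\<forall>n. \<phi> n \<in> Cc_infty \<Omega> \<and> energy (\<lambda>x. u x - \<phi> n x) \<le> ennreal ((1 / 2) ^ n) \<and>
      (\<integral>\<^sup>+x. ennreal (\<bar>u x - \<phi> n x\<bar> powr p) \<partial>lebesgue_on \<Omega>) \<le> ennreal ((1 / 2) ^ n)"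
    using X0_approx[OF uX0] by blast
  then have \<phi>: "\<And>n. \<phi> n \<in> Cc_infty \<Omega>" "\<And>n. energy (\<lambda>x. u x - \<phi> n x) \<le> ennreal ((1 / 2) ^ n)"
      "\<And>n. (\<integral>\<^sup>+x. ennreal (\<bar>u x - \<phi> n x\<bar> powr p) \<partial>lebesgue_on \<Omega>) \<le> ennreal ((1 / 2) ^ n)"
    by simp_all
  have um[measurable]: "u \<in> borel_measurable lebesgue" by (rule X0_measurable[OF uX0])
  have \<phi>m[measurable]: "\<phi> m \<in> borel_measurable lebesgue" for m by (rule Cc_infty_measurable[OF \<phi>(1)])
  have [measurable]: "u \<in> borel_measurable ?\<mu>" "\<And>m. \<phi> m \<in> borel_measurable ?\<mu>"
    by (intro measurable_restrict_space1 um \<phi>m)+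
  have conv: "AE x in lebesgue. (\<lambda>n. \<phi> n x) \<longlonglongrightarrow> u x" by (rule X0_approx_AE[OF uX0 \<Omega> \<phi>(1,3)])
  then have conv': "AE x in ?\<mu>. (\<lambda>n. \<phi> n x) \<longlonglongrightarrow> u x"
    using \<Omega> by (subst AE_restrict_space_iff) auto
  have eu: "energy u < \<infinity>" by (rule X0_energy_finite[OF uX0])
  let ?D = "\<lambda>n. \<integral>\<^sup>+x. ennreal (h x * \<bar>\<phi> n x - u x\<bar>) \<partial>?\<mu>"
  have D: "?D \<longlonglongrightarrow> 0" by (rule weak_approx_error_tendsto[OF \<phi>(1,2) conv'])

  have hdiff: "integrable ?\<mu> (\<lambda>x. h x * \<bar>\<phi> n x - u x\<bar>)" for n
  proof (rule integrableI_nonneg)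
    show "?D n < \<infinity>"
      using weak_approx_error[OF \<phi>(1,2) conv', of 1 n] by (auto simp: less_top[symmetric] top_unique)
    show "AE x in ?\<mu>. 0 \<le> h x * \<bar>\<phi> n x - u x\<bar>" using h_nonneg by eventually_elim simp
  qed measurable
  have hu: "integrable ?\<mu> (\<lambda>x. h x * u x)"
  proof (rule Bochner_Integration.integrable_bound)
    show "integrable ?\<mu> (\<lambda>x. h x * \<bar>\<phi> 0 x - u x\<bar> + \<bar>h x * \<phi> 0 x\<bar>)" using hdiff[of 0] h_int[OF \<phi>(1)[of 0]] by simp
    show "AE x in ?\<mu>. norm (h x * u x) \<le> norm (h x * \<bar>\<phi> 0 x - u x\<bar> + \<bar>h x * \<phi> 0 x\<bar>)"
      using h_nonneg
    proof eventually_elim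
      case (elim x)
      have "h x * \<bar>u x\<bar> \<le> h x * (\<bar>\<phi> 0 x - u x\<bar> + \<bar>\<phi> 0 x\<bar>)" using elim by (intro mult_left_mono) auto
      then show ?case using elim by (simp add: abs_mult algebra_simps)
    qed
  qed measurable
  have wle: "\<bar>?w x\<bar> \<le> \<bar>u x\<bar>" for x using a by (auto simp: max_def)
  show hw: "integrable ?\<mu> (\<lambda>x. h x * ?w x)"
    by (rule Bochner_Integration.integrable_bound[OF hu]) (auto simp: abs_mult intro!: mult_left_mono wle[simplified])

  define \<psi> where "\<psi> n x = smooth_trunc n a (\<phi> n x)" for n x
  have \<psi>: "\<psi> n \<in> Cc_infty \<Omega>" for n unfolding \<psi>_def[abs_def] by (rule Cc_infty_smooth_trunc[OF \<phi>(1)])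
  have \<psi>m[measurable]: "\<psi> m \<in> borel_measurable lebesgue" for m by (rule Cc_infty_measurable[OF \<psi>])
  have l2: "(\<lambda>n. ln 2 / real (Suc n)) \<longlonglongrightarrow> 0" by (rule LIMSEQ_Suc[OF lim_const_over_n])
  have trunc_lim: "(\<lambda>n. smooth_trunc n a t) \<longlonglongrightarrow> max 0 (t - a)" for t
  proof -
    have "(\<lambda>n. smooth_trunc n a t - max 0 (t - a)) \<longlonglongrightarrow> 0"
      by (rule Lim_null_comparison[OF _ l2])
        (intro always_eventually allI, simp only: real_norm_def smooth_trunc_approx[OF a])
    then show ?thesis by (simp add: LIM_zero_iff)
  qed
  have \<psi>_lim: "(\<lambda>n. \<psi> n x) \<longlonglongrightarrow> ?w x" if "(\<lambda>n. \<phi> n x) \<longlonglongrightarrow> u x" for x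
  proof -
    have "(\<lambda>n. \<phi> n x - u x) \<longlonglongrightarrow> 0" using that by (simp add: LIM_zero_iff)
    then have "(\<lambda>n. \<psi> n x - smooth_trunc n a (u x)) \<longlonglongrightarrow> 0"
      by (rule Lim_null_comparison[rotated, OF tendsto_rabs_zero])
        (intro always_eventually allI, simp add: \<psi>_def smooth_trunc_lipschitz)
    from tendsto_add[OF this trunc_lim[of "u x"]] show ?thesis by simp
  qed

  \<comment> \<open>Two replacements: \<phi>_n by u inside the smooth truncation, with error at most
    h |\<phi>_n - u| by the Lipschitz property, and then the smooth truncation by the exact one,
    dominated by |h u|.\<close>
  have rhs: "(\<lambda>n. \<integral>x. h x * \<psi> n x \<partial>?\<mu>) \<longlonglongrightarrow> (\<integral>x. h x * ?w x \<partial>?\<mu>)"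
  proof -
    have st[measurable]: "smooth_trunc n a \<in> borel_measurable borel" for n
    proof (rule borel_measurable_continuous_onI)
      have "continuous_on UNIV (smooth_abs n)"
        by (intro continuous_at_imp_continuous_on ballI DERIV_isCont[OF smooth_abs_deriv])
      then have "continuous_on UNIV (\<lambda>t. smooth_abs n (t - a))"
        by (rule continuous_on_compose2) (auto intro!: continuous_intros)
      then have "continuous_on UNIV (\<lambda>t. (t + smooth_abs n (t - a) - smooth_abs n a) / 2)"
        by (intro continuous_on_divide continuous_on_diff continuous_on_add continuous_on_const continuous_on_id) auto
      then show "continuous_on UNIV (smooth_trunc n a)" by (simp add: smooth_trunc_def[abs_def])
    qed
    have hst: "integrable ?\<mu> (\<lambda>x. h x * smooth_trunc n a (u x))" for n
      by (rule Bochner_Integration.integrable_bound[OF hu])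
        (use smooth_trunc_lipschitz[of n a _ 0] in \<open>auto simp: abs_mult intro!: mult_left_mono\<close>)
    have 1: "(\<lambda>n. \<integral>x. h x * smooth_trunc n a (u x) \<partial>?\<mu>) \<longlonglongrightarrow> (\<integral>x. h x * ?w x \<partial>?\<mu>)"
    proof (rule integral_dominated_convergence[where w="\<lambda>x. \<bar>h x * u x\<bar>"])
      show "integrable ?\<mu> (\<lambda>x. \<bar>h x * u x\<bar>)" using hu by simp
      show "AE x in ?\<mu>. (\<lambda>n. h x * smooth_trunc n a (u x)) \<longlonglongrightarrow> h x * ?w x"
        by (intro AE_I2 tendsto_mult tendsto_const trunc_lim)
      show "AE x in ?\<mu>. norm (h x * smooth_trunc n a (u x)) \<le> \<bar>h x * u x\<bar>" for n
        using smooth_trunc_lipschitz[of n a _ 0] by (intro AE_I2) (simp add: abs_mult mult_left_mono)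
    qed measurable
    have Dr: "(\<lambda>n. \<integral>x. h x * \<bar>\<phi> n x - u x\<bar> \<partial>?\<mu>) \<longlonglongrightarrow> 0"
    proof -
      have nn: "AE x in ?\<mu>. 0 \<le> h x * \<bar>\<phi> n x - u x\<bar>" for n using h_nonneg by eventually_elim simp
      have "?D n = ennreal (\<integral>x. h x * \<bar>\<phi> n x - u x\<bar> \<partial>?\<mu>)" for n
        by (rule nn_integral_eq_integral[OF hdiff nn])
      then have "(\<lambda>n. ennreal (\<integral>x. h x * \<bar>\<phi> n x - u x\<bar> \<partial>?\<mu>)) \<longlonglongrightarrow> ennreal 0" using D by simp
      then show ?thesis using integral_nonneg_AE[OF nn] by (subst (asm) tendsto_ennreal_iff) auto
    qed
    have 2: "(\<lambda>n. (\<integral>x. h x * \<psi> n x \<partial>?\<mu>) - (\<integral>x. h x * smooth_trunc n a (u x) \<partial>?\<mu>)) \<longlonglongrightarrow> 0"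
    proof (rule Lim_null_comparison[OF _ Dr], intro always_eventually allI)
      fix n
      have "(\<integral>x. h x * \<psi> n x \<partial>?\<mu>) - (\<integral>x. h x * smooth_trunc n a (u x) \<partial>?\<mu>)
          = (\<integral>x. h x * \<psi> n x - h x * smooth_trunc n a (u x) \<partial>?\<mu>)"
        by (rule Bochner_Integration.integral_diff[OF h_int[OF \<psi>] hst, symmetric])
      also have "norm \<dots> \<le> (\<integral>x. h x * \<bar>\<phi> n x - u x\<bar> \<partial>?\<mu>)"
      proof (rule order_trans[OF integral_norm_bound integral_mono_AE])
        show "AE x in ?\<mu>. norm (h x * \<psi> n x - h x * smooth_trunc n a (u x)) \<le> h x * \<bar>\<phi> n x - u x\<bar>"
          using h_nonneg
        proof eventually_elim
          case (elim x)
          have "h x * \<bar>\<psi> n x - smooth_trunc n a (u x)\<bar> \<le> h x * \<bar>\<phi> n x - u x\<bar>"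
            unfolding \<psi>_def by (intro mult_left_mono smooth_trunc_lipschitz elim)
          then show ?case using elim by (simp add: abs_mult right_diff_distrib[symmetric])
        qed
      qed (use hdiff h_int[OF \<psi>] hst in auto)
      finally show "norm ((\<integral>x. h x * \<psi> n x \<partial>?\<mu>) - (\<integral>x. h x * smooth_trunc n a (u x) \<partial>?\<mu>)) \<le> (\<integral>x. h x * \<bar>\<phi> n x - u x\<bar> \<partial>?\<mu>)" .
    qed
    from tendsto_add[OF 2 1] show ?thesis by simp
  qed

  define A where "A z = \<bar>u (fst z) - u (snd z)\<bar> powr p * wt (fst z) (snd z)" for z
  define R where "R n z = \<bar>(u (fst z) - \<phi> n (fst z)) - (u (snd z) - \<phi> n (snd z))\<bar> powr p * wt (fst z) (snd z)" for n z
  \<comment> \<open>The flux term has no sign, so Fatou needs a correction. Splitting the increment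
    of \<phi>_n into that of u and the remainder bounds the flux term by 2 A + R_n in absolute
    value. The integral of R_n tends to 0, and that of 2 A is the constant 2 E(u), removed at the
    end.\<close>
  define F where "F n z = flux u z * (\<psi> n (fst z) - \<psi> n (snd z)) + 2 * A z + R n z" for n z
  have A: "integrable LL A" "(\<integral>z. A z \<partial>LL) = enn2real (energy u)"
    using energy_integrable[OF um eu] by (simp_all add: A_def[abs_def])
  have en: "energy (\<lambda>x. u x - \<phi> n x) < \<infinity>" for n using \<phi>(2)[of n] by (auto intro: le_less_trans)
  have R: "integrable LL (R n)" "(\<integral>z. R n z \<partial>LL) = enn2real (energy (\<lambda>x. u x - \<phi> n x))" for n
    using energy_integrable[OF _ en[of n]] by (simp_all add: R_def[abs_def])
  have fl: "integrable LL (\<lambda>z. flux u z * (\<psi> n (fst z) - \<psi> n (snd z)))" for n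
    by (rule flux_integrable[OF um \<psi>m eu energy_test_function_finite[OF \<psi>]])
  have F0: "0 \<le> F n z" for n z
  proof -
    let ?b = "\<psi> n (fst z) - \<psi> n (snd z)" and ?c = "\<phi> n (fst z) - \<phi> n (snd z)" and ?d = "u (fst z) - u (snd z)"
    have "\<bar>?b\<bar> \<le> \<bar>?c\<bar>" unfolding \<psi>_def by (rule smooth_trunc_lipschitz)
    also have "\<dots> \<le> \<bar>?d\<bar> + \<bar>?d - ?c\<bar>" by linarith
    finally have "\<bar>flux u z * ?b\<bar> \<le> \<bar>flux u z * ?d\<bar> + \<bar>flux u z * (?d - ?c)\<bar>"
      unfolding abs_mult using mult_left_mono[of "\<bar>?b\<bar>" "\<bar>?d\<bar> + \<bar>?d - ?c\<bar>" "\<bar>flux u z\<bar>"] by (simp add: distrib_left)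
    also have "\<bar>flux u z * ?d\<bar> = A z"
    proof -
      have "\<bar>?d\<bar> powr (p - 1) * \<bar>?d\<bar> = \<bar>?d\<bar> powr p" using p by (cases "?d = 0") (auto simp: powr_diff)
      moreover have "\<bar>flux u z * ?d\<bar> = \<bar>\<bar>?d\<bar> powr (p - 2) * ?d\<bar> * \<bar>?d\<bar> * wt (fst z) (snd z)"
        by (simp add: flux_def abs_mult)
      ultimately show ?thesis by (simp add: abs_signed_powr A_def)
    qed
    also have "\<bar>flux u z * (?d - ?c)\<bar> \<le> A z + R n z"
      using flux_bound[of 1 u z "?d - ?c"] by (simp add: A_def R_def algebra_simps)
    finally show ?thesis unfolding F_def by linarith
  qed
  have intF: "(\<integral>\<^sup>+z. ennreal (F n z) \<partial>LL) = ennreal ((\<integral>x. h x * \<psi> n x \<partial>?\<mu>) + 2 * enn2real (energy u) + enn2real (energy (\<lambda>x. u x - \<phi> n x)))" for n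
  proof -
    have "(\<integral>\<^sup>+z. ennreal (F n z) \<partial>LL) = ennreal (\<integral>z. F n z \<partial>LL)"
      using A R fl F0 unfolding F_def[abs_def] by (intro nn_integral_eq_integral) auto
    also have "(\<integral>z. F n z \<partial>LL) = frac_p_sublaplacian mul ginv \<rho> Q s p u (\<psi> n) + 2 * enn2real (energy u) + enn2real (energy (\<lambda>x. u x - \<phi> n x))"
      using A R fl unfolding F_def[abs_def] frac_p_sublaplacian_eq by simp
    finally show ?thesis using weak_eq[OF \<psi>] by simp
  qed
  have e0: "(\<lambda>n. enn2real (energy (\<lambda>x. u x - \<phi> n x))) \<longlonglongrightarrow> 0"
  proof (rule Lim_null_comparison)
    show "(\<lambda>n. (1 / 2 :: real) ^ n) \<longlonglongrightarrow> 0" by (rule LIMSEQ_power_zero) simp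
    show "\<forall>\<^sub>F n in sequentially. norm (enn2real (energy (\<lambda>x. u x - \<phi> n x))) \<le> (1 / 2) ^ n"
      using \<phi>(2) by (intro always_eventually allI) (simp add: enn2real_leI)
  qed
  have "(\<lambda>n. (\<integral>x. h x * \<psi> n x \<partial>?\<mu>) + 2 * enn2real (energy u) + enn2real (energy (\<lambda>x. u x - \<phi> n x)))
     \<longlonglongrightarrow> (\<integral>x. h x * ?w x \<partial>?\<mu>) + 2 * enn2real (energy u) + 0"
    by (intro tendsto_add tendsto_const rhs e0)
  then have limF: "(\<lambda>n. \<integral>\<^sup>+z. ennreal (F n z) \<partial>LL) \<longlonglongrightarrow> ennreal ((\<integral>x. h x * ?w x \<partial>?\<mu>) + 2 * enn2real (energy u))"
    unfolding intF by (intro tendsto_ennrealI) simp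
  have "energy ?w + 2 * energy u = (\<integral>\<^sup>+z. ennreal (\<bar>?w (fst z) - ?w (snd z)\<bar> powr p * wt (fst z) (snd z)) + 2 * ennreal (A z) \<partial>LL)"
    unfolding energy_def A_def by (subst nn_integral_add) (auto simp: nn_integral_cmult)
  also have "\<dots> \<le> (\<integral>\<^sup>+z. liminf (\<lambda>n. ennreal (F n z)) \<partial>LL)"
  proof (rule nn_integral_mono_AE)
    show "AE z in LL. ennreal (\<bar>?w (fst z) - ?w (snd z)\<bar> powr p * wt (fst z) (snd z)) + 2 * ennreal (A z) \<le> liminf (\<lambda>n. ennreal (F n z))"
      using AE_lebesgue_pair[OF conv]
    proof eventually_elim
      case (elim z)
      let ?G = "\<lambda>n. flux u z * (\<psi> n (fst z) - \<psi> n (snd z)) + 2 * A z"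
      have A0: "0 \<le> A z" by (simp add: A_def)
      have "\<bar>?w (fst z) - ?w (snd z)\<bar> powr p * wt (fst z) (snd z) \<le> flux u z * (?w (fst z) - ?w (snd z))"
        using mult_right_mono[OF trunc_monotone[of p "u (fst z)" a "u (snd z)"], of "wt (fst z) (snd z)"] p
        by (simp add: flux_def mult_ac)
      then have "ennreal (\<bar>?w (fst z) - ?w (snd z)\<bar> powr p * wt (fst z) (snd z) + 2 * A z) \<le> ennreal (flux u z * (?w (fst z) - ?w (snd z)) + 2 * A z)"
        by (intro ennreal_leI) simp
      also have "\<dots> = liminf (\<lambda>n. ennreal (?G n))"
        using elim by (intro lim_imp_Liminf[symmetric] tendsto_ennrealI tendsto_intros \<psi>_lim) auto
      also have "\<dots> \<le> liminf (\<lambda>n. ennreal (F n z))"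
        by (intro Liminf_mono always_eventually allI ennreal_leI) (simp add: F_def R_def)
      finally show ?case using A0 by (simp add: ennreal_mult)
    qed
  qed
  also have "\<dots> \<le> liminf (\<lambda>n. \<integral>\<^sup>+z. ennreal (F n z) \<partial>LL)"
    by (rule nn_integral_liminf) (use A R fl in \<open>auto simp: F_def[abs_def]\<close>)
  also have "\<dots> = ennreal ((\<integral>x. h x * ?w x \<partial>?\<mu>) + 2 * enn2real (energy u))"
    using limF by (intro lim_imp_Liminf) auto
  also have "\<dots> = ennreal (\<integral>x. h x * ?w x \<partial>?\<mu>) + 2 * energy u"
  proof -
    have "0 \<le> (\<integral>x. h x * ?w x \<partial>?\<mu>)"
      by (rule integral_nonneg_AE) (use h_nonneg in \<open>eventually_elim, simp\<close>)
    then show ?thesis using eu by (simp add: ennreal_mult)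
  qed
  finally have le: "energy ?w + 2 * energy u \<le> ennreal (\<integral>x. h x * ?w x \<partial>?\<mu>) + 2 * energy u" .
  \<comment> \<open>Cancelling the added constant is legitimate only because E(u) is finite.\<close>
  have "2 * energy u \<noteq> top" using eu by (auto simp: ennreal_mult_eq_top_iff)
  then show "energy ?w \<le> ennreal (\<integral>x. h x * ?w x \<partial>?\<mu>)"
    using le ennreal_add_left_cancel_le[of "2 * energy u"] by (simp add: add.commute)
qed

end

end

section \<open>De Giorgi iteration\<close>

context finite_measure begin

section \<open>Moments and tails on a finite measure space\<close>

lemma integrable_powr_mono:
  fixes u :: "'a \<Rightarrow> real"
  assumes u[measurable]: "u \<in> borel_measurable M" and nn: "\<And>x. 0 \<le> u x"
    and ab: "0 \<le> a" "a \<le> b" and int: "integrable M (\<lambda>x. u x powr b)"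
  shows "integrable M (\<lambda>x. u x powr a)"
proof (rule Bochner_Integration.integrable_bound[where f="\<lambda>x. 1 + u x powr b"])
  show "integrable M (\<lambda>x. 1 + u x powr b)" using int by auto
  have "u x powr a \<le> 1 + u x powr b" for x
  proof (cases "u x \<le> 1")
    case True
    then have "u x powr a \<le> 1" using powr_mono2[of a "u x" 1] nn[of x] ab by simp
    then show ?thesis by (smt (verit) powr_ge_zero)
  next
    case False
    then have "u x powr a \<le> u x powr b" using ab by (intro powr_mono) auto
    then show ?thesis by simp
  qed
  then show "AE x in M. norm (u x powr a) \<le> norm (1 + u x powr b)"
    by (auto intro!: AE_I2 order_trans[OF _ abs_ge_self])
qed measurable

lemma measure_superlevel_le_moment:
  fixes u :: "'a \<Rightarrow> real"
  assumes u[measurable]: "u \<in> borel_measurable M" and nn: "\<And>x. 0 \<le> u x"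
    and k: "0 < k" and m: "0 \<le> m" and int: "integrable M (\<lambda>x. u x powr m)"
  shows "measure M {x\<in>space M. k < u x} \<le> k powr (- m) * (\<integral>x. u x powr m \<partial>M)"
proof -
  have "k powr m * measure M {x\<in>space M. k < u x} = (\<integral>x. k powr m * indicator {x\<in>space M. k < u x} x \<partial>M)"
    by (simp add: Int_absorb2 subset_eq)
  also have "\<dots> \<le> (\<integral>x. u x powr m \<partial>M)"
  proof (rule integral_mono[OF _ int])
    show "integrable M (\<lambda>x. k powr m * indicator {x\<in>space M. k < u x} x)"
      by (intro integrable_mult_right integrable_real_indicator) (auto simp: emeasure_eq_measure)
  qed (use k m nn in \<open>auto simp: indicator_def intro!: powr_mono2\<close>)
  finally show ?thesis using k by (simp add: powr_minus field_simps)
qed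

text \<open>Dyadic layer-cake argument: on 2^(i + 1) < u \<le> 2^(i + 2) the integrand is at most (4
  * 2^i)^m, while the tail bound at t = 2^i gives measure at most C * 2^(- i b), leaving a geometric
  series of ratio 2^(m - b). The level 2 t in the hypothesis is what the level inequality with l = 2
  k supplies.\<close>

lemma integrable_powr_of_tail:
  fixes u :: "'a \<Rightarrow> real"
  assumes u[measurable]: "u \<in> borel_measurable M" and nn: "\<And>x. 0 \<le> u x"
    and tail: "\<And>t. 1 \<le> t \<Longrightarrow> measure M {x\<in>space M. 2 * t < u x} \<le> C * t powr (- b)"
    and m: "0 \<le> m" "m < b"
  shows "integrable M (\<lambda>x. u x powr m)"
proof -
  define c where "c i = (4 * 2 ^ i) powr m" for i :: nat
  define A where "A i = {x\<in>space M. 2 * 2 ^ i < u x}" for i :: nat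
  have A[measurable]: "A i \<in> sets M" for i unfolding A_def by measurable
  have C0: "0 \<le> C" using tail[of 1] by (simp, meson measure_nonneg order_trans)
  have pw: "ennreal (u x powr m) \<le> ennreal (2 powr m) + (\<Sum>i. ennreal (c i) * indicator (A i) x)"
    if x: "x \<in> space M" for x
  proof (cases "u x \<le> 2")
    case True
    then have "u x powr m \<le> 2 powr m" using nn m by (intro powr_mono2) auto
    then show ?thesis by (simp add: add_increasing2)
  next
    case False
    \<comment> \<open>As u x > 2, the least exponent is at least 2, and i = n - 2 is the shell with
      2 * 2^i < u x \<le> 4 * 2^i.\<close>
    define n where "n = (LEAST n. u x \<le> 2 ^ n)"
    obtain n0 where "u x \<le> 2 ^ n0"
      using real_arch_pow[of 2 "u x"] by (auto intro: less_imp_le)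
    then have n1: "u x \<le> 2 ^ n" unfolding n_def by (rule LeastI)
    have n2: "\<not> u x \<le> 2 ^ i" if "i < n" for i using not_less_Least that unfolding n_def by blast
    have "n \<noteq> 0" "n \<noteq> 1" using n1 False by (auto intro: ccontr)
    then obtain i where i: "n = Suc (Suc i)" by (metis One_nat_def nat.exhaust)
    have "x \<in> A i" using n2[of "Suc i"] i x by (auto simp: A_def)
    moreover have "u x powr m \<le> c i" unfolding c_def using n1 i nn m by (intro powr_mono2) auto
    ultimately have "ennreal (u x powr m) \<le> ennreal (c i) * indicator (A i) x" by (simp add: ennreal_leI)
    also have "\<dots> = (\<Sum>j\<in>{i}. ennreal (c j) * indicator (A j) x)"
      by (simp only: sum.insert[OF finite.emptyI] sum.empty empty_iff not_False_eq_True add_0_right)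
    also have "\<dots> \<le> (\<Sum>i. ennreal (c i) * indicator (A i) x)" by (rule sum_le_suminf) auto
    finally show ?thesis by (simp add: add_increasing)
  qed
  define r where "r = 2 powr (m - b)"
  have r: "0 < r" "r < 1" using m by (auto simp: r_def powr_less_one)
  have shell: "ennreal (c i) * emeasure M (A i) \<le> ennreal (C * 4 powr m * r ^ i)" for i
  proof -
    have "c i * measure M (A i) \<le> c i * (C * (2 ^ i) powr (- b))"
      using tail[of "2 ^ i"] unfolding A_def by (intro mult_left_mono) (auto simp: c_def)
    also have "\<dots> = C * 4 powr m * r ^ i"
    proof -
      have "r ^ i = 2 powr (real i * (m - b))" 
        unfolding r_def by (simp add: powr_realpow[symmetric] powr_powr mult.commute)
      moreover have "c i = 4 powr m * 2 powr (real i * m)"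
        unfolding c_def by (simp add: powr_mult powr_realpow[symmetric] powr_powr)
      moreover have "(2 ^ i) powr (- b) = 2 powr (- (real i * b))" 
        by (simp add: powr_realpow[symmetric] powr_powr)
      ultimately show ?thesis by (simp add: right_diff_distrib powr_diff powr_minus field_simps)
    qed
    finally show ?thesis
      by (simp add: emeasure_eq_measure ennreal_mult'[symmetric] ennreal_leI c_def ennreal_mult''[symmetric])
  qed
  have "(\<integral>\<^sup>+x. ennreal (u x powr m) \<partial>M)
      \<le> (\<integral>\<^sup>+x. ennreal (2 powr m) + (\<Sum>i. ennreal (c i) * indicator (A i) x) \<partial>M)"
    by (rule nn_integral_mono) (rule pw)
  also have "\<dots> = ennreal (2 powr m) * emeasure M (space M) + (\<Sum>i. ennreal (c i) * emeasure M (A i))"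
    by (subst nn_integral_add) (auto simp: nn_integral_suminf nn_integral_cmult)
  also have "\<dots> \<le> ennreal (2 powr m) * emeasure M (space M) + (\<Sum>i. ennreal (C * 4 powr m * r ^ i))"
    by (intro add_left_mono suminf_le shell) auto
  also have "\<dots> < \<infinity>"
  proof -
    have "(\<Sum>i. ennreal (C * 4 powr m * r ^ i)) \<noteq> top"
      using r C0 by (intro ennreal_suminf_neq_top summable_mult summable_geometric) auto
    then show ?thesis by (simp add: emeasure_eq_measure ennreal_mult''[symmetric] less_top[symmetric])
  qed
  finally show ?thesis by (intro integrableI_nonneg) auto
qed

text \<open>Stampacchia's lemma: levels \<open>1 + d (1 - 2\<^sup>-\<^sup>n)\<close>, with \<open>d\<close> chosen so that the measures of
  the superlevel sets decay geometrically.\<close>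

lemma AE_bounded_of_superlevel_decay:
  fixes u :: "'a \<Rightarrow> real"
  assumes u[measurable]: "u \<in> borel_measurable M"
    and p: "0 < p" and \<beta>: "1 < \<beta>" and C: "0 \<le> C"
    and dec: "\<And>k l. 1 \<le> k \<Longrightarrow> k < l \<Longrightarrow>
      (l - k) powr p * measure M {x\<in>space M. l < u x} \<le> C * measure M {x\<in>space M. k < u x} powr \<beta>"
  shows "\<exists>B. AE x in M. u x \<le> B"
proof -
  define a where "a k = measure M {x\<in>space M. k < u x}" for k
  have a0: "0 \<le> a k" for k by (simp add: a_def)
  have amono: "a l \<le> a k" if "k \<le> l" for k l
    unfolding a_def using that by (intro finite_measure_mono) auto
  \<comment> \<open>This decay exponent reproduces itself: raising 2^(- n \<tau>) to the power
    \<beta> yields 2^(- n \<tau>) and an extra 2^(- n p), which pays for the shrinking gaps between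
    the levels.\<close>
  define \<tau> where "\<tau> = p / (\<beta> - 1)"
  have \<tau>: "0 < \<tau>" "\<tau> * \<beta> = \<tau> + p" using p \<beta> by (auto simp: \<tau>_def field_simps)
  define R where "R = C * a 1 powr (\<beta> - 1) * 2 powr (p + \<tau>)"
  have R0: "0 \<le> R" using C by (simp add: R_def)
  \<comment> \<open>Large enough that d^p absorbs the constant R of one step of the recursion; the
    added 1 keeps d positive if R = 0.\<close>
  define d where "d = (R + 1) powr (1 / p)"
  have d: "0 < d" "R \<le> d powr p" using p R0 by (auto simp: d_def powr_powr)
  define lev where "lev n = 1 + d * (1 - (1/2) ^ n)" for n :: nat
  have lev1: "1 \<le> lev n" "lev n \<le> 1 + d" for n
    using d by (auto simp: lev_def power_le_one mult_left_le)
  have levS: "lev (Suc n) - lev n = d * (1/2) ^ Suc n" for n by (simp add: lev_def algebra_simps)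
  have key: "a (lev n) \<le> a 1 * 2 powr (- (real n * \<tau>))" for n
  proof (induction n)
    case 0 then show ?case by (simp add: lev_def)
  next
    case (Suc n)
    have pos: "0 < lev (Suc n) - lev n" unfolding levS using d by simp
    have e1: "(lev (Suc n) - lev n) powr p = d powr p * 2 powr (- (real (Suc n) * p))"
      unfolding levS using d
      by (simp add: powr_mult powr_minus power_one_over powr_divide powr_realpow[symmetric] powr_powr
                    inverse_eq_divide del: of_nat_Suc power_Suc)
    have "d powr p * 2 powr (- (real (Suc n) * p)) * a (lev (Suc n)) \<le> C * a (lev n) powr \<beta>"
      using dec[of "lev n" "lev (Suc n)"] lev1 pos e1 by (simp add: a_def del: power_Suc of_nat_Suc)
    also have "\<dots> \<le> C * (a 1 * 2 powr (- (real n * \<tau>))) powr \<beta>"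
      using Suc a0 C \<beta> by (intro mult_left_mono powr_mono2) auto
    also have "\<dots> = C * a 1 powr (\<beta> - 1) * a 1 * 2 powr (- (real n * (\<tau> * \<beta>)))"
    proof (cases "a 1 = 0")
      case True then show ?thesis by simp
    next
      case False
      then have "a 1 powr \<beta> = a 1 powr (\<beta> - 1) * a 1" using a0[of 1] by (simp add: powr_mult_base[symmetric] powr_diff)
      then show ?thesis using a0 by (simp add: powr_mult powr_powr algebra_simps)
    qed
    also have "\<dots> = R * (a 1 * 2 powr (- (real (Suc n) * \<tau>)) * 2 powr (- (real (Suc n) * p)))"
    proof -
      have "- (real n * (\<tau> * \<beta>)) = (p + \<tau>) + - (real (Suc n) * \<tau>) + - (real (Suc n) * p)"
        unfolding \<tau> by (simp add: algebra_simps)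
      then show ?thesis unfolding R_def by (simp only: powr_add mult_ac)
    qed
    also have "\<dots> \<le> d powr p * (a 1 * 2 powr (- (real (Suc n) * \<tau>)) * 2 powr (- (real (Suc n) * p)))"
      using d a0 by (intro mult_right_mono) auto
    finally have "(d powr p * 2 powr (- (real (Suc n) * p))) * a (lev (Suc n))
       \<le> (d powr p * 2 powr (- (real (Suc n) * p))) * (a 1 * 2 powr (- (real (Suc n) * \<tau>)))"
      by (simp only: mult_ac)
    then show ?case using d by (subst (asm) mult_le_cancel_left_pos) auto
  qed
  have "(\<lambda>n. a 1 * (2 powr (- \<tau>)) ^ n) \<longlonglongrightarrow> a 1 * 0"
    using \<tau> by (intro tendsto_mult tendsto_const LIMSEQ_power_zero) (auto simp: powr_less_one)
  moreover have "a (1 + d) \<le> a 1 * (2 powr (- \<tau>)) ^ n" for n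
    using order_trans[OF amono[OF lev1(2)[of n]] key[of n]]
    by (simp add: powr_realpow[symmetric] powr_powr mult.commute)
  ultimately have "a (1 + d) \<le> 0"
    by (intro LIMSEQ_le_const[where X="\<lambda>n. a 1 * (2 powr (- \<tau>)) ^ n"]) auto
  then have "emeasure M {x\<in>space M. 1 + d < u x} = 0"
    using a0[of "1+d"] by (simp add: a_def emeasure_eq_measure measure_le_0_iff)
  then have "AE x in M. u x \<le> 1 + d"
    by (subst AE_iff_measurable[OF _ refl]) (auto simp: not_le)
  then show ?thesis by blast
qed

text \<open>One round of the iteration. With l = 2 k, the m-th moment bounds the measure of {u > k}
  by a multiple of k^(- m), so the tail of u decays with exponent p + m \<theta> + c. Here
  \<open>e\<close> stands for the truncation energies and c for their decay rate in the level: 0 at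
  first, positive once the equation has been used.\<close>

lemma integrable_powr_improve:
  fixes u e :: "_ \<Rightarrow> real"
  assumes u[measurable]: "u \<in> borel_measurable M" and nn: "\<And>x. 0 \<le> u x"
    and \<theta>: "0 \<le> \<theta>" and C: "0 \<le> C" and D: "0 \<le> D"
    and dec: "\<And>k l. 1 \<le> k \<Longrightarrow> k < l \<Longrightarrow>
      (l - k) powr p * measure M {x\<in>space M. l < u x} \<le> C * measure M {x\<in>space M. k < u x} powr \<theta> * e k"
    and e: "\<And>k. 1 \<le> k \<Longrightarrow> e k \<le> D * k powr (- c)"
    and m: "0 \<le> m" "integrable M (\<lambda>x. u x powr m)"
    and m': "0 \<le> m'" "m' < p + m * \<theta> + c"
  shows "integrable M (\<lambda>x. u x powr m')"
proof (rule integrable_powr_of_tail[OF u nn _ m'])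
  fix t :: real assume t: "1 \<le> t"
  define I where "I = (\<integral>x. u x powr m \<partial>M)"
  have I: "0 \<le> I" unfolding I_def by (intro Bochner_Integration.integral_nonneg) auto
  have "t powr p * measure M {x\<in>space M. 2 * t < u x} \<le> C * measure M {x\<in>space M. t < u x} powr \<theta> * e t"
    using dec[of t "2 * t"] t by simp
  also have "\<dots> \<le> C * measure M {x\<in>space M. t < u x} powr \<theta> * (D * t powr (- c))"
    using e[OF t] C by (intro mult_left_mono) auto
  also have "\<dots> \<le> C * (t powr (- m) * I) powr \<theta> * (D * t powr (- c))"
    using measure_superlevel_le_moment[OF u nn _ m, of t] t C D \<theta>
    by (intro mult_right_mono mult_left_mono powr_mono2) (auto simp: I_def)
  also have "\<dots> = t powr p * (C * D * I powr \<theta> * t powr (- (p + m * \<theta> + c)))"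
  proof -
    have "(t powr (- m) * I) powr \<theta> = t powr (- (m * \<theta>)) * I powr \<theta>"
      using t I by (simp add: powr_mult powr_powr)
    moreover have "t powr (- (m * \<theta>)) * t powr (- c) = t powr p * t powr (- (p + m * \<theta> + c))"
      by (simp add: powr_add[symmetric])
    ultimately show ?thesis by (simp add: mult_ac)
  qed
  finally show "measure M {x\<in>space M. 2 * t < u x} \<le> C * D * I powr \<theta> * t powr (- (p + m * \<theta> + c))"
    using t by (subst (asm) mult_le_cancel_left_pos) auto
qed

text \<open>Without decay of the energies, the exponent improves from m to anything below p + m
  \<theta>. As long as m \<le> r, the gain p - m (1 - \<theta>) is at least p - r (1 - \<theta>) = 2
  \<gamma> > 0; each round takes \<gamma> of it, so r is reached after finitely many.\<close>

lemma integrable_powr_of_energy_bound: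
  fixes u e :: "_ \<Rightarrow> real"
  assumes u[measurable]: "u \<in> borel_measurable M" and nn: "\<And>x. 0 \<le> u x"
    and \<theta>: "0 \<le> \<theta>" "\<theta> < 1" and C: "0 \<le> C" and p: "0 < p" "p \<le> r" "r * (1 - \<theta>) < p"
    and dec: "\<And>k l. 1 \<le> k \<Longrightarrow> k < l \<Longrightarrow>
      (l - k) powr p * measure M {x\<in>space M. l < u x} \<le> C * measure M {x\<in>space M. k < u x} powr \<theta> * e k"
    and e: "\<And>k. 1 \<le> k \<Longrightarrow> e k \<le> D"
    and int: "integrable M (\<lambda>x. u x powr p)"
  shows "integrable M (\<lambda>x. u x powr r)"
proof -
  define \<gamma> where "\<gamma> = (p - r * (1 - \<theta>)) / 2"
  have \<gamma>: "0 < \<gamma>" using p by (simp add: \<gamma>_def)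
  \<comment> \<open>The plain bound is read as decay with exponent c = 0.\<close>
  have e': "e k \<le> \<bar>D\<bar> * k powr (- 0)" if "1 \<le> k" for k
    using e[OF that] that by simp
  have ind: "integrable M (\<lambda>x. u x powr (min r (p + real n * \<gamma>)))" for n
  proof (induction n)
    case 0 then show ?case using int p by (simp add: min_absorb2)
  next
    case (Suc n)
    let ?m = "min r (p + real n * \<gamma>)"
    have m: "0 \<le> ?m" "?m \<le> r" using p \<gamma> by auto
    have "?m * (1 - \<theta>) \<le> r * (1 - \<theta>)" using m \<theta> by (intro mult_right_mono) auto
    then have "?m + \<gamma> < p + ?m * \<theta> + 0" using \<gamma> by (simp add: \<gamma>_def field_simps)
    then have "integrable M (\<lambda>x. u x powr (?m + \<gamma>))"
      using m \<gamma> by (intro integrable_powr_improve[OF u nn \<theta>(1) C abs_ge_zero dec e' m(1) Suc]) auto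
    then show ?case
      using p \<gamma> by (elim integrable_powr_mono[OF u nn, rotated 2]) (auto simp: min_def algebra_simps)
  qed
  obtain n where "r < real n * \<gamma>" using \<gamma> ex_less_of_nat_mult by blast
  then have "min r (p + real n * \<gamma>) = r" using p by auto
  then show ?thesis using ind[of n] by simp
qed

text \<open>On {u > k} one has u^r \<le> k^(r - m) u^m, so an m-th moment makes the energies decay
  with rate c = m - r. The exponent then grows by up to p + m \<theta> - r \<ge> 2 \<gamma> with no
  upper limit on m, which gives arbitrarily high moments. One with m > r / \<theta> pushes the power
  of the superlevel measure above 1, as Stampacchia's lemma requires.\<close>

lemma AE_bounded_of_energy_inequality:
  fixes u e :: "_ \<Rightarrow> real"
  assumes u[measurable]: "u \<in> borel_measurable M" and nn: "\<And>x. 0 \<le> u x"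
    and \<theta>: "0 < \<theta>" "\<theta> < 1" and C: "0 \<le> C" and p: "0 < p" "p \<le> r" "r * (1 - \<theta>) < p"
    and dec: "\<And>k l. 1 \<le> k \<Longrightarrow> k < l \<Longrightarrow>
      (l - k) powr p * measure M {x\<in>space M. l < u x} \<le> C * measure M {x\<in>space M. k < u x} powr \<theta> * e k"
    and D: "0 \<le> D"
    and e: "\<And>k. 1 \<le> k \<Longrightarrow> e k \<le> D * (\<integral>x. u x powr r * indicator {x\<in>space M. k < u x} x \<partial>M)"
    and int: "integrable M (\<lambda>x. u x powr r)"
  shows "\<exists>B. AE x in M. u x \<le> B"
proof -
  define I where "I m = (\<integral>x. u x powr m \<partial>M)" for m
  have I: "0 \<le> I m" for m unfolding I_def by (intro Bochner_Integration.integral_nonneg) auto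
  define \<gamma> where "\<gamma> = (p - r * (1 - \<theta>)) / 2"
  have \<gamma>: "0 < \<gamma>" using p by (simp add: \<gamma>_def)
  have int_ind: "integrable M (\<lambda>x. u x powr r * indicator {x\<in>space M. k < u x} x)" for k
    using int by (intro integrable_real_mult_indicator) auto
  have mom: "integrable M (\<lambda>x. u x powr (r + real n * \<gamma>))" for n
  proof (induction n)
    case 0 then show ?case using int by simp
  next
    case (Suc n)
    let ?m = "r + real n * \<gamma>"
    have m: "0 \<le> ?m" "r \<le> ?m" using p \<gamma> by auto
    have "e k \<le> D * I ?m * k powr (- (?m - r))" if k: "1 \<le> k" for k
    proof -
      have "(\<integral>x. u x powr r * indicator {x\<in>space M. k < u x} x \<partial>M) \<le> (\<integral>x. k powr (r - ?m) * u x powr ?m \<partial>M)"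
      proof (rule integral_mono[OF int_ind])
        fix x
        show "u x powr r * indicator {x\<in>space M. k < u x} x \<le> k powr (r - ?m) * u x powr ?m"
        proof (cases "k < u x")
          case True
          have "u x powr r = u x powr (r - ?m) * u x powr ?m" using True k by (simp add: powr_add[symmetric])
          also have "\<dots> \<le> k powr (r - ?m) * u x powr ?m"
            using True k m by (intro mult_right_mono powr_mono2') auto
          finally show ?thesis by (auto simp: indicator_def)
        qed auto
      qed (use Suc in auto)
      then have "D * (\<integral>x. u x powr r * indicator {x\<in>space M. k < u x} x \<partial>M) \<le> D * (k powr (r - ?m) * I ?m)"
        using D by (intro mult_left_mono) (auto simp: I_def)
      then show ?thesis using e[OF k] by (simp add: algebra_simps)
    qed
    moreover have "?m * \<theta> \<ge> r * \<theta>" using m \<theta> by (intro mult_right_mono) auto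
    then have "?m + \<gamma> < p + ?m * \<theta> + (?m - r)" using \<gamma> by (simp add: \<gamma>_def field_simps)
    ultimately have "integrable M (\<lambda>x. u x powr (?m + \<gamma>))"
      using m \<gamma> \<theta> D I by (intro integrable_powr_improve[OF u nn _ C _ dec _ m(1) Suc, where c="?m - r" and D="D * I ?m"]) auto
    then show ?case by (simp add: algebra_simps)
  qed
  \<comment> \<open>High enough that r / m < \<theta> / 2, hence \<beta> = \<theta> + 1 - r / m
    exceeds 1.\<close>
  obtain n where n: "2 * r / \<theta> < real n * \<gamma>" using \<gamma> ex_less_of_nat_mult by blast
  define m where "m = r + real n * \<gamma>"
  have m: "0 < m" "r \<le> m" "2 * r / \<theta> < m" using p \<gamma> n by (auto simp: m_def add_pos_nonneg add_strict_increasing)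
  have intm: "integrable M (\<lambda>x. u x powr m)" unfolding m_def by (rule mom)
  have rm: "r / m < \<theta> / 2" using m \<theta> by (simp add: field_simps)
  define \<beta> where "\<beta> = \<theta> + (1 - r / m)"
  have \<beta>: "1 < \<beta>" unfolding \<beta>_def using rm \<theta> by linarith
  show ?thesis
  proof (rule AE_bounded_of_superlevel_decay[OF u p(1) \<beta>, where C="C * (D * (1 + I m))"])
    fix k l :: real assume k: "1 \<le> k" and kl: "k < l"
    let ?A = "{x\<in>space M. k < u x}"
    define a where "a = measure M ?A"
    have a: "0 \<le> a" by (simp add: a_def)
    show "(l - k) powr p * measure M {x\<in>space M. l < u x} \<le> C * (D * (1 + I m)) * measure M ?A powr \<beta>"
    proof (cases "a = 0")
      case True
      have "measure M {x\<in>space M. l < u x} \<le> a"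
        unfolding a_def using kl by (intro finite_measure_mono) auto
      then show ?thesis using True a_def by (simp add: measure_le_0_iff)
    next
      case False
      with a have apos: "0 < a" by simp
      \<comment> \<open>Cutting u at height t bounds the integral of u^r over the superlevel set by
        t^r a + t^(r - m) I(m); this t makes both powers equal to a^(1 - r / m), the exponent that
        Hoelder's inequality would give.\<close>
      define t where "t = a powr (- 1 / m)"
      have t: "0 < t" using apos by (simp add: t_def)
      have "t powr r * a = a powr (- (r / m)) * a powr 1"
        using apos by (simp add: t_def powr_powr)
      also have "\<dots> = a powr (1 - r / m)" by (subst powr_add[symmetric]) simp
      finally have tr1: "t powr r * a = a powr (1 - r / m)" .
      have "- 1 / m * (r - m) = 1 - r / m" using m by (simp add: field_simps)
      then have tr2: "t powr (r - m) = a powr (1 - r / m)" by (simp add: t_def powr_powr)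
      have "(\<integral>x. u x powr r * indicator ?A x \<partial>M) \<le> (\<integral>x. t powr r * indicator ?A x + t powr (r - m) * u x powr m \<partial>M)"
      proof (rule integral_mono[OF int_ind])
        show "integrable M (\<lambda>x. t powr r * indicator ?A x + t powr (r - m) * u x powr m)"
          using intm by (intro integrable_mult_right integrable_real_indicator Bochner_Integration.integrable_add)
             (auto simp: emeasure_eq_measure)
        fix x
        show "u x powr r * indicator ?A x \<le> t powr r * indicator ?A x + t powr (r - m) * u x powr m"
        proof (cases "u x \<le> t")
          case True
          then have "u x powr r \<le> t powr r" using nn p by (intro powr_mono2) auto
          then show ?thesis by (auto simp: indicator_def add_increasing2)
        next
          case False
          have "u x powr r = u x powr (r - m) * u x powr m" using False t by (simp add: powr_add[symmetric])
          also have "\<dots> \<le> t powr (r - m) * u x powr m"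
            using False t m by (intro mult_right_mono powr_mono2') auto
          finally show ?thesis by (auto simp: indicator_def add_increasing)
        qed
      qed
      also have "\<dots> = t powr r * a + t powr (r - m) * I m"
        using intm by (subst Bochner_Integration.integral_add)
          (auto simp: I_def a_def emeasure_eq_measure Int_absorb2 subset_eq
             intro!: integrable_mult_right integrable_real_indicator)
      also have "\<dots> = (1 + I m) * a powr (1 - r / m)" unfolding tr1 tr2 by (simp add: algebra_simps)
      finally have le: "e k \<le> D * ((1 + I m) * a powr (1 - r / m))"
        using e[OF k] D by (meson mult_left_mono order_trans)
      have "(l - k) powr p * measure M {x\<in>space M. l < u x} \<le> C * a powr \<theta> * e k"
        using dec[OF k kl] by (simp add: a_def)
      also have "\<dots> \<le> C * a powr \<theta> * (D * ((1 + I m) * a powr (1 - r / m)))"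
        using C by (intro mult_left_mono le) auto
      also have "\<dots> = C * (D * (1 + I m)) * a powr \<beta>" by (simp add: \<beta>_def powr_add)
      finally show ?thesis by (simp add: a_def)
    qed
  qed (use C D I in auto)
qed

end

section \<open>Boundedness of weak solutions\<close>

lemma Linfty_AE_bounded:
  assumes "f \<in> Linfty \<Omega>"
  shows "\<exists>F\<ge>0. AE x in lebesgue_on \<Omega>. \<bar>f x\<bar> \<le> F"
proof -
  let ?s = "esssup (lebesgue_on \<Omega>) (\<lambda>x. ereal \<bar>f x\<bar>)"
  have s: "?s < \<infinity>" using assms by (simp add: Linfty_def)
  have ae: "AE x in lebesgue_on \<Omega>. ereal \<bar>f x\<bar> \<le> ?s" by (rule esssup_AE)
  show ?thesis
  proof (intro exI conjI)
    show "AE x in lebesgue_on \<Omega>. \<bar>f x\<bar> \<le> max 0 (real_of_ereal ?s)"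
      using ae
    proof eventually_elim
      case (elim x)
      then show ?case using s by (cases ?s) auto
    qed
  qed simp
qed

lemma ess_inf_AE:
  assumes K: "compact K" and u: "u \<in> borel_measurable lebesgue" and C: "ereal C \<le> ess_inf K u"
  shows "AE x in lebesgue. x \<in> K \<longrightarrow> C \<le> u x"
proof -
  have "AE x in lebesgue_on K. - ereal (u x) \<le> esssup (lebesgue_on K) (\<lambda>x. - ereal (u x))" by (rule esssup_AE)
  then have "AE x in lebesgue_on K. C \<le> u x"
  proof eventually_elim
    case (elim x)
    have "esssup (lebesgue_on K) (\<lambda>x. - ereal (u x)) \<le> - ereal C"
      using C ereal_uminus_le_reorder unfolding ess_inf_def by (metis ereal_minus_le_minus ereal_uminus_uminus)
    with elim have "- ereal (u x) \<le> - ereal C" by (rule order_trans)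
    then show ?case by simp
  qed
  then show ?thesis using K by (subst (asm) AE_restrict_space_iff) (auto simp: compact_imp_closed)
qed

context fractional_kernel begin

context
  fixes u f g :: "real^'n \<Rightarrow> real" and \<Omega> :: "(real^'n) set" and lam \<delta> q :: real
  assumes \<Omega>: "open \<Omega>" "bounded \<Omega>" and lam: "0 < lam" and \<delta>: "0 < \<delta>"
    and q: "p < q + 1" "(q + 1) * (1 - p * s / Q) < p"
    and f: "f \<in> Linfty \<Omega>" "AE x in lebesgue_on \<Omega>. 0 < f x"
    and g: "g \<in> Linfty \<Omega>" "AE x in lebesgue_on \<Omega>. 0 < g x"
    and sol: "weak_solution mul ginv \<rho> Q s p \<Omega> lam \<delta> q f g u"
    and u_nonneg: "AE x in lebesgue_on \<Omega>. 0 \<le> u x"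
begin

lemma solution_X0: "u \<in> X0 mul ginv \<rho> Q s p \<Omega>"
  using sol by (simp add: weak_solution_def)

lemma solution_measurable: "u \<in> borel_measurable lebesgue"
  by (rule X0_measurable[OF solution_X0])

lemma finite_domain: "finite_measure (lebesgue_on \<Omega>)"
proof
  show "emeasure (lebesgue_on \<Omega>) (space (lebesgue_on \<Omega>)) \<noteq> \<infinity>"
    using emeasure_bounded_finite[OF \<Omega>(2)] \<Omega>(1) by (simp add: emeasure_restrict_space)
qed

interpretation dom: finite_measure "lebesgue_on \<Omega>" by (rule finite_domain)

text \<open>The solution is nonnegative only almost everywhere, whereas the iteration lemmas ask for
  nonnegativity everywhere.\<close>

definition pos_part :: "real^'n \<Rightarrow> real" where "pos_part x = max 0 (u x)"

lemma pos_part_measurable [measurable]: "pos_part \<in> borel_measurable (lebesgue_on \<Omega>)"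
proof -
  have [measurable]: "u \<in> borel_measurable (lebesgue_on \<Omega>)" by (intro measurable_restrict_space1 solution_measurable)
  show ?thesis unfolding pos_part_def[abs_def] by measurable
qed

lemma pos_part_nonneg: "0 \<le> pos_part x" by (simp add: pos_part_def)

lemma pos_part_eq_AE: "AE x in lebesgue_on \<Omega>. pos_part x = u x"
  using u_nonneg by eventually_elim (simp add: pos_part_def)

text \<open>Since u vanishes almost everywhere outside \<Omega> and a > 0, the superlevel sets in
  \<Omega> and in the whole group agree up to a null set. This links the energy estimate on the
  group with the iteration on \<Omega>.\<close>

lemma superlevel_measure:
  assumes a: "0 < a"
  shows "measure (lebesgue_on \<Omega>) {x\<in>space (lebesgue_on \<Omega>). a < pos_part x} = measure lebesgue {x. a < u x}"
    and "emeasure lebesgue {x. a < u x} < \<infinity>"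
proof -
  note solution_measurable[measurable]
  have "{x\<in>space lebesgue. a < u x} \<in> sets lebesgue" by measurable
  then have A[measurable]: "{x. a < u x} \<in> sets lebesgue" by simp
  have \<Omega>m[measurable]: "\<Omega> \<in> sets lebesgue" using \<Omega> by simp
  have "AE x in lebesgue. x \<notin> \<Omega> \<longrightarrow> u x = 0" using solution_X0 by (simp add: X0_def)
  then have ae: "AE x in lebesgue. x \<in> {x. a < u x} \<longleftrightarrow> x \<in> \<Omega> \<inter> {x. a < u x}"
    by eventually_elim (use a in auto)
  have eq: "{x\<in>space (lebesgue_on \<Omega>). a < pos_part x} = \<Omega> \<inter> {x. a < u x}" using a by (auto simp: pos_part_def)
  have "measure (lebesgue_on \<Omega>) (\<Omega> \<inter> {x. a < u x}) = measure lebesgue (\<Omega> \<inter> {x. a < u x})"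
    by (intro measure_restrict_space) auto
  also have "\<dots> = measure lebesgue {x. a < u x}" using ae by (intro measure_eq_AE) auto
  finally show "measure (lebesgue_on \<Omega>) {x\<in>space (lebesgue_on \<Omega>). a < pos_part x} = measure lebesgue {x. a < u x}"
    unfolding eq .
  have "emeasure lebesgue {x. a < u x} = emeasure lebesgue (\<Omega> \<inter> {x. a < u x})" using ae by (intro emeasure_eq_AE) auto
  also have "\<dots> \<le> emeasure lebesgue \<Omega>" by (intro emeasure_mono) auto
  also have "\<dots> < \<infinity>" using emeasure_bounded_finite[OF \<Omega>(2)] \<Omega>(1) by simp
  finally show "emeasure lebesgue {x. a < u x} < \<infinity>" .
qed

abbreviation (input) "E a \<equiv> energy (\<lambda>x. max 0 (u x - a))"

lemma truncation_energy_le_energy: "E a \<le> energy u" "E a < \<infinity>"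
proof -
  show "E a \<le> energy u" by (rule energy_lipschitz_le) (auto simp: max_def)
  then show "E a < \<infinity>" using X0_energy_finite[OF solution_X0] by (rule le_less_trans)
qed

abbreviation (input) "CS \<equiv> (2 / unit_ball_volume) powr (1 + p * s / Q)"

lemma level_inequality:
  assumes "1 \<le> a" "a < b"
  shows "(b - a) powr p * measure (lebesgue_on \<Omega>) {x\<in>space (lebesgue_on \<Omega>). b < pos_part x}
    \<le> CS * measure (lebesgue_on \<Omega>) {x\<in>space (lebesgue_on \<Omega>). a < pos_part x} powr (p * s / Q) * enn2real (E a)"
proof -
  have "0 < a" "0 < b" using assms by simp_all
  then show ?thesis
    unfolding superlevel_measure(1)[OF \<open>0 < a\<close>] superlevel_measure(1)[OF \<open>0 < b\<close>]
    by (intro superlevel_le_energy solution_measurable assms superlevel_measure(2) truncation_energy_le_energy(2))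
qed

lemma theta: "0 < p * s / Q" "p * s / Q < 1"
  using ps_pos Q_pos p by simp_all

lemma pos_part_integrable_p: "integrable (lebesgue_on \<Omega>) (\<lambda>x. pos_part x powr p)"
proof (rule Bochner_Integration.integrable_bound[OF X0_moment_finite[OF solution_X0 \<Omega>]])
  show "AE x in lebesgue_on \<Omega>. norm (pos_part x powr p) \<le> norm (\<bar>u x\<bar> powr p)"
    using p by (intro AE_I2) (auto simp: pos_part_def intro!: powr_mono2)
qed measurable

text \<open>This rests on membership in the energy space alone: every truncation has energy at most
  E(u). It has to precede the use of the equation, where it makes the term with u^q meaningful
  against test functions.\<close>

lemma pos_part_integrable_q1: "integrable (lebesgue_on \<Omega>) (\<lambda>x. pos_part x powr (q + 1))"
proof (rule dom.integrable_powr_of_energy_bound[where e="\<lambda>a. enn2real (E a)" and C=CS and D="enn2real (energy u)",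
      OF pos_part_measurable pos_part_nonneg less_imp_le[OF theta(1)] theta(2) _ _ _ q(2) level_inequality _ pos_part_integrable_p])
  show "enn2real (E a) \<le> enn2real (energy u)" for a
    using truncation_energy_le_energy(1) X0_energy_finite[OF solution_X0] by (intro enn2real_mono) auto
qed (use p q in auto)

section \<open>The right-hand side of the equation and the energy of truncations\<close>

definition rhs :: "real^'n \<Rightarrow> real" where
  "rhs x = lam * (f x * u x powr (- \<delta>)) + g x * u x powr q"

lemma data_measurable [measurable]:
  "u \<in> borel_measurable (lebesgue_on \<Omega>)" "f \<in> borel_measurable (lebesgue_on \<Omega>)" "g \<in> borel_measurable (lebesgue_on \<Omega>)"
  using f(1) g(1) by (auto simp: Linfty_def intro: measurable_restrict_space1 solution_measurable)

lemma rhs_measurable [measurable]: "rhs \<in> borel_measurable (lebesgue_on \<Omega>)"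
  unfolding rhs_def[abs_def] by measurable

lemma rhs_nonneg: "AE x in lebesgue_on \<Omega>. 0 \<le> rhs x"
  using f(2) g(2) by eventually_elim (use lam in \<open>auto simp: rhs_def intro!: add_nonneg_nonneg mult_nonneg_nonneg\<close>)

text \<open>On the support of \<phi>, a compact subset of \<Omega>, the solution is bounded below by
  a positive constant, so u^(- \<delta>) is bounded there; elsewhere \<phi> vanishes.\<close>

lemma singular_term_integrable:
  assumes \<phi>: "\<phi> \<in> Cc_infty \<Omega>"
  shows "integrable (lebesgue_on \<Omega>) (\<lambda>x. f x * u x powr (- \<delta>) * \<phi> x)"
proof -
  have [measurable]: "\<phi> \<in> borel_measurable (lebesgue_on \<Omega>)"
    by (intro measurable_restrict_space1 Cc_infty_measurable[OF \<phi>])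
  obtain F where F: "0 \<le> F" "AE x in lebesgue_on \<Omega>. \<bar>f x\<bar> \<le> F" using Linfty_AE_bounded[OF f(1)] by blast
  obtain M where M: "0 < M" "\<And>x. \<bar>\<phi> x\<bar> \<le> M" using Cc_infty_bounded[OF \<phi>] by blast
  let ?K = "closure {x. \<phi> x \<noteq> 0}"
  have K: "compact ?K" "?K \<subseteq> \<Omega>" using \<phi> by (auto simp: Cc_infty_def)
  then obtain C where C: "0 < C" "ereal C \<le> ess_inf ?K u" using sol unfolding weak_solution_def by blast
  have "AE x in lebesgue. x \<in> ?K \<longrightarrow> C \<le> u x" by (rule ess_inf_AE[OF K(1) solution_measurable C(2)])
  then have "AE x in lebesgue_on \<Omega>. x \<in> ?K \<longrightarrow> C \<le> u x"
    using \<Omega> by (subst AE_restrict_space_iff) (auto elim: eventually_mono)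
  with F(2) have "AE x in lebesgue_on \<Omega>. norm (f x * u x powr (- \<delta>) * \<phi> x) \<le> F * C powr (- \<delta>) * M"
  proof eventually_elim
    case (elim x)
    show ?case
    proof (cases "x \<in> ?K")
      case True
      then have "u x powr (- \<delta>) \<le> C powr (- \<delta>)" using elim C \<delta> by (intro powr_mono2') auto
      then show ?thesis unfolding norm_mult using elim F M by (intro mult_mono) auto
    next
      case False
      then have "\<phi> x = 0" by (rule Cc_infty_outside)
      then show ?thesis using F M by simp
    qed
  qed
  then show ?thesis by (intro dom.integrable_const_bound) measurable
qed

lemma power_term_integrable:
  assumes \<phi>: "\<phi> \<in> Cc_infty \<Omega>"
  shows "integrable (lebesgue_on \<Omega>) (\<lambda>x. g x * u x powr q * \<phi> x)"
proof -
  have [measurable]: "\<phi> \<in> borel_measurable (lebesgue_on \<Omega>)"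
    by (intro measurable_restrict_space1 Cc_infty_measurable[OF \<phi>])
  obtain G where G: "0 \<le> G" "AE x in lebesgue_on \<Omega>. \<bar>g x\<bar> \<le> G" using Linfty_AE_bounded[OF g(1)] by blast
  obtain M where M: "0 < M" "\<And>x. \<bar>\<phi> x\<bar> \<le> M" using Cc_infty_bounded[OF \<phi>] by blast
  have "integrable (lebesgue_on \<Omega>) (\<lambda>x. pos_part x powr q)"
    using q p by (intro dom.integrable_powr_mono[OF pos_part_measurable pos_part_nonneg _ _ pos_part_integrable_q1]) auto
  then have "integrable (lebesgue_on \<Omega>) (\<lambda>x. G * pos_part x powr q * M)" by simp
  then show ?thesis
  proof (rule Bochner_Integration.integrable_bound)
    show "AE x in lebesgue_on \<Omega>. norm (g x * u x powr q * \<phi> x) \<le> norm (G * pos_part x powr q * M)"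
      using G(2) pos_part_eq_AE
    proof eventually_elim
      case (elim x)
      then show ?case unfolding norm_mult using G M by (intro mult_mono) auto
    qed
  qed measurable
qed

lemma rhs_integrable:
  assumes \<phi>: "\<phi> \<in> Cc_infty \<Omega>"
  shows "integrable (lebesgue_on \<Omega>) (\<lambda>x. rhs x * \<phi> x)"
    and "frac_p_sublaplacian mul ginv \<rho> Q s p u \<phi> = (\<integral>x. rhs x * \<phi> x \<partial>lebesgue_on \<Omega>)"
proof -
  note i = singular_term_integrable[OF \<phi>] power_term_integrable[OF \<phi>]
  have eq: "(\<lambda>x. rhs x * \<phi> x) = (\<lambda>x. lam * (f x * u x powr (- \<delta>) * \<phi> x) + g x * u x powr q * \<phi> x)"
    by (simp add: rhs_def fun_eq_iff algebra_simps)
  show "integrable (lebesgue_on \<Omega>) (\<lambda>x. rhs x * \<phi> x)"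
    unfolding eq using i by (intro Bochner_Integration.integrable_add integrable_mult_right)
  have "(\<integral>x. rhs x * \<phi> x \<partial>lebesgue_on \<Omega>) = lam * (\<integral>x. f x * u x powr (- \<delta>) * \<phi> x \<partial>lebesgue_on \<Omega>) + (\<integral>x. g x * u x powr q * \<phi> x \<partial>lebesgue_on \<Omega>)"
    unfolding eq using i by simp
  moreover have "frac_p_sublaplacian mul ginv \<rho> Q s p u \<phi>
        - lam * (\<integral>x. f x * u x powr (- \<delta>) * \<phi> x \<partial>lebesgue_on \<Omega>)
        - (\<integral>x. g x * u x powr q * \<phi> x \<partial>lebesgue_on \<Omega>) = 0"
    using sol \<phi> unfolding weak_solution_def by blast
  ultimately show "frac_p_sublaplacian mul ginv \<rho> Q s p u \<phi> = (\<integral>x. rhs x * \<phi> x \<partial>lebesgue_on \<Omega>)" by simp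
qed

text \<open>Where u > a \<ge> 1, the inequality u^(- \<delta>) \<le> u^q bounds the right-hand side
  by (\<lambda> F + G) u^q, with F and G bounds for |f| and |g|. The test function (u - a)_+ \<le> u
  contributes the remaining power.\<close>

lemma truncation_energy_le_moment:
  "\<exists>D\<ge>0. \<forall>a\<ge>1. enn2real (E a) \<le> D * (\<integral>x. pos_part x powr (q + 1) * indicator {x\<in>space (lebesgue_on \<Omega>). a < pos_part x} x \<partial>lebesgue_on \<Omega>)"
proof -
  obtain F where F: "0 \<le> F" "AE x in lebesgue_on \<Omega>. \<bar>f x\<bar> \<le> F" using Linfty_AE_bounded[OF f(1)] by blast
  obtain G where G: "0 \<le> G" "AE x in lebesgue_on \<Omega>. \<bar>g x\<bar> \<le> G" using Linfty_AE_bounded[OF g(1)] by blast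
  define D where "D = lam * F + G"
  have D: "0 \<le> D" using lam F G by (simp add: D_def)
  have "enn2real (E a) \<le> D * (\<integral>x. pos_part x powr (q + 1) * indicator {x\<in>space (lebesgue_on \<Omega>). a < pos_part x} x \<partial>lebesgue_on \<Omega>)"
    if a: "1 \<le> a" for a
  proof -
    let ?I = "\<lambda>x. D * (pos_part x powr (q + 1) * indicator {x\<in>space (lebesgue_on \<Omega>). a < pos_part x} x)"
    have a0: "0 \<le> a" using a by simp
    note tr = truncation_energy_le[OF solution_X0 \<Omega>(1) rhs_measurable rhs_nonneg rhs_integrable a0]
    have Im: "{x\<in>space (lebesgue_on \<Omega>). a < pos_part x} \<in> sets (lebesgue_on \<Omega>)" by measurable
    have "(\<integral>x. rhs x * max 0 (u x - a) \<partial>lebesgue_on \<Omega>) \<le> (\<integral>x. ?I x \<partial>lebesgue_on \<Omega>)"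
    proof (rule integral_mono_AE[OF tr(1)])
      show "integrable (lebesgue_on \<Omega>) ?I"
        by (intro integrable_mult_right integrable_real_mult_indicator pos_part_integrable_q1 Im)
      have sp: "AE x in lebesgue_on \<Omega>. x \<in> space (lebesgue_on \<Omega>)" by (rule AE_space)
      show "AE x in lebesgue_on \<Omega>. rhs x * max 0 (u x - a) \<le> ?I x"
        using F(2) G(2) sp
      proof eventually_elim
        case (elim x)
        show ?case
        proof (cases "a < u x")
          case True
          then have u1: "1 \<le> u x" using a by simp
          have "u x powr (- \<delta>) \<le> u x powr q" using u1 \<delta> q p by (intro powr_mono) auto
          then have "f x * u x powr (- \<delta>) \<le> F * u x powr q" using elim F by (intro mult_mono) auto
          then have "lam * (f x * u x powr (- \<delta>)) \<le> lam * (F * u x powr q)" using lam by simp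
          moreover have "g x * u x powr q \<le> G * u x powr q" using elim by (intro mult_right_mono) auto
          ultimately have "rhs x \<le> D * u x powr q" by (simp add: rhs_def D_def algebra_simps)
          then have "rhs x * max 0 (u x - a) \<le> (D * u x powr q) * u x"
            using True a D by (intro mult_mono) auto
          also have "\<dots> = D * u x powr (q + 1)" using u1 by (simp add: powr_add)
          finally show ?thesis using True a elim by (simp add: pos_part_def)
        next
          case False
          then show ?thesis using D by (simp add: max_def)
        qed
      qed
    qed
    then have "E a \<le> ennreal (\<integral>x. ?I x \<partial>lebesgue_on \<Omega>)"
      using tr(2) by (meson ennreal_leI order_trans)
    moreover have "0 \<le> (\<integral>x. ?I x \<partial>lebesgue_on \<Omega>)"
      using D by (intro Bochner_Integration.integral_nonneg) auto
    ultimately have "enn2real (E a) \<le> (\<integral>x. ?I x \<partial>lebesgue_on \<Omega>)" by (intro enn2real_leI)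
    then show ?thesis by simp
  qed
  then show ?thesis using D by blast
qed

theorem solution_bounded: "u \<in> Linfty \<Omega>"
proof -
  obtain D where D: "0 \<le> D" "\<And>a. 1 \<le> a \<Longrightarrow>
     enn2real (E a) \<le> D * (\<integral>x. pos_part x powr (q + 1) * indicator {x\<in>space (lebesgue_on \<Omega>). a < pos_part x} x \<partial>lebesgue_on \<Omega>)"
    using truncation_energy_le_moment by blast
  have "\<exists>B. AE x in lebesgue_on \<Omega>. pos_part x \<le> B"
    by (rule dom.AE_bounded_of_energy_inequality[where e="\<lambda>a. enn2real (E a)" and p=p and \<theta>="p * s / Q" and C=CS, OF pos_part_measurable pos_part_nonneg theta _ _ _ q(2) level_inequality D pos_part_integrable_q1])
      (use p q in auto)
  then obtain B where B: "AE x in lebesgue_on \<Omega>. pos_part x \<le> B" by blast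
  have "AE x in lebesgue_on \<Omega>. ereal \<bar>u x\<bar> \<le> ereal B"
    using B pos_part_eq_AE by eventually_elim (use pos_part_nonneg in \<open>metis abs_of_nonneg ereal_less_eq(3)\<close>)
  then have "esssup (lebesgue_on \<Omega>) (\<lambda>x. ereal \<bar>u x\<bar>) \<le> ereal B" by (intro esssup_I) measurable
  then have "esssup (lebesgue_on \<Omega>) (\<lambda>x. ereal \<bar>u x\<bar>) < \<infinity>" by (rule le_less_trans) simp
  then show ?thesis by (simp add: Linfty_def data_measurable)
qed

end

end

theorem lemma5p6:
  fixes mul :: "real^'n::finite \<Rightarrow> real^'n \<Rightarrow> real^'n"
    and ginv :: "real^'n \<Rightarrow> real^'n"
    and k :: nat and \<sigma> :: "'n \<Rightarrow> nat"
    and \<rho> :: "real^'n \<Rightarrow> real"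
    and \<Omega> :: "(real^'n) set"
    and Q s p lam \<delta> q :: real
    and f g u :: "real^'n \<Rightarrow> real"
  assumes "stratified_lie_group mul ginv k \<sigma>"
    and "Q = real (homogeneous_dim k \<sigma>)"
    and "homogeneous_quasi_norm ginv \<sigma> \<rho>"
    and "open \<Omega>" and "connected \<Omega>" and "\<Omega> \<noteq> {}" and "bounded \<Omega>"
    and "lam > 0" and "0 < s" and "s < 1" and "0 < \<delta>" and "\<delta> < 1"
    and "1 < p" and "p < Q" and "Q > p * s"
    and "p < q + 1" and "q + 1 < critical_exponent Q s p"
    and "f \<in> Linfty \<Omega>" and "AE x in lebesgue_on \<Omega>. f x > 0"
    and "g \<in> Linfty \<Omega>" and "AE x in lebesgue_on \<Omega>. g x > 0"
    and "weak_solution mul ginv \<rho> Q s p \<Omega> lam \<delta> q f g u"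
    and "AE x in lebesgue_on \<Omega>. u x \<ge> 0"
  shows "u \<in> Linfty \<Omega>"
proof -
  interpret fractional_kernel mul ginv k \<sigma> \<rho> Q s p
    using assms
    by (intro fractional_kernel.intro quasi_normed_group.intro quasi_normed_group_axioms.intro fractional_kernel_axioms.intro) auto
  \<comment> \<open>Subcriticality is brought to the form needed by the iteration: the critical
    exponent is p / (1 - \<theta>).\<close>
  have "(q + 1) * (Q - p * s) < Q * p"
    using assms(15,17) by (simp add: critical_exponent_def pos_less_divide_eq mult.commute[of s p])
  then have "(q + 1) * (Q - p * s) / Q < p" using Q_pos by (simp add: pos_divide_less_eq mult.commute)
  moreover have "(q + 1) * (Q - p * s) / Q = (q + 1) * (1 - p * s / Q)" using Q_pos by (simp add: field_simps)
  ultimately have "(q + 1) * (1 - p * s / Q) < p" by simp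
  with assms show ?thesis by (intro solution_bounded[where u=u and f=f and g=g and \<Omega>=\<Omega> and lam=lam and \<delta>=\<delta> and q=q]) auto
qed

end
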